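(* Let $\mathscr{A}$ be a unital C*-algebra. The following statements hold: 1. If $L\in B(\mathscr{A})$ and $(e^{tL})_{t\geqslant 0}$ is a smoothly decomposable semigroup on $\mathscr{A}$, then $L = L_1 + L_2$ such that $L_2\in\mathsf{coCP}(\mathscr{A})$ and $L_{1,n} = \mathrm{id}_n\otimes L_1$ is a *-map which satisfies the inequality $$L_{1,n}(X^* X) - L_{1,n}(X^* )X - X^* L_{1,n}(X) + X^* L_{1,n}(\mathbf{1}) X \geqslant 0 \qquad (\ast)$$ for every $X\in M_n(\mathscr{A})$ and every $n\in\mathbb{N}$. 2. If a *-map $L_1\in B(\mathscr{A})$ satisfies $(\ast)$ for all $X\in M_n(\mathscr{A})$ and all $n\in\mathbb{N}$, and $L_2\in\mathsf{coCP}(\mathscr{A})$, then $e^{tL}\in\mathsf{D}(\mathscr{A})$ for $L = L_1+L_2$ and all $t\geqslant 0$.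
   Context: $\mathbf{1}$ is the unit of the relevant algebra (in $(\ast)$, of $M_n(\mathscr{A})$, the C*-algebra of $n\times n$ matrices over $\mathscr{A}$), and $B(\mathscr{A})$ is the Banach space of bounded linear maps $\mathscr{A}\to\mathscr{A}$. A *-map is a linear map $T$ with $T(a^* )=T(a)^*$ for all $a$. For $T\in B(\mathscr{A})$, $\mathrm{id}_n\otimes T$ acts on $M_n(\mathscr{A})$ by $[a_{ij}]\mapsto[T(a_{ij})]$. $T\in B(\mathscr{A})$ is completely positive, $T\in\mathsf{CP}(\mathscr{A})$, if $\mathrm{id}_n\otimes T$ is positive for all $n\in\mathbb{N}$. $T$ is completely copositive, $T\in\mathsf{coCP}(\mathscr{A})$, if for all $n\in\mathbb{N}$ the map $[a_{ij}]\mapsto[T(a_{ji})]$ on $M_n(\mathscr{A})$ is positive. $T$ is decomposable, $T\in\mathsf{D}(\mathscr{A})$, if $T=\phi_1+\phi_2$ with $\phi_1\in\mathsf{CP}(\mathscr{A})$, $\phi_2\in\mathsf{coCP}(\mathscr{A})$. The semigroup $(e^{tL})_{t\geqslant0}$ is smoothly decomposable if there are functions $t\mapsto\phi_t\in\mathsf{CP}(\mathscr{A})$ and $t\mapsto\chi_t\in\mathsf{coCP}(\mathscr{A})$, smooth on $[0,\infty)$ with respect to the norm of $B(\mathscr{A})$ (one-sided derivatives at $0$), such that $e^{tL}=\phi_t+\chi_t$ for all $t\geqslant 0$. The maps $e^{tL}$ are not assumed to be unital. *)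

theory Defs
  imports "HOL-Analysis.Analysis" "Jordan_Normal_Form.Matrix"
begin

section \<open>Unital C*-algebras\<close>

text \<open>
  The real scalar action of the underlying Banach algebra is required to be the restriction of
  the complex one.  As in \<open>real_normed_algebra_1\<close>, the unit is nonzero and has norm 1 (the latter
  is automatic in a nonzero unital C*-algebra).
\<close>

class cstar_algebra = real_normed_algebra_1 + banach +
  fixes scaleC :: "complex \<Rightarrow> 'a \<Rightarrow> 'a"  (infixr \<open>*\<^sub>C\<close> 75)
    and star :: "'a \<Rightarrow> 'a"
  assumes scaleC_add_right: "c *\<^sub>C (x + y) = c *\<^sub>C x + c *\<^sub>C y"
    and scaleC_add_left: "(c + d) *\<^sub>C x = c *\<^sub>C x + d *\<^sub>C x"
    and scaleC_scaleC: "c *\<^sub>C d *\<^sub>C x = (c * d) *\<^sub>C x"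
    and scaleC_of_real: "complex_of_real r *\<^sub>C x = r *\<^sub>R x"
    and mult_scaleC_left: "(c *\<^sub>C x) * y = c *\<^sub>C (x * y)"
    and mult_scaleC_right: "x * (c *\<^sub>C y) = c *\<^sub>C (x * y)"
    and norm_scaleC: "norm (c *\<^sub>C x) = cmod c * norm x"
    and star_star: "star (star x) = x"
    and star_add: "star (x + y) = star x + star y"
    and star_scaleC: "star (c *\<^sub>C x) = cnj c *\<^sub>C star x"
    and star_mult: "star (x * y) = star y * star x"
    and cstar_identity: "norm (star x * x) = (norm x)\<^sup>2"

instantiation complex :: cstar_algebra
begin

definition scaleC_complex :: "complex \<Rightarrow> complex \<Rightarrow> complex"
  where "scaleC_complex c x = c * x"

definition star_complex :: "complex \<Rightarrow> complex"
  where "star_complex x = cnj x"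

instance
  by standard
    (simp_all add: scaleC_complex_def star_complex_def algebra_simps norm_mult
      power2_eq_square scaleR_conv_of_real)

end


section \<open>Matrices over a C*-algebra\<close>

text \<open>
  \<open>M\<^sub>n(A)\<close> is \<open>carrier_mat n n\<close>, and \<open>id\<^sub>n \<otimes> T\<close> acts on it as \<open>map_mat T\<close>.
\<close>

definition mat_star :: "'a::cstar_algebra mat \<Rightarrow> 'a mat"
  where "mat_star X = transpose_mat (map_mat star X)"

definition mat_scaleC :: "complex \<Rightarrow> 'a::cstar_algebra mat \<Rightarrow> 'a mat"
  where "mat_scaleC c X = map_mat (scaleC c) X"

text \<open>Positive elements of the C*-algebra \<open>M\<^sub>n(A)\<close> are those of the form \<open>Y\<^sup>* Y\<close>.\<close>

definition mat_pos :: "nat \<Rightarrow> 'a::cstar_algebra mat \<Rightarrow> bool"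
  where "mat_pos n X \<longleftrightarrow> (\<exists>Y \<in> carrier_mat n n. X = mat_star Y * Y)"

definition mat_positive_map ::
    "nat \<Rightarrow> ('a::cstar_algebra mat \<Rightarrow> 'a mat) \<Rightarrow> bool"
  where "mat_positive_map n \<Phi> \<longleftrightarrow>
    (\<forall>X \<in> carrier_mat n n. mat_pos n X \<longrightarrow> mat_pos n (\<Phi> X))"

definition mat_star_map ::
    "nat \<Rightarrow> ('a::cstar_algebra mat \<Rightarrow> 'a mat) \<Rightarrow> bool"
  where "mat_star_map n \<Phi> \<longleftrightarrow>
    (\<forall>X \<in> carrier_mat n n. \<Phi> X \<in> carrier_mat n n) \<and>
    (\<forall>X \<in> carrier_mat n n. \<forall>Y \<in> carrier_mat n n. \<Phi> (X + Y) = \<Phi> X + \<Phi> Y) \<and>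
    (\<forall>c. \<forall>X \<in> carrier_mat n n. \<Phi> (mat_scaleC c X) = mat_scaleC c (\<Phi> X)) \<and>
    (\<forall>X \<in> carrier_mat n n. \<Phi> (mat_star X) = mat_star (\<Phi> X))"


section \<open>Bounded maps on a C*-algebra\<close>

text \<open>
  \<open>'a \<Rightarrow>\<^sub>L 'a\<close> consists of the bounded \<^emph>\<open>real\<close>-linear maps; \<open>B(A)\<close> is its subspace of
  complex-linear maps, with the same operator norm.
\<close>

definition B_op :: "('a::cstar_algebra \<Rightarrow>\<^sub>L 'a) set"
  where "B_op = {T :: 'a \<Rightarrow>\<^sub>L 'a. \<forall>c x. T (c *\<^sub>C x) = c *\<^sub>C T x}"

definition star_map :: "('a::cstar_algebra \<Rightarrow>\<^sub>L 'a) \<Rightarrow> bool"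
  where "star_map T \<longleftrightarrow> T \<in> B_op \<and> (\<forall>a. T (star a) = star (T a))"

definition CP :: "('a::cstar_algebra \<Rightarrow>\<^sub>L 'a) set"
  where "CP = {T \<in> B_op. \<forall>n. mat_positive_map n (map_mat (blinfun_apply T))}"

definition coCP :: "('a::cstar_algebra \<Rightarrow>\<^sub>L 'a) set"
  where "coCP = {T \<in> B_op. \<forall>n. mat_positive_map n (\<lambda>X. map_mat (blinfun_apply T) (transpose_mat X))}"

definition decomposable :: "('a::cstar_algebra \<Rightarrow>\<^sub>L 'a) set"
  where "decomposable = {T. \<exists>\<phi>1 \<in> CP. \<exists>\<phi>2 \<in> coCP. T = \<phi>1 + \<phi>2}"

text \<open>
  The type \<open>'a \<Rightarrow>\<^sub>L 'a\<close> is not an instance of the algebra classes on which \<open>exp\<close> is defined, so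
  the norm-convergent exponential series with respect to composition is written out.
\<close>

definition op_exp :: "('a::cstar_algebra \<Rightarrow>\<^sub>L 'a) \<Rightarrow> ('a \<Rightarrow>\<^sub>L 'a)"
  where "op_exp T = (\<Sum>k. ((\<lambda>S. T o\<^sub>L S) ^^ k) id_blinfun /\<^sub>R fact k)"

text \<open>
  \<open>D k\<close> is the \<open>k\<close>-th derivative; the filter \<open>at t within {0..}\<close> makes it one-sided at \<open>0\<close>.
\<close>

definition smooth_halfline :: "(real \<Rightarrow> 'b::real_normed_vector) \<Rightarrow> bool"
  where "smooth_halfline f \<longleftrightarrow>
    (\<exists>D :: nat \<Rightarrow> real \<Rightarrow> 'b. D 0 = f \<and>
      (\<forall>k. \<forall>t\<ge>0. (D k has_vector_derivative D (Suc k) t) (at t within {0..})))"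

definition smoothly_decomposable :: "(real \<Rightarrow> ('a::cstar_algebra \<Rightarrow>\<^sub>L 'a)) \<Rightarrow> bool"
  where "smoothly_decomposable S \<longleftrightarrow>
    (\<exists>\<phi> \<psi>. smooth_halfline \<phi> \<and> smooth_halfline \<psi> \<and>
      (\<forall>t\<ge>0. \<phi> t \<in> CP \<and> \<psi> t \<in> coCP \<and> S t = \<phi> t + \<psi> t))"

definition dissipation_ineq :: "nat \<Rightarrow> ('a::cstar_algebra mat \<Rightarrow> 'a mat) \<Rightarrow> bool"
  where "dissipation_ineq n \<Phi> \<longleftrightarrow>
    (\<forall>X \<in> carrier_mat n n.
      mat_pos n (\<Phi> (mat_star X * X) - \<Phi> (mat_star X) * X - mat_star X * \<Phi> X
                   + mat_star X * \<Phi> (1\<^sub>m n) * X))"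

end

(*
  Part 1.  At t = 0 the decomposition phi + psi = id forces phi = (1 - h) and psi = h to be
  multiplications by central elements with h [x, y] = 0: the dissipation inequalities of phi and psi add up
  to psi (x x^* ) - psi (x^* x) >= 0, which is odd under x <-> x^*, so both are equalities.  Let K', K be the
  derivatives of phi, psi at 0.  Both are conditionally positive in their respective sense, but K
  need not be completely copositive.  Since psi_t = h + t K + O(t^2) is positive, the negative
  diagonal part of K is of order sqrt h, and L = (K' - C sqrt h) + (K + C sqrt h) is the desired splitting;
  multiplication by the central element sqrt h does not contribute to the dissipation form.

  Part 2.  The parts of exp (t (L1 + L2)) that are even and odd in L2 satisfy E' = L1 E + L2 F and
  F' = L1 F + L2 E.  Dissipativity of L1 and copositivity of L2 show that one small Euler step
  decreases the lower bounds of the two positivity forms by a second order term only, so a discrete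
  Gronwall argument gives E in CP and F in coCP.

  Positivity in M_n(A) is reduced to A: a matrix is Y^* Y iff its quadratic form on A^n has positive
  values.  Square roots come from the binomial series of sqrt (1 - e), in A and entrywise in M_n(A).
*)

theory Submission
  imports Defs
begin

section \<open>The involution\<close>

text \<open>The derivative \<open>K\<close> of \<open>\<psi>\<close> can fail to be completely
  copositive because \<open>\<psi> 0\<close> is multiplication by \<open>h\<close>, so the
  difference quotients of \<open>\<psi>\<close> at 0 need not be positive. A correction of
  \<open>K\<close> must be invisible to the dissipation inequality; multiplication by a central
  element is, and only its size has to be found. Where \<open>h\<close> takes the value q,
  positivity of \<open>\<psi> t\<close> bounds \<open>K\<close> below by -(q / t + M t), relative to
  the size of the argument. The best t is of order sqrt q, hence the square root of
  \<open>h\<close>. In general \<open>h\<close> is not a projection, so the algebra does not split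
  into a commutative and a noncommutative summand. The distinction is made state by state instead: a
  state with q > 0 is a character, and a state with q = 0 calls for no correction. In Part 2,
  composing an even number of completely copositive maps with completely positive ones gives a
  completely positive map, an odd number a completely copositive one; this is why parity in
  \<open>L2\<close> separates the two summands. A single Euler step is not positive, but it loses
  only O(e^2), with a constant uniform on [0, T], and T / e steps lose O(e).\<close>

lemma star_0 [simp]: "star (0::'a::cstar_algebra) = 0"
  using star_add[of 0 "0::'a"] by simp

lemma star_1 [simp]: "star (1::'a::cstar_algebra) = 1"
  by (metis mult_1_left mult_1_right star_mult star_star)

declare star_star [simp]

lemma star_minus: "star (- x) = - star (x::'a::cstar_algebra)"
  using star_add[of x "- x"] by (simp add: eq_neg_iff_add_eq_0 add.commute)

lemma star_diff: "star (x - y) = star x - star (y::'a::cstar_algebra)"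
  using star_add[of x "- y"] by (simp add: star_minus)

lemma star_scaleR: "star (r *\<^sub>R x) = r *\<^sub>R star (x::'a::cstar_algebra)"
  by (metis star_scaleC scaleC_of_real complex_cnj_complex_of_real)

lemma star_sum: "star (sum f I) = (\<Sum>i\<in>I. star (f i :: 'a::cstar_algebra))"
  by (induction I rule: infinite_finite_induct) (simp_all add: star_add)

lemma star_power: "star (x ^ k) = star (x::'a::cstar_algebra) ^ k"
  by (induction k) (simp_all add: star_mult power_commutes)

lemma norm_star [simp]: "norm (star x) = norm (x::'a::cstar_algebra)"
proof -
  have le: "norm y \<le> norm (star y)" for y :: 'a
  proof (cases "y = 0")
    case False
    have "(norm y)\<^sup>2 \<le> norm (star y) * norm y"
      by (metis cstar_identity norm_mult_ineq)
    then show ?thesis using False by (simp add: power2_eq_square)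
  qed simp
  show ?thesis using le[of x] le[of "star x"] by simp
qed

lemma bounded_linear_star: "bounded_linear (star :: 'a::cstar_algebra \<Rightarrow> 'a)"
  by (rule bounded_linear_intro[where K = 1]) (simp_all add: star_add star_scaleR)

lemmas tendsto_star = bounded_linear.tendsto[OF bounded_linear_star]

lemmas star_simps = star_add star_diff star_minus star_mult star_scaleR star_sum star_power star_scaleC

lemma scaleC_zero_right [simp]: "c *\<^sub>C (0::'a::cstar_algebra) = 0"
  using scaleC_add_right[of c 0 "0::'a"] by simp

lemma scaleC_one [simp]: "1 *\<^sub>C (x::'a::cstar_algebra) = x"
  using scaleC_of_real[of 1 x] by simp

lemma scaleC_minus_right: "c *\<^sub>C (- x) = - (c *\<^sub>C (x::'a::cstar_algebra))"
  using scaleC_add_right[of c x "- x"] by (simp add: eq_neg_iff_add_eq_0 add.commute)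

lemma scaleC_diff_right: "c *\<^sub>C (x - y) = c *\<^sub>C x - c *\<^sub>C (y::'a::cstar_algebra)"
  using scaleC_add_right[of c x "- y"] by (simp add: scaleC_minus_right)

lemma scaleC_minus_left: "(- c) *\<^sub>C x = - (c *\<^sub>C (x::'a::cstar_algebra))"
  using scaleC_add_left[of c "- c" x] scaleC_of_real[of 0 x]
  by (simp add: eq_neg_iff_add_eq_0 add.commute)

lemma scaleC_sum_right: "c *\<^sub>C sum f I = (\<Sum>i\<in>I. c *\<^sub>C (f i :: 'a::cstar_algebra))"
  by (induction I rule: infinite_finite_induct) (simp_all add: scaleC_add_right)

lemma scaleC_i_i: "\<i> *\<^sub>C \<i> *\<^sub>C x = - (x::'a::cstar_algebra)"
  by (simp add: scaleC_scaleC scaleC_minus_left)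

lemma scaleC_scaleR: "c *\<^sub>C (r *\<^sub>R x) = r *\<^sub>R (c *\<^sub>C (x::'a::cstar_algebra))"
  by (simp add: scaleC_of_real[symmetric] scaleC_scaleC mult.commute)

lemma bounded_linear_scaleC: "bounded_linear (\<lambda>x::'a::cstar_algebra. c *\<^sub>C x)"
  by (rule bounded_linear_intro[where K = "cmod c"])
    (simp_all add: scaleC_add_right scaleC_scaleR norm_scaleC mult.commute)

lemma scaleC_decomp: "c *\<^sub>C x = Re c *\<^sub>R x + Im c *\<^sub>R (\<i> *\<^sub>C (x::'a::cstar_algebra))"
proof -
  have "c *\<^sub>C x = (complex_of_real (Re c) + complex_of_real (Im c) * \<i>) *\<^sub>C x"
    by (metis complex_eq mult.commute)
  also have "\<dots> = complex_of_real (Re c) *\<^sub>C x + complex_of_real (Im c) *\<^sub>C \<i> *\<^sub>C x"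
    by (simp add: scaleC_add_left scaleC_scaleC)
  finally show ?thesis by (simp add: scaleC_of_real)
qed

section \<open>Square roots by the binomial series\<close>

text \<open>The coefficient of x^k in the Taylor series of sqrt (1 - x).\<close>

definition sqrt_coeff :: "nat \<Rightarrow> real"
  where "sqrt_coeff k = ((1/2) gchoose k) * (-1) ^ k"

lemma sqrt_coeff_0 [simp]: "sqrt_coeff 0 = 1"
  by (simp add: sqrt_coeff_def)

text \<open>The Vandermonde identity for 1/2 + 1/2 = 1: the series squares to 1 - x.\<close>

lemma sqrt_coeff_convolution:
  "(\<Sum>i\<le>k. sqrt_coeff i * sqrt_coeff (k - i)) = (if k = 0 then 1 else if k = 1 then -1 else 0)"
proof -
  have "(\<Sum>i\<le>k. sqrt_coeff i * sqrt_coeff (k - i))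
      = (\<Sum>i\<le>k. ((1/2) gchoose i) * ((1/2) gchoose (k - i)) * (-1) ^ k)"
    by (rule sum.cong) (auto simp: sqrt_coeff_def power_add[symmetric])
  also have "\<dots> = ((1 :: real) gchoose k) * (-1) ^ k"
    using gbinomial_Vandermonde[of "1/2 :: real" "1/2" k]
    by (simp add: sum_distrib_right[symmetric] atMost_atLeast0)
  also have "(1 :: real) gchoose k = of_nat (1 choose k)"
    by (metis binomial_gbinomial of_nat_1)
  finally show ?thesis
    by (cases k) (auto simp: binomial_eq_0)
qed

text \<open>Apart from its first factor -1/2, every factor of \<open>pochhammer (- 1 / 2) k\<close>
  is positive. The constant sign turns sums of absolute values into partial sums of the series
  itself.\<close>

lemma sqrt_coeff_nonpos:
  assumes "k \<ge> 1" shows "sqrt_coeff k \<le> 0"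
proof -
  obtain j where j: "k = Suc j" using assms by (cases k) auto
  have "pochhammer (- 1 / 2 :: real) k = - 1 / 2 * pochhammer (1 / 2) j"
    unfolding j by (simp add: pochhammer_rec)
  moreover have "pochhammer (1 / 2 :: real) j \<ge> 0"
    by (intro less_imp_le pochhammer_pos) simp
  ultimately have "pochhammer (- 1 / 2 :: real) k \<le> 0" by linarith
  moreover have "sqrt_coeff k = ((-1) ^ k * (-1) ^ k) * pochhammer (- 1 / 2) k / fact k"
    by (simp add: sqrt_coeff_def gbinomial_pochhammer)
  then have "sqrt_coeff k = pochhammer (- 1 / 2) k / fact k"
    by (simp add: power_mult_distrib[symmetric])
  ultimately show ?thesis by (simp add: divide_nonpos_pos)
qed

text \<open>The absolute values up to index \<open>n\<close> add up to 2 minus the partial sum of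
  the series at x = 1, and that partial sum is the nonnegative number
  \<open>pochhammer (1 / 2) n / fact n\<close>.\<close>

lemma sum_abs_sqrt_coeff_le: "(\<Sum>k<n. \<bar>sqrt_coeff k\<bar>) \<le> 2"
proof -
  have "(\<Sum>k\<le>n. sqrt_coeff k) = (-1) ^ n * ((1/2 - 1 :: real) gchoose n)"
    unfolding sqrt_coeff_def by (rule gbinomial_sum_lower_neg)
  also have "\<dots> = pochhammer (1 / 2) n / fact n"
    by (simp add: gbinomial_pochhammer power_mult_distrib[symmetric])
  also have "\<dots> \<ge> 0"
    by (intro divide_nonneg_pos less_imp_le pochhammer_pos) simp_all
  finally have pos: "(\<Sum>k\<le>n. sqrt_coeff k) \<ge> 0" .
  have "(\<Sum>k<n. \<bar>sqrt_coeff k\<bar>) \<le> (\<Sum>k\<le>n. \<bar>sqrt_coeff k\<bar>)"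
    by (rule sum_mono2) auto
  also have "\<dots> = (\<Sum>k\<le>n. (if k = 0 then 2 else 0) - sqrt_coeff k)"
    by (rule sum.cong) (use sqrt_coeff_nonpos in \<open>auto simp: abs_if not_less intro: antisym\<close>)
  also have "\<dots> = 2 - (\<Sum>k\<le>n. sqrt_coeff k)"
    by (simp add: sum_subtractf)
  finally show ?thesis using pos by linarith
qed

lemma summable_abs_sqrt_coeff: "summable (\<lambda>k. \<bar>sqrt_coeff k\<bar>)"
  by (rule summableI_nonneg_bounded[OF _ sum_abs_sqrt_coeff_le]) simp

lemma suminf_abs_sqrt_coeff_Suc: "(\<Sum>k. \<bar>sqrt_coeff (Suc k)\<bar>) \<le> 1"
  using suminf_le_const[OF summable_abs_sqrt_coeff sum_abs_sqrt_coeff_le]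
    suminf_split_head[OF summable_abs_sqrt_coeff] by simp

text \<open>Absolute summability of the coefficients admits the boundary case
  \<open>norm e = 1\<close>, which non-invertible \<open>1 - e\<close> require. The estimate for
  \<open>1 - s\<close> comes from the tail after the constant term, whose coefficients have absolute
  sum at most 1; it later shows that the root is positive.\<close>

lemma sqrt_series:
  fixes e :: "'a::cstar_algebra"
  assumes "star e = e" and "norm e \<le> 1"
  obtains s where "star s = s" and "s * s = 1 - e" and "\<And>x. x * e = e * x \<Longrightarrow> x * s = s * x"
    and "norm (1 - s) \<le> 1"
proof -
  define f where "f k = sqrt_coeff k *\<^sub>R e ^ k" for k
  have f_le: "norm (f k) \<le> \<bar>sqrt_coeff k\<bar>" for k
  proof -
    have "norm (e ^ k) \<le> 1"
      using norm_power_ineq[of e k] power_le_one[OF norm_ge_zero assms(2), of k] by linarith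
    then show ?thesis by (simp add: f_def mult_left_le)
  qed
  then have nf: "summable (\<lambda>k. norm (f k))"
    by (intro summable_comparison_test'[OF summable_abs_sqrt_coeff, of 0]) simp
  then have sf: "summable f" by (rule summable_norm_cancel)
  define s where "s = suminf f"
  have "star s = (\<Sum>k. star (f k))"
    unfolding s_def by (rule bounded_linear.suminf[OF bounded_linear_star sf])
  moreover have "star (f k) = f k" for k
    by (simp add: f_def star_scaleR star_power assms)
  ultimately have 1: "star s = s"
    by (simp add: s_def)
  have "s * s = (\<Sum>k. \<Sum>i\<le>k. f i * f (k - i))"
    unfolding s_def by (rule Cauchy_product[OF nf nf])
  also have "(\<lambda>k. \<Sum>i\<le>k. f i * f (k - i)) = (\<lambda>k. (if k = 0 then 1 else if k = 1 then -1 else 0) *\<^sub>R e ^ k)"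
  proof
    fix k
    have "(\<Sum>i\<le>k. f i * f (k - i)) = (\<Sum>i\<le>k. (sqrt_coeff i * sqrt_coeff (k - i)) *\<^sub>R e ^ k)"
      by (rule sum.cong) (auto simp: f_def power_add[symmetric])
    then show "(\<Sum>i\<le>k. f i * f (k - i)) = (if k = 0 then 1 else if k = 1 then -1 else 0) *\<^sub>R e ^ k"
      by (simp only: scaleR_sum_left[symmetric] sqrt_coeff_convolution)
  qed
  also have "(\<Sum>k. (if k = 0 then 1 else if k = 1 then -1 else 0 :: real) *\<^sub>R e ^ k)
      = (\<Sum>k\<in>{0,1}. (if k = 0 then 1 else if k = 1 then -1 else 0 :: real) *\<^sub>R e ^ k)"
    by (rule suminf_finite) auto
  finally have 2: "s * s = 1 - e" by simp
  have 3: "x * s = s * x" if "x * e = e * x" for x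
  proof -
    have "x * e ^ k = e ^ k * x" for k
      by (induction k) (simp_all, metis mult.assoc that)
    then show ?thesis
      unfolding s_def by (simp add: suminf_mult[OF sf, symmetric] suminf_mult2[OF sf] f_def)
  qed
  have "1 - s = - (\<Sum>k. f (Suc k))"
    using suminf_split_head[OF sf] by (simp add: s_def f_def)
  then have "norm (1 - s) = norm (\<Sum>k. f (Suc k))" by simp
  also have "\<dots> \<le> (\<Sum>k. \<bar>sqrt_coeff (Suc k)\<bar>)"
  proof (rule order_trans[OF summable_norm suminf_le])
    show nf': "summable (\<lambda>k. norm (f (Suc k)))" using nf by (subst summable_Suc_iff)
    then show "summable (\<lambda>k. norm (f (Suc k)))" .
    show "summable (\<lambda>k. \<bar>sqrt_coeff (Suc k)\<bar>)"
      using summable_abs_sqrt_coeff by (subst summable_Suc_iff)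
  qed (rule f_le)
  finally have 4: "norm (1 - s) \<le> 1"
    using suminf_abs_sqrt_coeff_Suc by linarith
  show thesis using 1 2 3 4 by (rule that)
qed


section \<open>Positive elements\<close>

text \<open>A definition without the spectrum. Squares of self-adjoint elements are chosen instead
  of products \<open>star y * y\<close>; that the latter are positive in this sense is a theorem,
  \<open>nonneg_star_mult\<close>.\<close>

definition nonneg :: "'a::cstar_algebra \<Rightarrow> bool"
  where "nonneg a \<longleftrightarrow> (\<exists>s. star s = s \<and> a = s * s)"

lemma nonneg_star: "nonneg a \<Longrightarrow> star a = a"
  by (auto simp: nonneg_def star_mult)

lemma norm_selfadjoint_square: "star s = s \<Longrightarrow> norm (s * s) = (norm (s::'a::cstar_algebra))\<^sup>2"
  by (metis cstar_identity)

text \<open>For \<open>r > 0\<close> the norm condition says that \<open>a / r\<close> lies in the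
  unit ball around 1, so the binomial series applies to \<open>e = 1 - a / r\<close>. The root
  satisfies a condition of the same shape, with \<open>sqrt r\<close>.\<close>

lemma sqrt_exists:
  fixes a :: "'a::cstar_algebra"
  assumes "star a = a" and "norm (r *\<^sub>R 1 - a) \<le> r"
  obtains s where "star s = s" and "s * s = a" and "\<And>x. x * a = a * x \<Longrightarrow> x * s = s * x"
    and "norm (sqrt r *\<^sub>R 1 - s) \<le> sqrt r"
proof (cases "r = 0")
  case True
  then have "a = 0" using assms by simp
  then show thesis using that[of 0] True by simp
next
  case False
  have r: "r > 0" using assms(2) False norm_ge_zero[of "r *\<^sub>R 1 - a"] by linarith
  define e where "e = 1 - inverse r *\<^sub>R a"
  have "e = inverse r *\<^sub>R (r *\<^sub>R 1 - a)" using r by (simp add: e_def scaleR_diff_right)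
  then have "norm e = norm (r *\<^sub>R 1 - a) / r" using r by (simp add: divide_inverse mult.commute)
  then have "norm e \<le> 1" using assms(2) r by simp
  moreover have "star e = e" by (simp add: e_def star_simps assms)
  ultimately obtain s where s: "star s = s" "s * s = 1 - e"
      "\<And>x. x * e = e * x \<Longrightarrow> x * s = s * x" "norm (1 - s) \<le> 1"
    using sqrt_series by metis
  show thesis
  proof (rule that[of "sqrt r *\<^sub>R s"])
    show "star (sqrt r *\<^sub>R s) = sqrt r *\<^sub>R s" by (simp add: star_simps s)
    have "(sqrt r *\<^sub>R s) * (sqrt r *\<^sub>R s) = (sqrt r * sqrt r) *\<^sub>R (s * s)" by simp
    then show "(sqrt r *\<^sub>R s) * (sqrt r *\<^sub>R s) = a" using r by (simp add: s(2) e_def)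
    have "sqrt r *\<^sub>R 1 - sqrt r *\<^sub>R s = sqrt r *\<^sub>R (1 - s)" by (simp add: scaleR_diff_right)
    then have "norm (sqrt r *\<^sub>R 1 - sqrt r *\<^sub>R s) = sqrt r * norm (1 - s)" using r by simp
    then show "norm (sqrt r *\<^sub>R 1 - sqrt r *\<^sub>R s) \<le> sqrt r"
      using r s(4) by (simp add: mult_left_le)
    fix x assume "x * a = a * x"
    then have "x * e = e * x" by (simp add: e_def algebra_simps)
    then show "x * (sqrt r *\<^sub>R s) = (sqrt r *\<^sub>R s) * x" using s(3) by simp
  qed
qed

lemma norm_unitary:
  fixes s c :: "'a::cstar_algebra"
  assumes "star s = s" "star c = c" "s * c = c * s" "s * s + c * c = 1"
  shows "norm (c + \<i> *\<^sub>C s) = 1"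
proof -
  have "star (c + \<i> *\<^sub>C s) * (c + \<i> *\<^sub>C s) = 1"
    using assms(3,4) by (simp add: star_simps assms(1,2) scaleC_minus_left algebra_simps
        mult_scaleC_left mult_scaleC_right scaleC_i_i scaleC_add_right scaleC_diff_right)
  then have "(norm (c + \<i> *\<^sub>C s))\<^sup>2 = 1"
    by (metis cstar_identity norm_one)
  then show ?thesis by (metis abs_norm_cancel power2_eq_1_iff abs_1 abs_minus_cancel)
qed

text \<open>With \<open>c = \<surd>(1 - s\<^sup>2)\<close>, the element \<open>u = c + \<i> s\<close> is unitary and \<open>1 - 2 s\<^sup>2\<close> is the real part of \<open>u\<^sup>2\<close>.\<close>

lemma norm_one_minus_two_square:
  fixes s :: "'a::cstar_algebra"
  assumes "star s = s" "norm s \<le> 1"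
  shows "norm (1 - 2 *\<^sub>R (s * s)) \<le> 1"
proof -
  have "norm (s * s) \<le> 1" using assms by (simp add: norm_selfadjoint_square power_le_one)
  then obtain c where c: "star c = c" "c * c = 1 - s * s" "\<And>x. x * (s * s) = (s * s) * x \<Longrightarrow> x * c = c * x"
    using sqrt_series[of "s * s"] assms(1) by (metis star_mult)
  have sc: "s * c = c * s" using c(3)[of s] by (simp add: mult.assoc)
  define u where "u = c + \<i> *\<^sub>C s"
  have u: "norm u = 1" unfolding u_def using norm_unitary[OF assms(1) c(1) sc] c(2) by simp
  have "u * u + star (u * u) = 2 *\<^sub>R (c * c - s * s)"
    using sc by (simp add: u_def star_simps assms(1) c(1) scaleC_minus_left algebra_simps
        mult_scaleC_left mult_scaleC_right scaleC_i_i scaleC_add_right scaleC_diff_right scaleR_2)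
  then have "1 - 2 *\<^sub>R (s * s) = (1/2) *\<^sub>R (u * u + star (u * u))"
    by (simp add: c(2) scaleR_2)
  also have "norm \<dots> \<le> (1/2) * (norm (u * u) + norm (star (u * u)))"
    using norm_triangle_ineq[of "u * u" "star (u * u)"] by simp
  also have "\<dots> \<le> 1"
    using norm_mult_ineq[of u u] u by simp
  finally show ?thesis .
qed

text \<open>With \<open>v = s / sqrt r\<close> the difference \<open>r - a\<close> equals
  \<open>(r / 2) (1 + (1 - 2 v^2))\<close>, and the second factor has norm at most 2 because
  \<open>1 - 2 v^2\<close> is a contraction.\<close>

lemma nonneg_norm_le:
  fixes a :: "'a::cstar_algebra"
  assumes "nonneg a" "norm a \<le> r"
  shows "norm (r *\<^sub>R 1 - a) \<le> r"
proof (cases "r = 0")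
  case True then show ?thesis using assms by simp
next
  case False
  then have r: "r > 0" using assms(2) norm_ge_zero[of a] by linarith
  obtain s where s: "star s = s" "a = s * s" using assms(1) by (auto simp: nonneg_def)
  define v where "v = inverse (sqrt r) *\<^sub>R s"
  have vv: "v * v = inverse r *\<^sub>R a"
    using r by (simp add: v_def s inverse_mult_distrib[symmetric] del: inverse_mult_distrib)
  have v: "star v = v" by (simp add: v_def star_simps s)
  have "(norm v)\<^sup>2 \<le> 1"
    using norm_selfadjoint_square[OF v] r assms(2) by (simp add: vv field_simps)
  then have "norm v \<le> 1" by (simp add: power_le_one_iff abs_square_le_1)
  then have "norm (1 - 2 *\<^sub>R (v * v)) \<le> 1" using norm_one_minus_two_square v by blast
  moreover have "r *\<^sub>R 1 - a = (r / 2) *\<^sub>R (1 + (1 - 2 *\<^sub>R (v * v)))"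
    using r by (simp add: vv algebra_simps flip: scaleR_2)
  then have "norm (r *\<^sub>R 1 - a) = (r / 2) * norm (1 + (1 - 2 *\<^sub>R (v * v)))"
    using r by (simp only: norm_scaleR)
  moreover have "norm (1 + (1 - 2 *\<^sub>R (v * v))) \<le> norm (1::'a) + norm (1 - 2 *\<^sub>R (v * v))"
    by (rule norm_triangle_ineq)
  moreover have "norm (1::'a) + norm (1 - 2 *\<^sub>R (v * v)) \<le> 2"
    using \<open>norm (1 - 2 *\<^sub>R (v * v)) \<le> 1\<close> by (simp only: norm_one)
  ultimately have "norm (1 + (1 - 2 *\<^sub>R (v * v))) \<le> 2" by linarith
  then have "(r / 2) * norm (1 + (1 - 2 *\<^sub>R (v * v))) \<le> (r / 2) * 2"
    using r by (intro mult_left_mono) simp_all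
  then show ?thesis
    using \<open>norm (r *\<^sub>R 1 - a) = (r / 2) * norm (1 + (1 - 2 *\<^sub>R (v * v)))\<close> by linarith
qed

text \<open>Replaces the spectral description of positivity by a norm inequality, which passes to
  sums and limits where the existence of a square root does not visibly do so.\<close>

lemma nonneg_iff:
  fixes a :: "'a::cstar_algebra"
  shows "nonneg a \<longleftrightarrow> star a = a \<and> (\<exists>r. norm (r *\<^sub>R 1 - a) \<le> r)"
proof
  assume "nonneg a"
  then show "star a = a \<and> (\<exists>r. norm (r *\<^sub>R 1 - a) \<le> r)"
    using nonneg_norm_le[OF _ order_refl] nonneg_star by blast
next
  assume "star a = a \<and> (\<exists>r. norm (r *\<^sub>R 1 - a) \<le> r)"
  then obtain r where "star a = a" "norm (r *\<^sub>R 1 - a) \<le> r" by blast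
  then obtain s where "star s = s" "s * s = a" by (rule sqrt_exists)
  then show "nonneg a" unfolding nonneg_def by blast
qed

lemma nonneg_sqrt:
  fixes a :: "'a::cstar_algebra"
  assumes "nonneg a"
  obtains s where "nonneg s" and "star s = s" and "s * s = a" and "\<And>x. x * a = a * x \<Longrightarrow> x * s = s * x"
proof (rule sqrt_exists[OF nonneg_star[OF assms] nonneg_norm_le[OF assms order_refl]])
  fix s
  assume s: "star s = s" "s * s = a" "\<And>x. x * a = a * x \<Longrightarrow> x * s = s * x"
    "norm (sqrt (norm a) *\<^sub>R 1 - s) \<le> sqrt (norm a)"
  have "nonneg s" unfolding nonneg_iff using s(1,4) by blast
  then show thesis using s(1-3) by (rule that)
qed

lemma nonneg_0 [simp]: "nonneg 0" by (auto simp: nonneg_def intro!: exI[of _ 0])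
lemma nonneg_1 [simp]: "nonneg 1" by (auto simp: nonneg_def intro!: exI[of _ 1])

lemma nonneg_add:
  fixes a b :: "'a::cstar_algebra"
  assumes "nonneg a" "nonneg b" shows "nonneg (a + b)"
proof -
  have "norm ((norm a + norm b) *\<^sub>R 1 - (a + b)) \<le> norm (norm a *\<^sub>R 1 - a) + norm (norm b *\<^sub>R 1 - b)"
    using norm_triangle_ineq[of "norm a *\<^sub>R 1 - a" "norm b *\<^sub>R 1 - b"] by (simp add: algebra_simps)
  also have "\<dots> \<le> norm a + norm b"
    using nonneg_norm_le[OF assms(1) order_refl] nonneg_norm_le[OF assms(2) order_refl] by simp
  finally show ?thesis using assms by (auto simp: nonneg_iff star_simps)
qed

lemma nonneg_scaleR:
  fixes a :: "'a::cstar_algebra"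
  assumes "nonneg a" "r \<ge> 0" shows "nonneg (r *\<^sub>R a)"
proof -
  obtain s where s: "star s = s" "a = s * s" using assms(1) by (auto simp: nonneg_def)
  have "(sqrt r *\<^sub>R s) * (sqrt r *\<^sub>R s) = (sqrt r * sqrt r) *\<^sub>R (s * s)" by simp
  then have "r *\<^sub>R a = (sqrt r *\<^sub>R s) * (sqrt r *\<^sub>R s)" using assms(2) s(2) by simp
  moreover have "star (sqrt r *\<^sub>R s) = sqrt r *\<^sub>R s" by (simp add: star_simps s(1))
  ultimately show ?thesis unfolding nonneg_def by blast
qed

lemma nonneg_limit:
  fixes f :: "'b \<Rightarrow> 'a::cstar_algebra"
  assumes "(f \<longlongrightarrow> a) F" "eventually (\<lambda>x. nonneg (f x)) F" "F \<noteq> bot"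
  shows "nonneg a"
proof -
  have "eventually (\<lambda>x. star (f x) = f x) F"
    using assms(2) by eventually_elim (rule nonneg_star)
  then have "(f \<longlongrightarrow> star a) F"
    by (rule Lim_transform_eventually[OF tendsto_star[OF assms(1)]])
  then have "star a = a" by (rule tendsto_unique[OF assms(3) _ assms(1)])
  moreover have "((\<lambda>x. norm (f x) *\<^sub>R (1::'a)) \<longlongrightarrow> norm a *\<^sub>R 1) F"
    by (rule tendsto_scaleR[OF tendsto_norm[OF assms(1)] tendsto_const])
  then have "((\<lambda>x. norm (norm (f x) *\<^sub>R 1 - f x)) \<longlongrightarrow> norm (norm a *\<^sub>R 1 - a)) F"
    by (rule tendsto_norm[OF tendsto_diff[OF _ assms(1)]])
  then have "norm (norm a *\<^sub>R 1 - a) \<le> norm a"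
  proof (rule tendsto_le[OF assms(3) tendsto_norm[OF assms(1)]])
    show "\<forall>\<^sub>F x in F. norm (norm (f x) *\<^sub>R 1 - f x) \<le> norm (f x)"
      using assms(2) by eventually_elim (simp add: nonneg_norm_le)
  qed
  ultimately show ?thesis by (auto simp: nonneg_iff)
qed

text \<open>Each root commutes with everything that commutes with its square. So \<open>s\<close>
  and \<open>t\<close> commute, and \<open>s t\<close> is a self-adjoint root of
  \<open>a b\<close>.\<close>

lemma nonneg_mult:
  fixes a b :: "'a::cstar_algebra"
  assumes "nonneg a" "nonneg b" "a * b = b * a"
  shows "nonneg (a * b)"
proof -
  obtain s where s: "nonneg s" "star s = s" "s * s = a" "\<And>x. x * a = a * x \<Longrightarrow> x * s = s * x"
    by (rule nonneg_sqrt[OF assms(1)]) (rule that)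
  obtain t where t: "nonneg t" "star t = t" "t * t = b" "\<And>x. x * b = b * x \<Longrightarrow> x * t = t * x"
    by (rule nonneg_sqrt[OF assms(2)]) (rule that)
  have "s * b = b * s" using s(4)[of b] assms(3) by simp
  then have st: "s * t = t * s" by (rule t(4))
  have "a * b = (s * t) * (s * t)"
  proof -
    have "(s * t) * (s * t) = s * (t * s) * t" by (simp add: mult.assoc)
    also have "\<dots> = (s * s) * (t * t)" by (simp add: st[symmetric] mult.assoc)
    finally show ?thesis by (simp add: s t)
  qed
  moreover have "star (s * t) = s * t" by (simp add: star_simps s t st)
  ultimately show ?thesis unfolding nonneg_def by blast
qed

lemma nonneg_bound:
  fixes a :: "'a::cstar_algebra"
  assumes "star a = a" "norm a \<le> r"
  shows "nonneg (r *\<^sub>R 1 - a)" "nonneg (r *\<^sub>R 1 + a)"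
  using assms by (auto simp: nonneg_iff star_simps intro!: exI[of _ r])

lemma nonneg_norm_mono:
  fixes a :: "'a::cstar_algebra"
  assumes "nonneg a" "nonneg (r *\<^sub>R 1 - a)" "r \<ge> 0"
  shows "norm a \<le> r"
proof -
  \<comment> \<open>With roots \<open>s\<close> of \<open>x\<close> and \<open>c\<close> of
    \<open>1 - x\<close>, both \<open>c + \<i> s\<close> and \<open>c - \<i> s\<close> are unitary,
    and \<open>2 \<i> s\<close> is their difference; hence \<open>norm s \<le> 1\<close>.\<close>
  have le1: "norm x \<le> 1" if x: "nonneg x" "nonneg (1 - x)" for x :: 'a
  proof -
    obtain s where s: "nonneg s" "star s = s" "s * s = x" "\<And>y. y * x = x * y \<Longrightarrow> y * s = s * y"
      by (rule nonneg_sqrt[OF x(1)]) (rule that)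
    obtain c where c: "nonneg c" "star c = c" "c * c = 1 - x" "\<And>y. y * (1 - x) = (1 - x) * y \<Longrightarrow> y * c = c * y"
      by (rule nonneg_sqrt[OF x(2)]) (rule that)
    have "s * (1 - x) = (1 - x) * s" by (simp add: algebra_simps s(3)[symmetric])
    then have sc: "s * c = c * s" by (rule c(4))
    have u: "norm (c + \<i> *\<^sub>C s) = 1" "norm (c + \<i> *\<^sub>C (- s)) = 1"
      using sc by (auto intro!: norm_unitary simp: s c star_simps)
    have "2 *\<^sub>R (\<i> *\<^sub>C s) = (c + \<i> *\<^sub>C s) - (c + \<i> *\<^sub>C (- s))"
      by (simp add: scaleC_minus_right scaleR_2)
    moreover have "norm (2 *\<^sub>R (\<i> *\<^sub>C s)) = 2 * norm s" by (simp add: norm_scaleC)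
    ultimately have "2 * norm s \<le> 2"
      using norm_triangle_ineq4[of "c + \<i> *\<^sub>C s" "c + \<i> *\<^sub>C (- s)"] u by simp
    then show ?thesis using norm_selfadjoint_square[OF s(2)] s(3) by (simp add: power_le_one)
  qed
  \<comment> \<open>\<open>r\<close> may be 0, so the rescaling to the case of bound 1 is done with
    every \<open>q > r\<close>.\<close>
  have le: "norm a \<le> q" if q: "q > r" for q
  proof -
    have "nonneg ((r *\<^sub>R 1 - a) + (q - r) *\<^sub>R 1)"
      using q by (intro nonneg_add assms nonneg_scaleR nonneg_1) simp
    then have "nonneg (inverse q *\<^sub>R ((r *\<^sub>R 1 - a) + (q - r) *\<^sub>R 1))"
      using q assms(3) by (intro nonneg_scaleR) auto
    moreover have "inverse q *\<^sub>R ((r *\<^sub>R 1 - a) + (q - r) *\<^sub>R 1) = 1 - inverse q *\<^sub>R a"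
      using q assms(3) by (simp add: algebra_simps)
    ultimately have "norm (inverse q *\<^sub>R a) \<le> 1"
      using q assms by (intro le1 nonneg_scaleR) auto
    then show ?thesis using q assms(3) by (simp add: field_simps)
  qed
  then show ?thesis by (rule dense_ge)
qed

section \<open>Inverses of positive elements and positivity of \<open>star y * y\<close>\<close>

lemma nonneg_of_inverse:
  fixes x y :: "'a::cstar_algebra"
  assumes "nonneg x" and xy: "x * y = 1" "y * x = 1"
  shows "nonneg y"
proof -
  obtain s where s: "star s = s" "s * s = x" using assms(1) by (auto simp: nonneg_def)
  have "s * y = y * (x * s) * y" by (simp add: mult.assoc[symmetric] xy)
  also have "\<dots> = y * s * (x * y)" by (simp add: s(2)[symmetric] mult.assoc)
  finally have sy: "s * y = y * s" by (simp add: xy)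
  have "star y * x = 1" by (metis star_1 star_mult xy(1) nonneg_star[OF assms(1)])
  then have "star y * (x * y) = y" by (simp add: mult.assoc[symmetric])
  then have ysa: "star y = y" by (simp add: xy)
  have "(y * s) * (y * s) = y * (s * y) * s" by (simp add: mult.assoc)
  also have "\<dots> = y * (y * (s * s))" by (simp add: sy mult.assoc)
  finally have "y = (y * s) * (y * s)" by (simp add: s(2) xy)
  moreover have "star (y * s) = y * s" by (simp add: star_simps s ysa sy)
  ultimately show ?thesis unfolding nonneg_def by blast
qed

text \<open>Neumann series for \<open>e = 1 - x / m\<close>. The gap \<open>d\<close> below
  \<open>x\<close> gives \<open>norm (m - x) \<le> m - d\<close> for
  \<open>m = norm (x - d) + d\<close>, hence \<open>norm e < 1\<close>.\<close>

lemma nonneg_inverse: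
  fixes x :: "'a::cstar_algebra"
  assumes "nonneg (x - d *\<^sub>R 1)" "d > 0"
  obtains y where "x * y = 1" "y * x = 1" "nonneg y" "\<And>z. z * x = x * z \<Longrightarrow> z * y = y * z"
proof -
  define m where "m = norm (x - d *\<^sub>R 1) + d"
  have m: "m > 0" using assms(2) by (simp add: m_def add_nonneg_pos)
  define e where "e = 1 - inverse m *\<^sub>R x"
  have e: "e = inverse m *\<^sub>R (m *\<^sub>R 1 - x)" using m by (simp add: e_def scaleR_diff_right)
  have "m *\<^sub>R 1 - x = norm (x - d *\<^sub>R 1) *\<^sub>R 1 - (x - d *\<^sub>R 1)"
    by (simp add: m_def algebra_simps)
  then have "norm (m *\<^sub>R 1 - x) \<le> m - d"
    using nonneg_norm_le[OF assms(1) order_refl] unfolding m_def by (metis add_diff_cancel_right')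
  moreover have "norm e = norm (m *\<^sub>R 1 - x) / m"
    using m unfolding e by (simp add: divide_inverse mult.commute)
  ultimately have ne: "norm e < 1" using m assms(2) by simp
  have "summable (\<lambda>k. norm e ^ k)" using ne by (simp add: summable_geometric)
  then have sn: "summable (\<lambda>k. norm (e ^ k))"
    by (rule summable_comparison_test') (simp add: norm_power_ineq)
  then have sm: "summable (\<lambda>k. e ^ k)" by (rule summable_norm_cancel)
  define S where "S = (\<Sum>k. e ^ k)"
  have split: "S = 1 + (\<Sum>k. e ^ Suc k)"
    unfolding S_def using suminf_split_head[OF sm] by simp
  have "(\<Sum>k. e ^ Suc k) = e * S" unfolding S_def by (simp add: suminf_mult[OF sm])
  moreover have "(\<Sum>k. e ^ Suc k) = S * e" unfolding S_def
    by (simp add: suminf_mult2[OF sm] power_commutes)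
  ultimately have S: "(1 - e) * S = 1" "S * (1 - e) = 1" using split by (simp_all add: algebra_simps)
  define y where "y = inverse m *\<^sub>R S"
  have x: "x = m *\<^sub>R (1 - e)" using m by (simp add: e_def)
  have xy: "x * y = 1" "y * x = 1" using m S by (simp_all add: x y_def)
  have comm: "z * y = y * z" if "z * x = x * z" for z
  proof -
    have "z * y = y * x * z * y" by (simp add: xy)
    also have "\<dots> = y * (z * x) * y" by (simp add: that mult.assoc)
    finally show ?thesis by (simp add: mult.assoc xy)
  qed
  have "nonneg (x - d *\<^sub>R 1 + d *\<^sub>R 1)"
    using assms by (intro nonneg_add nonneg_scaleR) auto
  then have "nonneg x" by simp
  then have "nonneg y" using xy by (rule nonneg_of_inverse)
  then show thesis using that[of y] xy comm by blast
qed

text \<open>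
  If \<open>w\<^sup>* w \<le> 0\<close>, then \<open>w w\<^sup>* \<ge> 0\<close> because \<open>w\<^sup>* w + w w\<^sup>* = 2 (Re w)\<^sup>2 + 2 (Im w)\<^sup>2\<close>.  Yet
  \<open>1 - w w\<^sup>*\<close> is invertible, since \<open>1 - w\<^sup>* w\<close> is; so \<open>1\<close> is not in the spectrum of \<open>w w\<^sup>*\<close>,
  which is impossible for norm 1.
\<close>

lemma star_mult_nonpos_imp_zero:
  fixes w :: "'a::cstar_algebra"
  assumes "nonneg (- (star w * w))"
  shows "w = 0"
proof (rule ccontr)
  assume w0: "w \<noteq> 0"
  define v where "v = inverse (norm w) *\<^sub>R w"
  have nv: "norm v = 1" using w0 by (simp add: v_def)
  define a where "a = - (star v * v)"
  have "a = (inverse (norm w) * inverse (norm w)) *\<^sub>R (- (star w * w))"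
    by (simp add: a_def v_def star_simps)
  then have a: "nonneg a" using nonneg_scaleR[OF assms] by simp
  define d where "d = v * star v"
  define p where "p = (1/2) *\<^sub>R (v + star v)"
  define q where "q = (1/2) *\<^sub>R (\<i> *\<^sub>C (star v - v))"
  have p: "nonneg (p * p)" and q: "nonneg (q * q)"
  proof -
    have "star p = p" by (simp add: p_def star_simps add.commute)
    moreover have "star q = q"
      by (simp add: q_def star_simps scaleC_minus_left scaleC_diff_right)
    ultimately show "nonneg (p * p)" "nonneg (q * q)" unfolding nonneg_def by blast+
  qed
  have "4 *\<^sub>R (p * p) = (v + star v) * (v + star v)" by (simp add: p_def)
  moreover have "4 *\<^sub>R (q * q) = - ((star v - v) * (star v - v))"
    by (simp add: q_def mult_scaleC_left mult_scaleC_right scaleC_i_i scaleC_scaleR)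
  ultimately have "4 *\<^sub>R (p * p) + 4 *\<^sub>R (q * q) = 2 *\<^sub>R (d - a)"
    by (simp add: d_def a_def algebra_simps scaleR_2)
  then have "d = (1/2) *\<^sub>R (4 *\<^sub>R (p * p) + 4 *\<^sub>R (q * q)) + a" by simp
  then have d: "nonneg d"
    using a p q by (simp only:) (intro nonneg_add nonneg_scaleR, simp_all)
  have nd: "norm d = 1" using cstar_identity[of "star v"] nv by (simp add: d_def)
  obtain y where y: "(1 + a) * y = 1" "y * (1 + a) = 1"
    by (rule nonneg_inverse[of "1 + a" 1], use a in simp, simp) (rule that)
  \<comment> \<open>The classical formula for the inverse of \<open>1 - v * star v\<close> in terms
    of the inverse \<open>y\<close> of \<open>1 - star v * v = 1 + a\<close>.\<close>
  define z where "z = 1 + v * y * star v"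
  have "(1 - d) * z = 1 - d + v * ((1 + a) * y) * star v"
    by (simp add: z_def d_def a_def algebra_simps)
  then have z1: "(1 - d) * z = 1" by (simp add: y d_def)
  have "z * (1 - d) = 1 - d + v * (y * (1 + a)) * star v"
    by (simp add: z_def d_def a_def algebra_simps)
  then have z2: "z * (1 - d) = 1" by (simp add: y d_def)
  have x: "nonneg (1 - d)" using nonneg_bound(1)[OF nonneg_star[OF d], of 1] nd by simp
  have z: "nonneg z" using x z1 z2 by (rule nonneg_of_inverse)
  \<comment> \<open>Multiplying \<open>z \<le> m\<close> by the commuting positive element
    \<open>1 - d\<close> gives \<open>1 \<le> m (1 - d)\<close>, that is
    \<open>d \<le> 1 - 1 / m\<close>, against \<open>norm d = 1\<close>.\<close>
  define m where "m = max 1 (norm z)"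
  have m: "m \<ge> 1" by (simp add: m_def)
  have "nonneg (m *\<^sub>R 1 - z)" using nonneg_star[OF z] by (rule nonneg_bound) (simp add: m_def)
  then have "nonneg ((1 - d) * (m *\<^sub>R 1 - z))"
  proof (rule nonneg_mult[OF x])
    have "(1 - d) * z = z * (1 - d)" by (simp only: z1 z2)
    then have "d * z = z * d" by (simp add: left_diff_distrib right_diff_distrib)
    then show "(1 - d) * (m *\<^sub>R 1 - z) = (m *\<^sub>R 1 - z) * (1 - d)" by (simp add: algebra_simps)
  qed
  then have "nonneg (inverse m *\<^sub>R ((1 - d) * (m *\<^sub>R 1 - z)))"
    using m by (intro nonneg_scaleR) simp_all
  moreover have "inverse m *\<^sub>R ((1 - d) * (m *\<^sub>R 1 - z)) = (1 - inverse m) *\<^sub>R 1 - d"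
  proof -
    have "(1 - d) * (m *\<^sub>R 1 - z) = m *\<^sub>R (1 - d) - 1" by (simp add: right_diff_distrib z1)
    then show ?thesis using m by (simp add: scaleR_diff_right scaleR_diff_left)
  qed
  ultimately have "norm d \<le> 1 - inverse m"
    using m by (intro nonneg_norm_mono[OF d]) (simp_all add: field_simps)
  then show False using nd m by simp
qed

text \<open>With \<open>c = |b|\<close>, the element \<open>g = c - b\<close> is twice the negative
  part of \<open>b\<close>. Since \<open>b g = - c g\<close>, the product of
  \<open>star (y g)\<close> and \<open>y g\<close> is \<open>- c g^2\<close>, which is nonpositive,
  so \<open>y g = 0\<close> by \<open>star_mult_nonpos_imp_zero\<close>. Then
  \<open>c g^2 = 0\<close>, and \<open>g^2 = 2 c g\<close> forces \<open>g = 0\<close>.\<close>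

lemma nonneg_star_mult: "nonneg (star y * (y::'a::cstar_algebra))"
proof -
  define b where "b = star y * y"
  have bsa: "star b = b" by (simp add: b_def star_mult)
  have "nonneg (b * b)" using bsa unfolding nonneg_def by blast
  then obtain c where c: "nonneg c" "star c = c" "c * c = b * b" "\<And>x. x * (b * b) = (b * b) * x \<Longrightarrow> x * c = c * x"
    by (rule nonneg_sqrt) (rule that)
  have bc: "b * c = c * b" by (rule c(4)) (simp add: mult.assoc)
  define g where "g = c - b"
  have gsa: "star g = g" by (simp add: g_def star_simps bsa c(2))
  have bg: "b * g = - (c * g)" by (simp add: g_def algebra_simps bc c(3))
  have gg: "g * g = 2 *\<^sub>R (c * g)" by (simp add: g_def algebra_simps bc c(3) scaleR_2)
  have cg: "c * g = g * c" by (simp add: g_def algebra_simps bc)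
  have gb: "g * b = b * g" by (simp add: g_def algebra_simps bc)
  have "star (y * g) * (y * g) = g * b * g" by (simp add: star_simps gsa b_def mult.assoc)
  also have "\<dots> = - (c * (g * g))" by (simp add: gb bg mult.assoc)
  finally have 1: "star (y * g) * (y * g) = - (c * (g * g))" .
  have "nonneg (c * (g * g))"
  proof (rule nonneg_mult[OF c(1)])
    show "nonneg (g * g)" using gsa unfolding nonneg_def by blast
    show "c * (g * g) = (g * g) * c" by (metis cg mult.assoc)
  qed
  then have "y * g = 0" using 1 by (intro star_mult_nonpos_imp_zero) simp
  then have 2: "c * (g * g) = 0" using 1 by simp
  have "(g * g) * (g * g) = (2 *\<^sub>R (c * g)) * (g * g)" by (metis gg)
  also have "\<dots> = 2 *\<^sub>R ((c * (g * g)) * g)" by (simp add: mult.assoc)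
  finally have "(g * g) * (g * g) = 0" using 2 by simp
  then have "g * g = 0" using norm_selfadjoint_square[of "g * g"] gsa by (simp add: star_mult)
  then have "g = 0" using norm_selfadjoint_square[of g] gsa by simp
  then show ?thesis using c(1) by (simp add: g_def b_def)
qed

lemma nonneg_conj:
  fixes a :: "'a::cstar_algebra"
  assumes "nonneg a" shows "nonneg (star x * a * x)"
proof -
  obtain s where "star s = s" "a = s * s" using assms by (auto simp: nonneg_def)
  then have "star x * a * x = star (s * x) * (s * x)" by (simp add: star_mult mult.assoc)
  then show ?thesis using nonneg_star_mult by metis
qed

lemma nonneg_antisym:
  fixes a :: "'a::cstar_algebra"
  assumes "nonneg a" "nonneg (- a)" shows "a = 0"
  using nonneg_norm_mono[of a 0] assms by simp

lemma nonneg_sum: "(\<And>i. i \<in> I \<Longrightarrow> nonneg (f i)) \<Longrightarrow> nonneg (\<Sum>i\<in>I. f i :: 'a::cstar_algebra)"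
  by (induction I rule: infinite_finite_induct) (simp_all add: nonneg_add)

lemma nonneg_conj_bound:
  fixes a :: "'a::cstar_algebra"
  assumes "star a = a" "norm a \<le> r"
  shows "nonneg (r *\<^sub>R (star x * x) - star x * a * x)" "nonneg (r *\<^sub>R (star x * x) + star x * a * x)"
  using nonneg_conj[OF nonneg_bound(1)[OF assms], of x] nonneg_conj[OF nonneg_bound(2)[OF assms], of x]
  by (simp_all add: algebra_simps)

lemma nonneg_perturb:
  fixes a b :: "'a::cstar_algebra"
  assumes "\<And>e. e > 0 \<Longrightarrow> nonneg (a + e *\<^sub>R b)"
  shows "nonneg a"
proof -
  have "((\<lambda>e. a + e *\<^sub>R b) \<longlongrightarrow> a + 0 *\<^sub>R b) (at_right 0)"
    by (intro tendsto_add tendsto_const tendsto_scaleR tendsto_ident_at)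
  moreover have "eventually (\<lambda>e. nonneg (a + e *\<^sub>R b)) (at_right 0)"
    by (rule eventually_mono[OF eventually_at_right_less[of 0]]) (rule assms)
  ultimately have "nonneg (a + 0 *\<^sub>R b)" by (rule nonneg_limit) simp
  then show ?thesis by simp
qed

section \<open>Positive matrices\<close>

text \<open>The algebra-valued inner product on A^n. Vectors and matrices are functions on all of
  \<open>nat\<close> that are read only below \<open>n\<close>, so a coordinate is appended by an
  update at \<open>n\<close>.\<close>

definition vec_inner :: "nat \<Rightarrow> (nat \<Rightarrow> 'a::cstar_algebra) \<Rightarrow> (nat \<Rightarrow> 'a) \<Rightarrow> 'a"
  where "vec_inner n u v = (\<Sum>i<n. star (u i) * v i)"

definition mat_vec :: "nat \<Rightarrow> (nat \<Rightarrow> nat \<Rightarrow> 'a::cstar_algebra) \<Rightarrow> (nat \<Rightarrow> 'a) \<Rightarrow> nat \<Rightarrow> 'a"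
  where "mat_vec n X v i = (\<Sum>j<n. X i j * v j)"

definition hermitian :: "nat \<Rightarrow> (nat \<Rightarrow> nat \<Rightarrow> 'a::cstar_algebra) \<Rightarrow> bool"
  where "hermitian n X \<longleftrightarrow> (\<forall>i<n. \<forall>j<n. star (X i j) = X j i)"

definition mat_form :: "nat \<Rightarrow> (nat \<Rightarrow> nat \<Rightarrow> 'a::cstar_algebra) \<Rightarrow> (nat \<Rightarrow> 'a) \<Rightarrow> 'a"
  where "mat_form n X v = (\<Sum>i<n. \<Sum>j<n. star (v i) * X i j * v j)"

text \<open>Coordinate \<open>i\<close> of the basis vector \<open>j\<close>; the unit matrix is
  therefore \<open>\<lambda>i j. unit_coord j i\<close>.\<close>

definition unit_coord :: "nat \<Rightarrow> nat \<Rightarrow> 'a::cstar_algebra"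
  where "unit_coord j i = (if i = j then 1 else 0)"

lemma mat_form_vec_inner: "mat_form n X v = vec_inner n v (mat_vec n X v)"
  by (simp add: mat_form_def vec_inner_def mat_vec_def sum_distrib_left mult.assoc)

lemma star_vec_inner: "star (vec_inner n u v) = vec_inner n v u"
  by (simp add: vec_inner_def star_sum star_mult)

lemma vec_inner_self_nonneg: "nonneg (vec_inner n v v)"
  unfolding vec_inner_def by (intro nonneg_sum nonneg_star_mult)

lemma vec_inner_diff_left: "vec_inner n (\<lambda>i. u i - v i) w = vec_inner n u w - vec_inner n v w"
  by (simp add: vec_inner_def star_diff left_diff_distrib sum_subtractf)

lemma vec_inner_diff_right: "vec_inner n w (\<lambda>i. u i - v i) = vec_inner n w u - vec_inner n w v"
  by (simp add: vec_inner_def right_diff_distrib sum_subtractf)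

lemma mat_vec_diff: "mat_vec n X (\<lambda>i. u i - v i) = (\<lambda>i. mat_vec n X u i - mat_vec n X v i)"
  by (rule ext) (simp add: mat_vec_def right_diff_distrib sum_subtractf)

lemma vec_inner_unit: "j < n \<Longrightarrow> vec_inner n (unit_coord j) v = v j"
  by (simp add: vec_inner_def unit_coord_def if_distrib[of star] if_distrib[of "\<lambda>x. x * _"] sum.delta' cong: if_cong)

lemma vec_inner_mat_vec:
  assumes "hermitian n X"
  shows "vec_inner n u (mat_vec n X v) = vec_inner n (mat_vec n X u) v"
proof -
  have "vec_inner n u (mat_vec n X v) = (\<Sum>i<n. \<Sum>j<n. star (u i) * X i j * v j)"
    by (simp add: vec_inner_def mat_vec_def sum_distrib_left mult.assoc)
  also have "\<dots> = (\<Sum>j<n. \<Sum>i<n. star (u i) * X i j * v j)" by (rule sum.swap)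
  also have "\<dots> = (\<Sum>j<n. \<Sum>i<n. star (X j i * u i) * v j)"
    using assms by (intro sum.cong refl) (auto simp: star_mult hermitian_def)
  finally show ?thesis by (simp add: vec_inner_def mat_vec_def star_sum sum_distrib_right)
qed

lemma mat_form_star:
  assumes "hermitian n X" shows "star (mat_form n X v) = mat_form n X v"
  by (simp add: mat_form_vec_inner star_vec_inner vec_inner_mat_vec[OF assms])

text \<open>Completing the square in \<open>a - x b / norm x\<close> with weight
  \<open>norm x\<close>; what remains is controlled by
  \<open>star x * x \<le> (norm x)^2\<close>.\<close>

lemma nonneg_young:
  fixes a b x :: "'a::cstar_algebra"
  shows "nonneg (norm x *\<^sub>R (star a * a + star b * b) - (star a * x * b + star b * star x * a))"
proof (cases "x = 0")
  case True then show ?thesis by simp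
next
  case False
  define r where "r = norm x"
  have r: "r > 0" using False by (simp add: r_def)
  have 1: "nonneg (r *\<^sub>R (star (a - inverse r *\<^sub>R (x * b)) * (a - inverse r *\<^sub>R (x * b))))"
    using r by (intro nonneg_scaleR nonneg_star_mult) simp
  have "norm (star x * x) \<le> r * r" by (simp add: cstar_identity r_def power2_eq_square)
  then have "nonneg ((r * r) *\<^sub>R (star b * b) - star b * (star x * x) * b)"
    by (intro nonneg_conj_bound) (simp_all add: star_mult)
  then have 2: "nonneg (inverse r *\<^sub>R ((r * r) *\<^sub>R (star b * b) - star b * (star x * x) * b))"
    using r by (intro nonneg_scaleR) simp_all
  have "r *\<^sub>R (star (a - inverse r *\<^sub>R (x * b)) * (a - inverse r *\<^sub>R (x * b)))
      + inverse r *\<^sub>R ((r * r) *\<^sub>R (star b * b) - star b * (star x * x) * b)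
      = r *\<^sub>R (star a * a + star b * b) - (star a * x * b + star b * star x * a)"
    using r by (simp add: star_simps algebra_simps)
  then show ?thesis using nonneg_add[OF 1 2] by (simp add: r_def)
qed

lemma nonneg_young':
  fixes a b x :: "'a::cstar_algebra"
  shows "nonneg (norm x *\<^sub>R (star a * a + star b * b) + (star a * x * b + star b * star x * a))"
  using nonneg_young[of "- x" a b] by (simp add: star_minus algebra_simps)

section \<open>Norm bounds and square roots for matrices\<close>

definition mat_norm_bound :: "nat \<Rightarrow> (nat \<Rightarrow> nat \<Rightarrow> 'a::cstar_algebra) \<Rightarrow> real"
  where "mat_norm_bound n X = (\<Sum>i<n. \<Sum>j<n. norm (X i j))"

lemma mat_norm_bound_nonneg: "mat_norm_bound n X \<ge> 0"
  unfolding mat_norm_bound_def by (intro sum_nonneg norm_ge_zero)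

text \<open>\<open>nonneg_young'\<close> is applied to every entry. In the sum over all entries,
  \<open>star (v i) * v i\<close> appears with the \<open>i\<close>-th row sum plus the
  \<open>i\<close>-th column sum of norms as factor, and each of these is at most the sum of all
  entry norms.\<close>

lemma mat_form_bounded:
  fixes X :: "nat \<Rightarrow> nat \<Rightarrow> 'a::cstar_algebra"
  assumes "hermitian n X"
  shows "nonneg (mat_norm_bound n X *\<^sub>R vec_inner n v v + mat_form n X v)"
proof -
  let ?R = "mat_norm_bound n X"
  let ?N = "\<lambda>i j. norm (X i j) *\<^sub>R (star (v i) * v i + star (v j) * v j)"
  let ?T = "\<lambda>i j. star (v i) * X i j * v j + star (v j) * star (X i j) * v i"
  have 1: "nonneg (\<Sum>i<n. \<Sum>j<n. ?N i j + ?T i j)"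
    by (intro nonneg_sum nonneg_young')
  have herm: "star (X i j) = X j i" if "i < n" "j < n" for i j
    using assms that by (auto simp: hermitian_def)
  have "(\<Sum>i<n. \<Sum>j<n. star (v j) * star (X i j) * v i) = (\<Sum>i<n. \<Sum>j<n. star (v j) * X j i * v i)"
    by (intro sum.cong refl) (simp add: herm)
  also have "\<dots> = mat_form n X v" unfolding mat_form_def by (rule sum.swap)
  finally have 2: "(\<Sum>i<n. \<Sum>j<n. ?T i j) = 2 *\<^sub>R mat_form n X v"
    by (simp add: sum.distrib mat_form_def scaleR_2)
  have rb: "(\<Sum>j<n. norm (X i j)) \<le> ?R" "(\<Sum>j<n. norm (X j i)) \<le> ?R" if "i < n" for i
  proof -
    show "(\<Sum>j<n. norm (X i j)) \<le> ?R" unfolding mat_norm_bound_def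
      using that member_le_sum[of i "{..<n}" "\<lambda>i. \<Sum>j<n. norm (X i j)"] by (simp add: sum_nonneg)
    then show "(\<Sum>j<n. norm (X j i)) \<le> ?R"
      using herm[OF that] that herm by (metis (no_types, lifting) lessThan_iff norm_star sum.cong)
  qed
  have "(\<Sum>i<n. \<Sum>j<n. ?N i j) = (\<Sum>i<n. (\<Sum>j<n. norm (X i j)) *\<^sub>R (star (v i) * v i))
      + (\<Sum>i<n. \<Sum>j<n. norm (X i j) *\<^sub>R (star (v j) * v j))"
    by (simp add: scaleR_add_right sum.distrib scaleR_sum_left)
  also have "(\<Sum>i<n. \<Sum>j<n. norm (X i j) *\<^sub>R (star (v j) * v j))
      = (\<Sum>i<n. (\<Sum>j<n. norm (X j i)) *\<^sub>R (star (v i) * v i))"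
    by (subst sum.swap) (simp add: scaleR_sum_left)
  finally have "2 *\<^sub>R (?R *\<^sub>R vec_inner n v v) - (\<Sum>i<n. \<Sum>j<n. ?N i j)
      = (\<Sum>i<n. (?R - (\<Sum>j<n. norm (X i j))) *\<^sub>R (star (v i) * v i))
      + (\<Sum>i<n. (?R - (\<Sum>j<n. norm (X j i))) *\<^sub>R (star (v i) * v i))"
    by (simp add: vec_inner_def scaleR_sum_right scaleR_diff_left sum_subtractf scaleR_2 sum.distrib
        del: scaleR_scaleR)
  moreover have "nonneg \<dots>"
    using rb by (intro nonneg_add nonneg_sum nonneg_scaleR nonneg_star_mult) simp_all
  ultimately have "nonneg (2 *\<^sub>R (?R *\<^sub>R vec_inner n v v) - (\<Sum>i<n. \<Sum>j<n. ?N i j))" by simp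
  from nonneg_add[OF this 1] have "nonneg (2 *\<^sub>R (?R *\<^sub>R vec_inner n v v + mat_form n X v))"
    by (simp add: 2[symmetric] sum.distrib scaleR_add_right)
  from nonneg_scaleR[OF this, of "1/2"] show ?thesis by simp
qed

text \<open>As operators, \<open>1 - E^2 = (1 - E) + (1 - E) E (1 - E) + E (1 - E) E\<close>, and
  all three summands are positive when \<open>0 \<le> E \<le> 1\<close>.\<close>

lemma mat_vec_contraction:
  fixes E :: "nat \<Rightarrow> nat \<Rightarrow> 'a::cstar_algebra"
  assumes h: "hermitian n E"
    and pos: "\<And>v. nonneg (mat_form n E v)"
    and le1: "\<And>v. nonneg (vec_inner n v v - mat_form n E v)"
  shows "nonneg (vec_inner n v v - vec_inner n (mat_vec n E v) (mat_vec n E v))"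
proof -
  let ?u = "mat_vec n E v"
  have "mat_form n E (\<lambda>i. v i - ?u i) = mat_form n E v - 2 *\<^sub>R vec_inner n ?u ?u + mat_form n E ?u"
    by (simp add: mat_form_vec_inner vec_inner_mat_vec[OF h] mat_vec_diff vec_inner_diff_left
        vec_inner_diff_right scaleR_2)
  then have "(vec_inner n v v - mat_form n E v) + (mat_form n E (\<lambda>i. v i - ?u i) + (vec_inner n ?u ?u - mat_form n E ?u))
      = vec_inner n v v - vec_inner n ?u ?u"
    by (simp add: scaleR_2)
  then show ?thesis using nonneg_add[OF le1[of v] nonneg_add[OF pos[of "\<lambda>i. v i - ?u i"] le1[of ?u]]]
    by metis
qed

text \<open>Column \<open>l\<close> of the matrix E^k is E^k applied to the basis vector
  \<open>l\<close>. With \<open>w\<close> a column of another power, this is the product rule for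
  powers of \<open>E\<close>.\<close>

lemma mat_vec_funpow_expand:
  "(\<Sum>l<n. ((mat_vec n E ^^ k) (unit_coord l)) i * w l) = (mat_vec n E ^^ k) w i" if "i < n"
  using that
proof (induction k arbitrary: i)
  case 0
  then show ?case by (simp add: unit_coord_def if_distrib[of "\<lambda>x. x * _"] sum.delta cong: if_cong)
next
  case (Suc k)
  have "(\<Sum>l<n. ((mat_vec n E ^^ Suc k) (unit_coord l)) i * w l)
      = (\<Sum>l<n. \<Sum>j<n. E i j * (((mat_vec n E ^^ k) (unit_coord l)) j * w l))"
    by (simp add: mat_vec_def sum_distrib_right mult.assoc)
  also have "\<dots> = (\<Sum>j<n. \<Sum>l<n. E i j * (((mat_vec n E ^^ k) (unit_coord l)) j * w l))" by (rule sum.swap)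
  also have "\<dots> = (\<Sum>j<n. E i j * (mat_vec n E ^^ k) w j)"
    by (intro sum.cong refl) (simp add: Suc.IH sum_distrib_left[symmetric])
  finally show ?case by (simp add: mat_vec_def[of n E "(mat_vec n E ^^ k) w" i])
qed

text \<open>The binomial series of sqrt (1 - E), summed entry by entry. By
  \<open>mat_vec_contraction\<close> the columns of E^k stay in the unit ball of A^n, so the entries
  of all powers have norm at most 1, and convergence follows without a norm on matrices.\<close>

lemma mat_sqrt_exists:
  fixes E :: "nat \<Rightarrow> nat \<Rightarrow> 'a::cstar_algebra"
  assumes h: "hermitian n E"
    and pos: "\<And>v. nonneg (mat_form n E v)"
    and le1: "\<And>v. nonneg (vec_inner n v v - mat_form n E v)"
  obtains S where "hermitian n S"
    and "\<And>i j. i < n \<Longrightarrow> j < n \<Longrightarrow> (\<Sum>l<n. S i l * S l j) = unit_coord j i - E i j"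
proof -
  define p where "p k i j = (mat_vec n E ^^ k) (unit_coord j) i" for k i j
  have contr: "nonneg (vec_inner n v v - vec_inner n ((mat_vec n E ^^ k) v) ((mat_vec n E ^^ k) v))" for k v
  proof (induction k)
    case (Suc k)
    from nonneg_add[OF Suc mat_vec_contraction[OF h pos le1, of "(mat_vec n E ^^ k) v"]]
    show ?case by simp
  qed simp
  have np: "norm (p k i j) \<le> 1" if ij: "i < n" "j < n" for k i j
  proof -
    have "nonneg (1 - vec_inner n (\<lambda>i. p k i j) (\<lambda>i. p k i j))"
      using contr[of "unit_coord j" k] ij by (simp add: p_def[abs_def] vec_inner_unit) (simp add: unit_coord_def)
    moreover have "nonneg (vec_inner n (\<lambda>i. p k i j) (\<lambda>i. p k i j) - star (p k i j) * p k i j)"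
    proof -
      have "vec_inner n (\<lambda>i. p k i j) (\<lambda>i. p k i j) - star (p k i j) * p k i j
          = (\<Sum>l\<in>{..<n} - {i}. star (p k l j) * p k l j)"
        unfolding vec_inner_def using ij by (subst sum.remove[of _ i]) auto
      then show ?thesis by (simp add: nonneg_sum nonneg_star_mult)
    qed
    ultimately have "nonneg (1 *\<^sub>R 1 - star (p k i j) * p k i j)" using nonneg_add by fastforce
    then have "norm (star (p k i j) * p k i j) \<le> 1"
      by (intro nonneg_norm_mono nonneg_star_mult) simp_all
    then show ?thesis by (simp add: cstar_identity abs_square_le_1)
  qed
  have ps: "star (p k i j) = p k j i" if ij: "i < n" "j < n" for k i j
  proof -
    have sym: "vec_inner n u ((mat_vec n E ^^ k) v) = vec_inner n ((mat_vec n E ^^ k) u) v" for u v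
      by (induction k arbitrary: u v) (simp_all add: vec_inner_mat_vec[OF h] funpow_swap1)
    have "p k j i = vec_inner n (unit_coord j) ((mat_vec n E ^^ k) (unit_coord i))"
      using ij by (simp add: vec_inner_unit p_def)
    also have "\<dots> = star (vec_inner n (unit_coord i) ((mat_vec n E ^^ k) (unit_coord j)))"
      by (simp add: sym star_vec_inner)
    finally show ?thesis using ij by (simp add: vec_inner_unit p_def)
  qed
  define f where "f k i j = sqrt_coeff k *\<^sub>R p k i j" for k i j
  have nf: "summable (\<lambda>k. norm (f k i j))" if "i < n" "j < n" for i j
    by (rule summable_comparison_test'[OF summable_abs_sqrt_coeff, of 0])
      (use np[OF that] in \<open>simp add: f_def mult_left_le\<close>)
  define S where "S i j = (\<Sum>k. f k i j)" for i j
  have "hermitian n S"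
    unfolding hermitian_def
  proof (intro allI impI)
    fix i j assume ij: "i < n" "j < n"
    have "star (S i j) = (\<Sum>k. star (f k i j))"
      unfolding S_def by (rule bounded_linear.suminf[OF bounded_linear_star summable_norm_cancel[OF nf[OF ij]]])
    moreover have "star (f k i j) = f k j i" for k using ps[OF ij] by (simp add: f_def star_scaleR)
    ultimately show "star (S i j) = S j i" by (simp add: S_def)
  qed
  moreover have "(\<Sum>l<n. S i l * S l j) = unit_coord j i - E i j" if ij: "i < n" "j < n" for i j
  proof -
    have "(\<lambda>k. \<Sum>q\<le>k. f q i l * f (k - q) l j) sums (S i l * S l j)" if "l < n" for l
      unfolding S_def using nf ij that by (intro Cauchy_product_sums) auto
    then have "(\<lambda>k. \<Sum>l<n. \<Sum>q\<le>k. f q i l * f (k - q) l j) sums (\<Sum>l<n. S i l * S l j)"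
      by (intro sums_sum) simp
    moreover have "(\<Sum>l<n. \<Sum>q\<le>k. f q i l * f (k - q) l j)
        = (if k = 0 then 1 else if k = 1 then -1 else 0) *\<^sub>R p k i j" for k
    proof -
      have "(\<Sum>l<n. \<Sum>q\<le>k. f q i l * f (k - q) l j)
          = (\<Sum>q\<le>k. \<Sum>l<n. (sqrt_coeff q * sqrt_coeff (k - q)) *\<^sub>R (p q i l * p (k - q) l j))"
        by (subst sum.swap) (simp add: f_def mult.commute)
      also have "\<dots> = (\<Sum>q\<le>k. (sqrt_coeff q * sqrt_coeff (k - q)) *\<^sub>R p k i j)"
      proof (intro sum.cong refl)
        fix q assume q: "q \<in> {..k}"
        have "(\<Sum>l<n. p q i l * p (k - q) l j) = (mat_vec n E ^^ q) ((mat_vec n E ^^ (k - q)) (unit_coord j)) i"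
          unfolding p_def using ij by (intro mat_vec_funpow_expand)
        also have "\<dots> = p k i j"
          using q by (simp add: p_def funpow_add[symmetric, THEN fun_cong, unfolded comp_def])
        finally show "(\<Sum>l<n. (sqrt_coeff q * sqrt_coeff (k - q)) *\<^sub>R (p q i l * p (k - q) l j))
            = (sqrt_coeff q * sqrt_coeff (k - q)) *\<^sub>R p k i j"
          by (simp add: scaleR_sum_right[symmetric])
      qed
      finally show ?thesis by (simp only: scaleR_sum_left[symmetric] sqrt_coeff_convolution)
    qed
    ultimately have "(\<lambda>k. (if k = 0 then 1 else if k = 1 then -1 else 0 :: real) *\<^sub>R p k i j) sums (\<Sum>l<n. S i l * S l j)"
      by simp
    moreover have "(\<lambda>k. (if k = 0 then 1 else if k = 1 then -1 else 0 :: real) *\<^sub>R p k i j) sums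
        (\<Sum>k\<in>{0,1}. (if k = 0 then 1 else if k = 1 then -1 else 0 :: real) *\<^sub>R p k i j)"
      by (rule sums_finite) auto
    ultimately have "(\<Sum>l<n. S i l * S l j) = p 0 i j - p 1 i j"
      using sums_unique2 by fastforce
    moreover have "p 1 i j = E i j"
      using ij by (simp add: p_def mat_vec_def unit_coord_def if_distrib[of "\<lambda>x. _ * x"] sum.delta' cong: if_cong)
    ultimately show ?thesis by (simp add: p_def)
  qed
  ultimately show thesis by (rule that)
qed

lemma mat_form_unit: "mat_form n (\<lambda>i j. unit_coord j i) v = vec_inner n v v"
  by (simp add: mat_form_def vec_inner_def unit_coord_def if_distrib[of "\<lambda>x. _ * x * _"]
      if_distrib[of "\<lambda>x. _ * x"] if_distrib[of "\<lambda>x. x * _"] sum.delta cong: if_cong)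

text \<open>Polarization: the form is self-adjoint at \<open>u + c w\<close> for every complex
  \<open>c\<close>, hence so are its cross terms, and \<open>c = 1\<close> and
  \<open>c = \<i>\<close> separate the two of them.\<close>

lemma hermitian_if_nonneg_form:
  fixes X :: "nat \<Rightarrow> nat \<Rightarrow> 'a::cstar_algebra"
  assumes pos: "\<And>v. nonneg (mat_form n X v)"
  shows "hermitian n X"
  unfolding hermitian_def
proof (intro allI impI)
  fix i j assume ij: "i < n" "j < n"
  define B where "B u w = vec_inner n u (mat_vec n X w)" for u w
  have B_add: "B (\<lambda>i. u i + c *\<^sub>C w i) (\<lambda>i. u i + c *\<^sub>C w i)
      = B u u + c *\<^sub>C B u w + cnj c *\<^sub>C B w u + (cnj c * c) *\<^sub>C B w w" for u w c
    by (simp add: B_def vec_inner_def mat_vec_def star_simps algebra_simps sum.distrib sum_distrib_left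
        mult_scaleC_left mult_scaleC_right scaleC_add_right scaleC_sum_right scaleC_scaleC)
  have B_sa: "star (B u u) = B u u" for u
    using nonneg_star[OF pos] by (simp add: B_def mat_form_vec_inner)
  define u :: "nat \<Rightarrow> 'a" where "u = unit_coord i"
  define w :: "nat \<Rightarrow> 'a" where "w = unit_coord j"
  have e: "star (c *\<^sub>C B u w + cnj c *\<^sub>C B w u) = c *\<^sub>C B u w + cnj c *\<^sub>C B w u" for c
  proof -
    have "c *\<^sub>C B u w + cnj c *\<^sub>C B w u
        = B (\<lambda>i. u i + c *\<^sub>C w i) (\<lambda>i. u i + c *\<^sub>C w i) - B u u - (cnj c * c) *\<^sub>C B w w"
      unfolding B_add by simp
    then show ?thesis by (simp only: star_simps B_sa) (simp add: mult.commute)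
  qed
  have "star (B u w) + star (B w u) = B u w + B w u"
    using e[of 1] by (simp add: star_simps)
  moreover have "\<i> *\<^sub>C (star (B w u) - star (B u w)) = \<i> *\<^sub>C (B u w - B w u)"
    using e[of \<i>] by (simp add: star_simps scaleC_minus_left scaleC_diff_right)
  then have "\<i> *\<^sub>C \<i> *\<^sub>C (star (B w u) - star (B u w)) = \<i> *\<^sub>C \<i> *\<^sub>C (B u w - B w u)" by simp
  then have "star (B w u) - star (B u w) = B u w - B w u"
    unfolding scaleC_i_i by (metis neg_equal_iff_equal)
  ultimately have "2 *\<^sub>R star (B u w) = 2 *\<^sub>R B w u" unfolding scaleR_2
    by (metis (no_types, opaque_lifting) add_diff_cancel_left add_diff_cancel_right' diff_add_cancel diff_add_eq diff_diff_eq2 add.commute)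
  then have "star (B u w) = B w u" by simp
  moreover have "B (unit_coord k) (unit_coord l) = X k l" if "k < n" "l < n" for k l
    using that by (simp add: B_def vec_inner_unit mat_vec_def unit_coord_def
        if_distrib[of "\<lambda>x. _ * x"] sum.delta' cong: if_cong)
  ultimately show "star (X i j) = X j i" using ij by (simp add: u_def w_def)
qed

theorem positive_form_gram:
  fixes X :: "nat \<Rightarrow> nat \<Rightarrow> 'a::cstar_algebra"
  assumes pos: "\<And>v. nonneg (mat_form n X v)"
  obtains Y where "\<And>i j. i < n \<Longrightarrow> j < n \<Longrightarrow> X i j = (\<Sum>k<n. star (Y k i) * Y k j)"
proof -
  have h: "hermitian n X" using pos by (rule hermitian_if_nonneg_form)
  \<comment> \<open>Scaling by \<open>R\<close> places \<open>E = 1 - X / R\<close> between 0 and 1,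
    as \<open>mat_sqrt_exists\<close> requires; the summand 1 keeps \<open>R\<close> positive even
    for \<open>X = 0\<close>.\<close>
  define R where "R = mat_norm_bound n (\<lambda>i j. - X i j) + 1"
  have R: "R > 0" using mat_norm_bound_nonneg[of n "\<lambda>i j. - X i j"] by (simp add: R_def)
  define E where "E i j = unit_coord j i - inverse R *\<^sub>R X i j" for i j
  have Eform: "mat_form n E v = vec_inner n v v - inverse R *\<^sub>R mat_form n X v" for v
    by (simp add: mat_form_unit[symmetric] mat_form_def E_def scaleR_sum_right left_diff_distrib
        right_diff_distrib sum_subtractf)
  have "hermitian n E" using h by (auto simp: hermitian_def E_def star_simps unit_coord_def)
  moreover have "nonneg (vec_inner n v v - mat_form n E v)" for v
    using nonneg_scaleR[OF pos, of "inverse R" v] R by (simp add: Eform)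
  moreover have "nonneg (mat_form n E v)" for v
  proof -
    have "hermitian n (\<lambda>i j. - X i j)" using h by (simp add: hermitian_def star_minus)
    from mat_form_bounded[OF this, of v] have "nonneg ((R - 1) *\<^sub>R vec_inner n v v - mat_form n X v)"
      by (simp add: R_def mat_form_def sum_negf)
    from nonneg_add[OF this vec_inner_self_nonneg[of n v]]
    have "nonneg (R *\<^sub>R vec_inner n v v - mat_form n X v)" by (simp add: algebra_simps)
    from nonneg_scaleR[OF this, of "inverse R"] R show ?thesis by (simp add: Eform scaleR_diff_right)
  qed
  ultimately obtain S where S: "hermitian n S"
      "\<And>i j. i < n \<Longrightarrow> j < n \<Longrightarrow> (\<Sum>l<n. S i l * S l j) = unit_coord j i - E i j"
    using mat_sqrt_exists[of n E] by metis
  show thesis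
  proof (rule that[of "\<lambda>i j. sqrt R *\<^sub>R S i j"])
    fix i j assume ij: "i < n" "j < n"
    have "(\<Sum>k<n. star (sqrt R *\<^sub>R S k i) * (sqrt R *\<^sub>R S k j)) = (\<Sum>k<n. R *\<^sub>R (S i k * S k j))"
    proof (intro sum.cong refl)
      fix k assume "k \<in> {..<n}"
      then have "star (S k i) = S i k" using S(1) ij by (auto simp: hermitian_def)
      moreover have "(sqrt R * sqrt R) *\<^sub>R (S i k * S k j) = R *\<^sub>R (S i k * S k j)" using R by simp
      ultimately show "star (sqrt R *\<^sub>R S k i) * (sqrt R *\<^sub>R S k j) = R *\<^sub>R (S i k * S k j)"
        by (simp add: star_scaleR del: real_sqrt_mult_self)
    qed
    also have "\<dots> = X i j" using S(2)[OF ij] R by (simp add: scaleR_sum_right[symmetric] E_def)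
    finally show "X i j = (\<Sum>k<n. star (sqrt R *\<^sub>R S k i) * (sqrt R *\<^sub>R S k j))" ..
  qed
qed

lemma mat_form_gram:
  "mat_form n (\<lambda>i j. \<Sum>k<m. star (Y k i) * Y k j) v
    = (\<Sum>k<m. star (\<Sum>j<n. Y k j * v j) * (\<Sum>j<n. Y k j * v j))"
proof -
  have "mat_form n (\<lambda>i j. \<Sum>k<m. star (Y k i) * Y k j) v
      = (\<Sum>i<n. \<Sum>j<n. \<Sum>k<m. star (Y k i * v i) * (Y k j * v j))"
    by (simp add: mat_form_def sum_distrib_left sum_distrib_right star_mult mult.assoc)
  also have "\<dots> = (\<Sum>i<n. \<Sum>k<m. \<Sum>j<n. star (Y k i * v i) * (Y k j * v j))"
    by (intro sum.cong refl sum.swap)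
  also have "\<dots> = (\<Sum>k<m. \<Sum>i<n. \<Sum>j<n. star (Y k i * v i) * (Y k j * v j))"
    by (rule sum.swap)
  finally show ?thesis by (simp add: star_sum sum_product)
qed

lemma mat_form_cong:
  assumes "\<And>i j. i < n \<Longrightarrow> j < n \<Longrightarrow> X i j = Y i j"
  shows "mat_form n X v = mat_form n Y v"
  unfolding mat_form_def using assms by (intro sum.cong refl) auto

lemma mat_form_sum: "mat_form n (\<lambda>i j. \<Sum>k\<in>K. X k i j) v = (\<Sum>k\<in>K. mat_form n (X k) v)"
proof -
  have "mat_form n (\<lambda>i j. \<Sum>k\<in>K. X k i j) v = (\<Sum>i<n. \<Sum>j<n. \<Sum>k\<in>K. star (v i) * X k i j * v j)"
    by (simp add: mat_form_def sum_distrib_left sum_distrib_right)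
  also have "\<dots> = (\<Sum>i<n. \<Sum>k\<in>K. \<Sum>j<n. star (v i) * X k i j * v j)"
    by (intro sum.cong refl sum.swap)
  also have "\<dots> = (\<Sum>k\<in>K. \<Sum>i<n. \<Sum>j<n. star (v i) * X k i j * v j)"
    by (rule sum.swap)
  finally show ?thesis by (simp add: mat_form_def)
qed

lemma mat_form_add: "mat_form n (\<lambda>i j. X i j + Y i j) v = mat_form n X v + mat_form n Y v"
  by (simp add: mat_form_def algebra_simps sum.distrib)

lemma mat_form_diff: "mat_form n (\<lambda>i j. X i j - Y i j) v = mat_form n X v - mat_form n Y v"
  by (simp add: mat_form_def algebra_simps sum_subtractf)

lemma mat_form_scaleR: "mat_form n (\<lambda>i j. r *\<^sub>R X i j) v = r *\<^sub>R mat_form n X v"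
  by (simp add: mat_form_def scaleR_sum_right)

section \<open>Positivity of matrices as positivity of their forms\<close>

lemma mat_star_dim [simp]: "dim_row (mat_star X) = dim_col X" "dim_col (mat_star X) = dim_row X"
  by (simp_all add: mat_star_def)

lemma mat_star_mult_index:
  assumes "Y \<in> carrier_mat n n" "i < n" "j < n"
  shows "(mat_star Y * Y) $$ (i, j) = (\<Sum>k<n. star (Y $$ (k, i)) * Y $$ (k, j))"
  using assms by (simp add: mat_star_def scalar_prod_def atLeast0LessThan)

lemma mat_star_carrier [simp]: "X \<in> carrier_mat n m \<Longrightarrow> mat_star X \<in> carrier_mat m n"
  by (simp add: mat_star_def)

lemma mat_star_index [simp]: "i < dim_col X \<Longrightarrow> j < dim_row X \<Longrightarrow> mat_star X $$ (i, j) = star (X $$ (j, i))"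
  by (simp add: mat_star_def)

lemma mat_pos_iff:
  fixes X :: "'a::cstar_algebra mat"
  assumes X: "X \<in> carrier_mat n n"
  shows "mat_pos n X \<longleftrightarrow> (\<forall>v. nonneg (mat_form n (\<lambda>i j. X $$ (i, j)) v))"
proof
  assume "mat_pos n X"
  then obtain Y where Y: "Y \<in> carrier_mat n n" "X = mat_star Y * Y" by (auto simp: mat_pos_def)
  show "\<forall>v. nonneg (mat_form n (\<lambda>i j. X $$ (i, j)) v)"
  proof
    fix v
    have "mat_form n (\<lambda>i j. X $$ (i, j)) v = mat_form n (\<lambda>i j. \<Sum>k<n. star (Y $$ (k, i)) * Y $$ (k, j)) v"
      using Y by (intro mat_form_cong) (simp add: mat_star_mult_index del: index_mult_mat)
    then show "nonneg (mat_form n (\<lambda>i j. X $$ (i, j)) v)"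
      by (simp add: mat_form_gram nonneg_sum nonneg_star_mult)
  qed
next
  assume "\<forall>v. nonneg (mat_form n (\<lambda>i j. X $$ (i, j)) v)"
  then obtain Y where Y: "\<And>i j. i < n \<Longrightarrow> j < n \<Longrightarrow> X $$ (i, j) = (\<Sum>k<n. star (Y k i) * Y k j)"
    using positive_form_gram[of n "\<lambda>i j. X $$ (i, j)"] by metis
  define Z where "Z = mat n n (\<lambda>(i, j). Y i j)"
  have Z: "Z \<in> carrier_mat n n" by (simp add: Z_def)
  have "X = mat_star Z * Z"
  proof (rule eq_matI)
    fix i j assume "i < dim_row (mat_star Z * Z)" "j < dim_col (mat_star Z * Z)"
    then have ij: "i < n" "j < n" using Z by auto
    show "X $$ (i, j) = (mat_star Z * Z) $$ (i, j)"
      unfolding mat_star_mult_index[OF Z ij] Y[OF ij] using ij by (simp add: Z_def)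
  qed (use X Z in auto)
  then show "mat_pos n X" unfolding mat_pos_def using Z by blast
qed

section \<open>Completely positive and completely copositive maps\<close>

text \<open>A row vector \<open>a\<close>, extended by zero rows, gives the positive matrix \<open>[a\<^sub>i\<^sup>* a\<^sub>j]\<close>; every positive
  matrix is a sum of such.\<close>

lemma row_matrix:
  fixes a :: "nat \<Rightarrow> 'a::cstar_algebra"
  assumes "n > 0"
  obtains Y where "Y \<in> carrier_mat n n"
    and "\<And>j. j < n \<Longrightarrow> Y $$ (0, j) = a j"
    and "\<And>k j. 0 < k \<Longrightarrow> k < n \<Longrightarrow> j < n \<Longrightarrow> Y $$ (k, j) = 0"
  using assms by (intro that[of "mat n n (\<lambda>(k, j). if k = 0 then a j else 0)"]) auto

lemma row_matrix_gram:
  fixes a :: "nat \<Rightarrow> 'a::cstar_algebra"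
  assumes "n > 0"
  obtains X where "X \<in> carrier_mat n n" and "mat_pos n X"
    and "\<And>i j. i < n \<Longrightarrow> j < n \<Longrightarrow> X $$ (i, j) = star (a i) * a j"
proof -
  obtain Y where Y: "Y \<in> carrier_mat n n" "\<And>j. j < n \<Longrightarrow> Y $$ (0, j) = a j"
    "\<And>k j. 0 < k \<Longrightarrow> k < n \<Longrightarrow> j < n \<Longrightarrow> Y $$ (k, j) = 0"
    using row_matrix[OF assms, of a] by metis
  show thesis
  proof (rule that[of "mat_star Y * Y"])
    show "mat_star Y * Y \<in> carrier_mat n n" using Y(1) by (intro mult_carrier_mat mat_star_carrier)
    show "mat_pos n (mat_star Y * Y)" using Y(1) by (auto simp: mat_pos_def)
    fix i j assume ij: "i < n" "j < n"
    have "(mat_star Y * Y) $$ (i, j) = (\<Sum>k<n. star (Y $$ (k, i)) * Y $$ (k, j))"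
      using Y(1) ij by (rule mat_star_mult_index)
    also have "\<dots> = (\<Sum>k\<in>{0}. star (Y $$ (k, i)) * Y $$ (k, j))"
      using assms ij Y(3) by (intro sum.mono_neutral_right) auto
    finally show "(mat_star Y * Y) $$ (i, j) = star (a i) * a j" using Y(2) ij by simp
  qed
qed

text \<open>The index maps \<open>f\<close> and \<open>g\<close> treat both notions at once:
  \<open>(i, j)\<close> gives complete positivity and \<open>(j, i)\<close> complete copositivity.
  By linearity it is enough to test on the Gram matrix of a single row \<open>a\<close>.\<close>

lemma mat_positive_map_iff:
  fixes T :: "'a::cstar_algebra \<Rightarrow>\<^sub>L 'a"
  assumes carrier: "\<And>X. X \<in> carrier_mat n n \<Longrightarrow> \<Phi> X \<in> carrier_mat n n"
    and index: "\<And>X i j. X \<in> carrier_mat n n \<Longrightarrow> i < n \<Longrightarrow> j < n \<Longrightarrow> \<Phi> X $$ (i, j) = T (X $$ (f i j, g i j))"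
    and less: "\<And>i j. i < n \<Longrightarrow> j < n \<Longrightarrow> f i j < n \<and> g i j < n"
  shows "mat_positive_map n \<Phi> \<longleftrightarrow>
    (\<forall>a v. nonneg (mat_form n (\<lambda>i j. T (star (a (f i j)) * a (g i j))) v))"
proof (intro iffI allI)
  fix a v
  assume \<Phi>: "mat_positive_map n \<Phi>"
  show "nonneg (mat_form n (\<lambda>i j. T (star (a (f i j)) * a (g i j))) v)"
  proof (cases "n = 0")
    case False
    then obtain X where X: "X \<in> carrier_mat n n" "mat_pos n X"
      "\<And>i j. i < n \<Longrightarrow> j < n \<Longrightarrow> X $$ (i, j) = star (a i) * a j"
      using row_matrix_gram[of n a] by auto
    then have "mat_pos n (\<Phi> X)" using \<Phi> by (auto simp: mat_positive_map_def)
    then have "nonneg (mat_form n (\<lambda>i j. \<Phi> X $$ (i, j)) v)"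
      using mat_pos_iff[OF carrier[OF X(1)]] by blast
    moreover have "mat_form n (\<lambda>i j. \<Phi> X $$ (i, j)) v = mat_form n (\<lambda>i j. T (star (a (f i j)) * a (g i j))) v"
      using X less by (intro mat_form_cong) (simp add: index)
    ultimately show ?thesis by simp
  qed (simp add: mat_form_def)
next
  assume *: "\<forall>a v. nonneg (mat_form n (\<lambda>i j. T (star (a (f i j)) * a (g i j))) v)"
  have "mat_pos n (\<Phi> X)" if X: "X \<in> carrier_mat n n" "mat_pos n X" for X
  proof -
    obtain Y where Y: "Y \<in> carrier_mat n n" "X = mat_star Y * Y" using X(2) by (auto simp: mat_pos_def)
    have XY: "X $$ (i, j) = (\<Sum>k<n. star (Y $$ (k, i)) * Y $$ (k, j))" if "i < n" "j < n" for i j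
      unfolding Y(2) using Y(1) that by (rule mat_star_mult_index)
    have "nonneg (mat_form n (\<lambda>i j. \<Phi> X $$ (i, j)) v)" for v
    proof -
      have "mat_form n (\<lambda>i j. \<Phi> X $$ (i, j)) v
          = mat_form n (\<lambda>i j. \<Sum>k<n. T (star (Y $$ (k, f i j)) * Y $$ (k, g i j))) v"
        using X(1) XY less by (intro mat_form_cong) (simp add: index blinfun.sum_right[symmetric])
      also have "nonneg \<dots>"
        unfolding mat_form_sum by (rule nonneg_sum) (rule *[rule_format, of "\<lambda>j. Y $$ (_, j)"])
      finally show ?thesis .
    qed
    then show ?thesis using mat_pos_iff[OF carrier[OF X(1)]] by blast
  qed
  then show "mat_positive_map n \<Phi>" by (simp add: mat_positive_map_def)
qed

lemma CP_iff:
  "T \<in> CP \<longleftrightarrow> T \<in> B_op \<and> (\<forall>n a v. nonneg (mat_form n (\<lambda>i j. T (star (a i) * a j)) v))"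
  unfolding CP_def mem_Collect_eq
  by (subst mat_positive_map_iff[where T = T and f = "\<lambda>i j. i" and g = "\<lambda>i j. j"]) auto

lemma coCP_iff:
  "T \<in> coCP \<longleftrightarrow> T \<in> B_op \<and> (\<forall>n a v. nonneg (mat_form n (\<lambda>i j. T (star (a j) * a i)) v))"
  unfolding coCP_def mem_Collect_eq
  by (subst mat_positive_map_iff[where T = T and f = "\<lambda>i j. j" and g = "\<lambda>i j. i"]) auto

text \<open>The test row \<open>(1, x)\<close> gives a positive 2 by 2 matrix with
  \<open>T x\<close> and \<open>T (star x)\<close> off the diagonal, and positive matrices are
  hermitian.\<close>

lemma CP_star:
  assumes "T \<in> CP" shows "T (star x) = star (T x)"
proof -
  let ?a = "\<lambda>i::nat. if i = 0 then 1 else x"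
  have "hermitian 2 (\<lambda>i j. T (star (?a i) * ?a j))"
    using assms by (intro hermitian_if_nonneg_form) (simp add: CP_iff)
  from this[unfolded hermitian_def, rule_format, of 0 1] show ?thesis by simp
qed

lemma coCP_star:
  assumes "T \<in> coCP" shows "T (star x) = star (T x)"
proof -
  let ?a = "\<lambda>i::nat. if i = 0 then 1 else x"
  have "hermitian 2 (\<lambda>i j. T (star (?a j) * ?a i))"
    using assms by (intro hermitian_if_nonneg_form) (simp add: coCP_iff)
  from this[unfolded hermitian_def, rule_format, of 1 0] show ?thesis by simp
qed

section \<open>Dissipative maps\<close>

text \<open>Lindblad's dissipation form in its sesquilinear version, with the term in
  \<open>L 1\<close> that accounts for semigroups that are not unital.\<close>

definition dissipator :: "('a::cstar_algebra \<Rightarrow>\<^sub>L 'a) \<Rightarrow> 'a \<Rightarrow> 'a \<Rightarrow> 'a"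
  where "dissipator L x y = L (star x * y) - L (star x) * y - star x * L y + star x * L 1 * y"

lemma dissipation_matrix_index:
  fixes X :: "'a::cstar_algebra mat" and L :: "'a \<Rightarrow>\<^sub>L 'a"
  assumes X: "X \<in> carrier_mat n n" and ij: "i < n" "j < n"
  shows "(map_mat L (mat_star X * X) - map_mat L (mat_star X) * X - mat_star X * map_mat L X
      + mat_star X * map_mat L (1\<^sub>m n) * X) $$ (i, j) = (\<Sum>k<n. dissipator L (X $$ (k, i)) (X $$ (k, j)))"
proof -
  have "(mat_star X * map_mat L (1\<^sub>m n) * X) $$ (i, j)
      = (\<Sum>l<n. \<Sum>k<n. star (X $$ (k, i)) * L (1\<^sub>m n $$ (k, l)) * X $$ (l, j))"
    using assms by (simp add: scalar_prod_def atLeast0LessThan sum_distrib_right)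
  also have "\<dots> = (\<Sum>l<n. star (X $$ (l, i)) * L 1 * X $$ (l, j))"
  proof (rule sum.cong[OF refl])
    fix l assume l: "l \<in> {..<n}"
    have "(\<Sum>k<n. star (X $$ (k, i)) * L (1\<^sub>m n $$ (k, l)) * X $$ (l, j))
        = (\<Sum>k\<in>{l}. star (X $$ (k, i)) * L (1\<^sub>m n $$ (k, l)) * X $$ (l, j))"
      using l by (intro sum.mono_neutral_right) auto
    then show "(\<Sum>k<n. star (X $$ (k, i)) * L (1\<^sub>m n $$ (k, l)) * X $$ (l, j))
        = star (X $$ (l, i)) * L 1 * X $$ (l, j)" using l by simp
  qed
  finally have 1: "(mat_star X * map_mat L (1\<^sub>m n) * X) $$ (i, j)
      = (\<Sum>l<n. star (X $$ (l, i)) * L 1 * X $$ (l, j))" .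
  have 2: "map_mat L (mat_star X * X) $$ (i, j) = (\<Sum>k<n. L (star (X $$ (k, i)) * X $$ (k, j)))"
    using assms mat_star_mult_index[OF assms] by (simp add: blinfun.sum_right del: index_mult_mat(1))
  have 3: "(map_mat L (mat_star X) * X) $$ (i, j) = (\<Sum>k<n. L (star (X $$ (k, i))) * X $$ (k, j))"
    "(mat_star X * map_mat L X) $$ (i, j) = (\<Sum>k<n. star (X $$ (k, i)) * L (X $$ (k, j)))"
    using assms by (simp_all add: scalar_prod_def atLeast0LessThan)
  show ?thesis
    using assms 1 2 3
    by (simp add: dissipator_def sum.distrib sum_subtractf del: index_mult_mat(1) index_map_mat(1))
qed

text \<open>The matrix in the dissipation inequality for \<open>X\<close> is the sum, over the rows
  of \<open>X\<close>, of the matrices built from \<open>dissipator\<close>. Rows can therefore be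
  tested one at a time, and a single row is embedded as a matrix whose other rows are 0.\<close>

lemma dissipation_ineq_iff:
  fixes L :: "'a::cstar_algebra \<Rightarrow>\<^sub>L 'a"
  shows "(\<forall>n. dissipation_ineq n (map_mat L)) \<longleftrightarrow>
    (\<forall>n a v. nonneg (mat_form n (\<lambda>i j. dissipator L (a i) (a j)) v))"
proof -
  have carrier: "map_mat L (mat_star X * X) - map_mat L (mat_star X) * X - mat_star X * map_mat L X
      + mat_star X * map_mat L (1\<^sub>m n) * X \<in> carrier_mat n n" (is "?M n X \<in> _")
    if "X \<in> carrier_mat n n" for n X
    using that by (intro carrier_matI) simp_all
  have form: "mat_form n (\<lambda>i j. ?M n X $$ (i, j)) v
      = (\<Sum>k<n. mat_form n (\<lambda>i j. dissipator L (X $$ (k, i)) (X $$ (k, j))) v)"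
    if "X \<in> carrier_mat n n" for n X v
    unfolding mat_form_sum[symmetric] using that by (intro mat_form_cong dissipation_matrix_index)
  show ?thesis
  proof (intro iffI allI)
    fix n and a v :: "nat \<Rightarrow> 'a"
    assume *: "\<forall>n. dissipation_ineq n (map_mat L)"
    show "nonneg (mat_form n (\<lambda>i j. dissipator L (a i) (a j)) v)"
    proof (cases "n = 0")
      case False
      then have "n > 0" by simp
      then obtain Y where Y: "Y \<in> carrier_mat n n" "\<And>j. j < n \<Longrightarrow> Y $$ (0, j) = a j"
        "\<And>k j. 0 < k \<Longrightarrow> k < n \<Longrightarrow> j < n \<Longrightarrow> Y $$ (k, j) = 0"
        by (rule row_matrix[of n a]) (rule that)
      have "nonneg (mat_form n (\<lambda>i j. ?M n Y $$ (i, j)) v)"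
        using * Y(1) mat_pos_iff[OF carrier[OF Y(1)]] unfolding dissipation_ineq_def by blast
      also have "mat_form n (\<lambda>i j. ?M n Y $$ (i, j)) v
          = (\<Sum>k<n. mat_form n (\<lambda>i j. dissipator L (Y $$ (k, i)) (Y $$ (k, j))) v)"
        by (rule form[OF Y(1)])
      also have "\<dots> = (\<Sum>k\<in>{0}. mat_form n (\<lambda>i j. dissipator L (Y $$ (k, i)) (Y $$ (k, j))) v)"
        using False Y(3) by (intro sum.mono_neutral_right) (auto simp: mat_form_def dissipator_def)
      also have "\<dots> = mat_form n (\<lambda>i j. dissipator L (a i) (a j)) v"
        using Y(2) by (simp, intro mat_form_cong) simp
      finally show ?thesis .
    qed (simp add: mat_form_def)
  next
    fix n
    assume *: "\<forall>n a v. nonneg (mat_form n (\<lambda>i j. dissipator L (a i) (a j)) v)"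
    show "dissipation_ineq n (map_mat L)"
      unfolding dissipation_ineq_def
    proof
      fix X :: "'a mat" assume X: "X \<in> carrier_mat n n"
      have "nonneg (mat_form n (\<lambda>i j. ?M n X $$ (i, j)) v)" for v
        unfolding form[OF X] using * by (intro nonneg_sum) auto
      then show "mat_pos n (?M n X)" using carrier[OF X] by (simp add: mat_pos_iff)
    qed
  qed
qed

lemma mat_form_dissipator:
  "mat_form n (\<lambda>i j. dissipator L (a i) (a j)) v
    = mat_form n (\<lambda>i j. L (star (a i) * a j)) v
      - (\<Sum>i<n. star (v i) * L (star (a i))) * (\<Sum>j<n. a j * v j)
      - star (\<Sum>j<n. a j * v j) * (\<Sum>j<n. L (a j) * v j)
      + star (\<Sum>j<n. a j * v j) * L 1 * (\<Sum>j<n. a j * v j)"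
proof -
  have "star (v i) * dissipator L (a i) (a j) * v j
      = star (v i) * L (star (a i) * a j) * v j - (star (v i) * L (star (a i))) * (a j * v j)
        - star (a i * v i) * (L (a j) * v j) + star (a i * v i) * L 1 * (a j * v j)" for i j
    by (simp add: dissipator_def star_mult algebra_simps)
  then show ?thesis
    by (simp add: mat_form_def sum.distrib sum_subtractf star_sum flip: sum_distrib_left sum_distrib_right)
qed

text \<open>Conditional positivity implies dissipativity: appending \<open>1\<close> to
  \<open>a\<close> and \<open>- s\<close> to \<open>v\<close> makes the sum vanish, and the
  additional terms of the form are exactly the correction terms of
  \<open>dissipator\<close>.\<close>

lemma dissipator_form_nonneg:
  fixes L :: "'a::cstar_algebra \<Rightarrow>\<^sub>L 'a"
  assumes cond: "\<And>n a v. (\<Sum>i<n. a i * v i) = 0 \<Longrightarrow> nonneg (mat_form n (\<lambda>i j. L (star (a i) * a j)) v)"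
  shows "nonneg (mat_form n (\<lambda>i j. dissipator L (a i) (a j)) v)"
proof -
  define s where "s = (\<Sum>j<n. a j * v j)"
  define a' where "a' = a(n := 1)"
  define v' where "v' = v(n := - s)"
  have "(\<Sum>i<n. a' i * v' i) = s" by (simp add: s_def a'_def v'_def)
  then have "nonneg (mat_form (Suc n) (\<lambda>i j. L (star (a' i) * a' j)) v')"
    by (intro cond) (simp add: a'_def v'_def)
  also have "mat_form (Suc n) (\<lambda>i j. L (star (a' i) * a' j)) v'
      = mat_form n (\<lambda>i j. L (star (a i) * a j)) v - (\<Sum>i<n. star (v i) * L (star (a i)) * s)
        - star s * (\<Sum>j<n. L (a j) * v j) + star s * L 1 * s"
    by (simp add: mat_form_def a'_def v'_def sum.distrib star_minus sum_negf sum_distrib_left sum_subtractf mult.assoc)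
  also have "\<dots> = mat_form n (\<lambda>i j. dissipator L (a i) (a j)) v"
    by (simp add: mat_form_dissipator s_def[symmetric] sum_distrib_right)
  finally show ?thesis .
qed

section \<open>States that are multiplicative on the centre\<close>

definition central :: "'a::cstar_algebra \<Rightarrow> bool"
  where "central z \<longleftrightarrow> (\<forall>x. z * x = x * z)"

lemma central_1 [simp]: "central 1" by (simp add: central_def)
lemma central_0 [simp]: "central 0" by (simp add: central_def)
lemma centralI: "(\<And>x. z * x = x * z) \<Longrightarrow> central z" by (simp add: central_def)

lemma centralD: "central z \<Longrightarrow> z * x = x * z" unfolding central_def by blast

lemma central_add: "central x \<Longrightarrow> central y \<Longrightarrow> central (x + y)"
  by (rule centralI) (simp only: distrib_left distrib_right centralD[of x] centralD[of y])

lemma central_diff: "central x \<Longrightarrow> central y \<Longrightarrow> central (x - y)"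
  by (rule centralI) (simp only: left_diff_distrib right_diff_distrib centralD[of x] centralD[of y])

lemma central_scaleR: "central x \<Longrightarrow> central (r *\<^sub>R x)" by (simp add: central_def)
lemma central_scaleC: "central x \<Longrightarrow> central (c *\<^sub>C x)"
  by (simp add: central_def mult_scaleC_left mult_scaleC_right)
lemma central_mult: "central x \<Longrightarrow> central y \<Longrightarrow> central (x * y)"
  by (rule centralI) (metis centralD mult.assoc)

lemma central_star: "central x \<Longrightarrow> central (star x)"
  by (rule centralI) (metis centralD star_mult star_star)

text \<open>A cone in the spirit of the quadratic modules of real algebra, but stable only under
  positive central factors. This stability is what makes the resulting state multiplicative against
  the centre.\<close>

locale positive_premodule =
  fixes W :: "'a::cstar_algebra set"
  assumes nonneg_in: "nonneg x \<Longrightarrow> x \<in> W"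
    and selfadjoint: "x \<in> W \<Longrightarrow> star x = x"
    and add_in: "x \<in> W \<Longrightarrow> y \<in> W \<Longrightarrow> x + y \<in> W"
    and central_mult_in: "x \<in> W \<Longrightarrow> nonneg z \<Longrightarrow> central z \<Longrightarrow> z * x \<in> W"
begin

lemma scaleR_in: "x \<in> W \<Longrightarrow> r \<ge> 0 \<Longrightarrow> r *\<^sub>R x \<in> W"
  using central_mult_in[of x "r *\<^sub>R 1"] by (simp add: nonneg_scaleR central_scaleR)

lemma adjoin:
  assumes x: "star x = x"
  shows "positive_premodule {w + z * x | w z. w \<in> W \<and> nonneg z \<and> central z}" (is "positive_premodule ?X")
proof
  fix y :: 'a assume "nonneg y"
  then show "y \<in> ?X"
    using nonneg_in by (intro CollectI exI[of _ y] exI[of _ 0]) simp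
next
  fix y assume "y \<in> ?X"
  then obtain w z where y: "y = w + z * x" "w \<in> W" "nonneg z" "central z" by blast
  have "star y = w + x * z"
    using selfadjoint[OF y(2)] nonneg_star[OF y(3)] x by (simp add: y(1) star_simps)
  also have "x * z = z * x" using centralD[OF y(4)] by simp
  finally show "star y = y" by (simp add: y(1))
next
  fix y y' assume "y \<in> ?X"
    and "y' \<in> ?X"
  then obtain w z w' z' where y: "y = w + z * x" "w \<in> W" "nonneg z" "central z"
    and y': "y' = w' + z' * x" "w' \<in> W" "nonneg z'" "central z'" by blast
  have "y + y' = (w + w') + (z + z') * x" by (simp add: y(1) y'(1) algebra_simps)
  then show "y + y' \<in> ?X"
    using add_in[OF y(2) y'(2)] nonneg_add[OF y(3) y'(3)] central_add[OF y(4) y'(4)] by blast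
next
  fix y u :: 'a assume "y \<in> ?X" and u: "nonneg u" "central u"
  then obtain w z where y: "y = w + z * x" "w \<in> W" "nonneg z" "central z" by blast
  have "u * y = u * w + (u * z) * x" by (simp add: y(1) algebra_simps)
  moreover have "nonneg (u * z)" by (rule nonneg_mult[OF u(1) y(3) centralD[OF u(2)]])
  ultimately show "u * y \<in> ?X"
    using central_mult_in[OF y(2) u] central_mult[OF u(2) y(4)] by blast
qed

end

text \<open>The analogue of an ordering: totality compares every self-adjoint element with every
  real multiple of 1, and these comparisons determine a real number as a cut.\<close>

locale total_positive_module = positive_premodule +
  assumes proper: "- 1 \<notin> W"
    and total: "star x = x \<Longrightarrow> x \<in> W \<or> - x \<in> W"
begin

lemma scaleR_1_in_iff: "r *\<^sub>R 1 \<in> W \<longleftrightarrow> r \<ge> 0"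
proof
  assume r: "r *\<^sub>R 1 \<in> W"
  show "r \<ge> 0"
  proof (rule ccontr)
    assume "\<not> r \<ge> 0"
    then have "inverse (- r) *\<^sub>R (r *\<^sub>R 1) \<in> W" by (intro scaleR_in[OF r]) simp
    moreover have "inverse (- r) *\<^sub>R (r *\<^sub>R 1) = - (1::'a)" using \<open>\<not> r \<ge> 0\<close> by simp
    ultimately show False using proper by simp
  qed
qed (simp add: nonneg_in nonneg_scaleR)

text \<open>\<open>value_at x c\<close> states that \<open>c\<close> is the value at \<open>x\<close> of the functional defined by the cone.\<close>

definition value_at :: "'a \<Rightarrow> real \<Rightarrow> bool"
  where "value_at x c \<longleftrightarrow> (\<forall>e>0. x - (c - e) *\<^sub>R 1 \<in> W \<and> (c + e) *\<^sub>R 1 - x \<in> W)"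

lemma value_at_unique:
  assumes "value_at x c" "value_at x d" shows "c = d"
proof -
  have le: "d \<le> c" if "value_at x c" "value_at x d" for c d
  proof (rule field_le_epsilon)
    fix e :: real assume "e > 0"
    define k where "k = e / 2"
    have k: "k > 0" using \<open>e > 0\<close> by (simp add: k_def)
    then have "x - (d - k) *\<^sub>R 1 \<in> W" "(c + k) *\<^sub>R 1 - x \<in> W"
      using that by (auto simp: value_at_def)
    then have "(x - (d - k) *\<^sub>R 1) + ((c + k) *\<^sub>R 1 - x) \<in> W" by (rule add_in)
    moreover have "(x - (d - k) *\<^sub>R 1) + ((c + k) *\<^sub>R 1 - x) = ((c + k) - (d - k)) *\<^sub>R 1"
      by (simp only: scaleR_diff_left[of "c + k" "d - k"]) simp
    ultimately have "((c + k) - (d - k)) *\<^sub>R 1 \<in> W" by (simp only:)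
    then have "(c + k) - (d - k) \<ge> 0" by (simp only: scaleR_1_in_iff)
    then show "d \<le> c + e" by (simp add: k_def)
  qed
  then show ?thesis using assms by (meson order_antisym)
qed

text \<open>The value is the supremum of the real \<open>r\<close> with \<open>x - r\<close> in the
  cone; the upper estimate comes from totality.\<close>

lemma value_at_exists:
  assumes x: "star x = x"
  obtains c where "value_at x c"
proof -
  let ?S = "{r. x - r *\<^sub>R 1 \<in> W}"
  have "norm x *\<^sub>R 1 + x \<in> W" by (rule nonneg_in) (rule nonneg_bound(2)[OF x order_refl])
  then have ne: "- norm x \<in> ?S" by (simp add: add.commute)
  have ub: "r \<le> norm x" if "r \<in> ?S" for r
  proof -
    have "norm x *\<^sub>R 1 - x \<in> W" by (rule nonneg_in) (rule nonneg_bound(1)[OF x order_refl])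
    from add_in[OF this, of "x - r *\<^sub>R 1"] that have "(norm x - r) *\<^sub>R 1 \<in> W"
      by (simp add: scaleR_diff_left)
    then show ?thesis by (simp add: scaleR_1_in_iff)
  qed
  then have bdd: "bdd_above ?S" by (intro bdd_aboveI)
  have "value_at x (Sup ?S)"
    unfolding value_at_def
  proof (intro allI impI conjI)
    fix e :: real assume e: "e > 0"
    then have "Sup ?S - e < Sup ?S" by simp
    then obtain r where r: "r \<in> ?S" "Sup ?S - e < r"
      using less_cSup_iff[of ?S] ne bdd by blast
    then have "(x - r *\<^sub>R 1) + (r - (Sup ?S - e)) *\<^sub>R 1 \<in> W"
      by (intro add_in) (simp_all add: scaleR_1_in_iff)
    then show "x - (Sup ?S - e) *\<^sub>R 1 \<in> W" by (simp add: algebra_simps)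
    have "Sup ?S + e \<notin> ?S" using cSup_upper[OF _ bdd, of "Sup ?S + e"] e by auto
    then have "- (x - (Sup ?S + e) *\<^sub>R 1) \<in> W"
      using total[of "x - (Sup ?S + e) *\<^sub>R 1"] x by (auto simp: star_simps)
    then show "(Sup ?S + e) *\<^sub>R 1 - x \<in> W" by simp
  qed
  then show thesis by (rule that)
qed

lemma value_at_add:
  assumes "value_at x c" "value_at y d" shows "value_at (x + y) (c + d)"
  unfolding value_at_def
proof (intro allI impI)
  fix e :: real assume "e > 0"
  then have "x - (c - e/2) *\<^sub>R 1 \<in> W" "(c + e/2) *\<^sub>R 1 - x \<in> W"
    "y - (d - e/2) *\<^sub>R 1 \<in> W" "(d + e/2) *\<^sub>R 1 - y \<in> W"
    using assms by (auto simp: value_at_def)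
  then have "(x - (c - e/2) *\<^sub>R 1) + (y - (d - e/2) *\<^sub>R 1) \<in> W"
    "((c + e/2) *\<^sub>R 1 - x) + ((d + e/2) *\<^sub>R 1 - y) \<in> W" by (simp_all add: add_in)
  moreover have "(x - (c - e/2) *\<^sub>R 1) + (y - (d - e/2) *\<^sub>R 1) = x + y - (c + d - e) *\<^sub>R 1"
    by (simp add: algebra_simps flip: scaleR_left_distrib)
  moreover have "((c + e/2) *\<^sub>R 1 - x) + ((d + e/2) *\<^sub>R 1 - y) = (c + d + e) *\<^sub>R 1 - (x + y)"
    by (simp add: algebra_simps flip: scaleR_left_distrib)
  ultimately show "x + y - (c + d - e) *\<^sub>R 1 \<in> W \<and> (c + d + e) *\<^sub>R 1 - (x + y) \<in> W" by simp
qed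

lemma value_at_minus:
  assumes "value_at x c" shows "value_at (- x) (- c)"
  unfolding value_at_def
proof (intro allI impI)
  fix e :: real assume "e > 0"
  then have "x - (c - e) *\<^sub>R 1 \<in> W" "(c + e) *\<^sub>R 1 - x \<in> W"
    using assms by (auto simp: value_at_def)
  then show "- x - (- c - e) *\<^sub>R 1 \<in> W \<and> (- c + e) *\<^sub>R 1 - (- x) \<in> W"
    by (simp add: algebra_simps)
qed

lemma value_at_1: "value_at (r *\<^sub>R 1) r"
  unfolding value_at_def by (simp only: scaleR_diff_left[symmetric] scaleR_1_in_iff) simp

lemma value_at_in: "x \<in> W \<Longrightarrow> value_at x c \<Longrightarrow> c \<ge> 0"
proof (rule field_le_epsilon)
  fix e :: real assume x: "x \<in> W" "value_at x c" "e > 0"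
  then have "x + ((c + e) *\<^sub>R 1 - x) \<in> W" by (intro add_in) (auto simp: value_at_def)
  then show "0 \<le> c + e" by (simp add: scaleR_1_in_iff)
qed

lemma value_at_central_mult:
  assumes z: "nonneg z" "central z" "value_at z d" and x: "value_at x c"
  shows "value_at (z * x) (d * c)"
proof -
  have lower: "z * x - (d * c - e) *\<^sub>R 1 \<in> W" if x: "value_at x c" and e: "e > 0" for x c e
  proof -
    \<comment> \<open>Approximating the value of \<open>x\<close> costs \<open>k norm z\<close>,
      approximating the value of \<open>z\<close> costs \<open>\<bar>c\<bar> k\<close>, and a
      further \<open>k\<close> keeps the denominator positive; together they make up
      \<open>e\<close>.\<close>
    define k where "k = e / (norm z + \<bar>c\<bar> + 1)"
    have pos: "norm z + \<bar>c\<bar> + 1 > 0" by (simp add: add_nonneg_pos)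
    have k: "k > 0" using e pos by (simp add: k_def)
    have "x - (c - k) *\<^sub>R 1 \<in> W" using x k by (simp add: value_at_def)
    then have 1: "z * (x - (c - k) *\<^sub>R 1) \<in> W" using z by (intro central_mult_in)
    have "norm z *\<^sub>R 1 - z \<in> W"
      by (rule nonneg_in) (rule nonneg_bound(1)[OF nonneg_star[OF z(1)] order_refl])
    then have 2: "k *\<^sub>R (norm z *\<^sub>R 1 - z) \<in> W" using k by (intro scaleR_in) simp_all
    have 3: "c *\<^sub>R z - (c * d) *\<^sub>R 1 + (\<bar>c\<bar> * k) *\<^sub>R 1 \<in> W"
    proof (cases "c \<ge> 0")
      case True
      have "c *\<^sub>R (z - (d - k) *\<^sub>R 1) \<in> W" using z(3) k True by (intro scaleR_in) (simp_all add: value_at_def)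
      then show ?thesis using True by (simp add: algebra_simps)
    next
      case False
      have "(- c) *\<^sub>R ((d + k) *\<^sub>R 1 - z) \<in> W" using z(3) k False by (intro scaleR_in) (simp_all add: value_at_def)
      then show ?thesis using False by (simp add: algebra_simps)
    qed
    have 4: "k *\<^sub>R 1 \<in> W" using k by (simp add: scaleR_1_in_iff)
    have "z * (x - (c - k) *\<^sub>R 1) + k *\<^sub>R (norm z *\<^sub>R 1 - z)
        + (c *\<^sub>R z - (c * d) *\<^sub>R 1 + (\<bar>c\<bar> * k) *\<^sub>R 1) + k *\<^sub>R 1
        = z * x - (d * c) *\<^sub>R 1 + (k * (norm z + \<bar>c\<bar> + 1)) *\<^sub>R 1"
      by (simp add: algebra_simps)
    also have "k * (norm z + \<bar>c\<bar> + 1) = e" using pos by (simp add: k_def)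
    finally have "z * x - (d * c) *\<^sub>R 1 + e *\<^sub>R 1 \<in> W"
      using add_in[OF add_in[OF add_in[OF 1 2] 3] 4] by (simp only:)
    then show ?thesis by (simp add: algebra_simps)
  qed
  show ?thesis unfolding value_at_def
  proof (intro allI impI conjI)
    fix e :: real assume e: "e > 0"
    show "z * x - (d * c - e) *\<^sub>R 1 \<in> W" using lower[OF x e] .
    show "(d * c + e) *\<^sub>R 1 - z * x \<in> W" using lower[OF value_at_minus[OF x] e]
      by (simp add: algebra_simps)
  qed
qed

end

lemma total_positive_module_exists:
  fixes Z :: "'a::cstar_algebra"
  assumes Z: "star Z = Z" "\<not> nonneg Z"
  obtains W where "total_positive_module W" and "- Z \<in> W"
proof -
  let ?F = "{W. positive_premodule W \<and> - 1 \<notin> W \<and> - Z \<in> W}"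
  interpret P: positive_premodule "{x::'a. nonneg x}"
  proof
    fix x z :: 'a assume "x \<in> {x. nonneg x}" "nonneg z" "central z"
    then show "z * x \<in> {x. nonneg x}" using nonneg_mult[of z x] centralD[of z x] by simp
  qed (simp_all add: nonneg_star nonneg_add)
  define W0 where "W0 = {w + z * (- Z) | w z. w \<in> {x. nonneg x} \<and> nonneg z \<and> central z}"
  have W0: "positive_premodule W0"
    unfolding W0_def by (rule P.adjoin) (simp add: Z(1) star_minus)
  moreover have "- 1 \<notin> W0"
  proof
    assume "- 1 \<in> W0"
    then obtain p z where pz: "- 1 = p + z * (- Z)" "nonneg p" "nonneg z" "central z"
      by (auto simp: W0_def)
    \<comment> \<open>\<open>z\<close> need not be invertible. From \<open>z Z = 1 + p\<close>, the
      shifted product \<open>(z + k) Z\<close> is \<open>p + (1 + k Z)\<close>, still positive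
      because \<open>norm (k Z) \<le> 1\<close>; dividing by the invertible central element
      \<open>z + k\<close> gives \<open>Z \<ge> 0\<close>.\<close>
    define k where "k = inverse (norm Z + 1)"
    have k: "k > 0" by (simp add: k_def add_nonneg_pos)
    have "nonneg (z + k *\<^sub>R 1 - k *\<^sub>R 1)" using pz(3) by simp
    then obtain y where y: "(z + k *\<^sub>R 1) * y = 1" "y * (z + k *\<^sub>R 1) = 1" "nonneg y"
        "\<And>u. u * (z + k *\<^sub>R 1) = (z + k *\<^sub>R 1) * u \<Longrightarrow> u * y = y * u"
      using k by (rule nonneg_inverse) (rule that)
    have yc: "u * y = y * u" for u
      by (rule y(4)) (simp add: distrib_left distrib_right centralD[OF pz(4)])
    have "norm (k *\<^sub>R Z) \<le> 1" using k by (simp add: k_def field_simps)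
    then have "nonneg (1 *\<^sub>R 1 + k *\<^sub>R Z)" using Z(1) by (intro nonneg_bound) (simp_all add: star_scaleR)
    then have "nonneg (p + (1 *\<^sub>R 1 + k *\<^sub>R Z))" by (rule nonneg_add[OF pz(2)])
    moreover have "p + (1 *\<^sub>R 1 + k *\<^sub>R Z) = (z + k *\<^sub>R 1) * Z"
      using pz(1) by (simp add: algebra_simps)
    ultimately have q: "nonneg ((z + k *\<^sub>R 1) * Z)" by simp
    have "Z = y * ((z + k *\<^sub>R 1) * Z)" by (simp add: mult.assoc[symmetric] y)
    then show False using nonneg_mult[OF y(3) q] yc Z(2) by metis
  qed
  moreover have "- Z \<in> W0"
    unfolding W0_def by (rule CollectI, intro exI[of _ 0] exI[of _ 1]) simp
  ultimately have ne: "?F \<noteq> {}" by blast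
  have "\<exists>M\<in>?F. \<forall>X\<in>?F. M \<subseteq> X \<longrightarrow> X = M"
  proof (rule subset_Zorn_nonempty[OF ne])
    fix C assume C: "C \<noteq> {}" "subset.chain ?F C"
    have mem: "positive_premodule X" "- 1 \<notin> X" "- Z \<in> X" if "X \<in> C" for X
      using C(2) that by (auto simp: subset.chain_def)
    have ch: "X \<subseteq> Y \<or> Y \<subseteq> X" if "X \<in> C" "Y \<in> C" for X Y
      using C(2) that by (auto simp: subset.chain_def)
    have "positive_premodule (\<Union>C)"
    proof
      fix x :: 'a assume "nonneg x"
      then show "x \<in> \<Union>C" using C(1) mem(1) positive_premodule.nonneg_in by blast
    next
      fix x assume "x \<in> \<Union>C"
      then show "star x = x" using mem(1) positive_premodule.selfadjoint by blast
    next
      fix x y assume "x \<in> \<Union>C" "y \<in> \<Union>C"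
      then obtain X Y where XY: "X \<in> C" "Y \<in> C" "x \<in> X" "y \<in> Y" by blast
      then obtain V where V: "V \<in> C" "x \<in> V" "y \<in> V" using ch[OF XY(1,2)] by blast
      then have "x + y \<in> V" using mem(1) positive_premodule.add_in by blast
      then show "x + y \<in> \<Union>C" using V(1) by blast
    next
      fix x z :: 'a assume "x \<in> \<Union>C" "nonneg z" "central z"
      then show "z * x \<in> \<Union>C" using mem(1) positive_premodule.central_mult_in by blast
    qed
    then show "\<Union>C \<in> ?F" using mem C(1) by blast
  qed
  then obtain W where W: "positive_premodule W" "- 1 \<notin> W" "- Z \<in> W"
    and max: "\<And>X. positive_premodule X \<Longrightarrow> - 1 \<notin> X \<Longrightarrow> - Z \<in> X \<Longrightarrow> W \<subseteq> X \<Longrightarrow> X = W"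
    by blast
  interpret W: positive_premodule W by (rule W(1))
  have adj: "\<exists>w z. - 1 = w + z * x \<and> w \<in> W \<and> nonneg z \<and> central z" if x: "star x = x" "x \<notin> W" for x
  proof (rule ccontr)
    assume no: "\<nexists>w z. - 1 = w + z * x \<and> w \<in> W \<and> nonneg z \<and> central z"
    let ?X = "{w + z * x | w z. w \<in> W \<and> nonneg z \<and> central z}"
    have sub: "W \<subseteq> ?X"
    proof
      fix w assume "w \<in> W"
      then show "w \<in> ?X" by (intro CollectI exI[of _ w] exI[of _ 0]) simp
    qed
    have "?X = W"
    proof (rule max)
      show "positive_premodule ?X" using x(1) by (rule W.adjoin)
      show "- 1 \<notin> ?X" using no by blast
      show "- Z \<in> ?X" using sub W(3) by blast
    qed (rule sub)
    moreover have "x \<in> ?X" using W.nonneg_in[of 0] by (intro CollectI exI[of _ 0] exI[of _ 1]) simp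
    ultimately show False using x(2) by simp
  qed
  have "x \<in> W \<or> - x \<in> W" if x: "star x = x" for x
  proof (rule ccontr)
    assume "\<not> (x \<in> W \<or> - x \<in> W)"
    then obtain w z v u where 1: "- 1 = w + z * x" "w \<in> W" "nonneg z" "central z"
      and 2: "- 1 = v + u * (- x)" "v \<in> W" "nonneg u" "central u"
      using adj[of x] adj[of "- x"] x by (metis star_minus)
    \<comment> \<open>Eliminating \<open>x\<close> from the two relations puts \<open>- z\<close>
      into \<open>W\<close>. Then \<open>z x = z (norm x + x) + norm x (- z)\<close> lies in
      \<open>W\<close>, and with it \<open>- 1 = w + z x\<close>.\<close>
    have zu: "z * u = u * z" by (rule centralD[OF 1(4)])
    have "u * (- 1) = u * w + u * z * x" by (subst 1(1)) (simp add: algebra_simps)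
    then have "u * z * x = - u - u * w" by (simp add: eq_diff_eq add.commute)
    moreover have "z * (- 1) = z * v - u * z * x"
      by (subst 2(1)) (simp add: right_diff_distrib mult.assoc[symmetric] zu)
    ultimately have "- z = z * v + (u + u * w)" by simp
    moreover have "z * v + (u + u * w) \<in> W"
      by (intro W.add_in[OF W.central_mult_in[OF 2(2) 1(3,4)]]
          W.add_in[OF W.nonneg_in[OF 2(3)] W.central_mult_in[OF 1(2) 2(3,4)]])
    ultimately have mz: "- z \<in> W" by simp
    have "nonneg (z * (norm x *\<^sub>R 1 + x))"
      by (rule nonneg_mult[OF 1(3) nonneg_bound(2)[OF x order_refl] centralD[OF 1(4)]])
    then have "z * (norm x *\<^sub>R 1 + x) + norm x *\<^sub>R (- z) \<in> W"
      by (rule W.add_in[OF W.nonneg_in W.scaleR_in[OF mz norm_ge_zero]])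
    then have "z * x \<in> W" by (simp add: algebra_simps)
    then have "w + z * x \<in> W" by (rule W.add_in[OF 1(2)])
    then show False using 1(1) W(2) by simp
  qed
  then have "total_positive_module W"
    using W(2) by unfold_locales
  then show thesis using W(3) by (rule that)
qed


text \<open>Pure states have these properties; here such functionals are obtained from maximal
  cones, without extreme points of the state space.\<close>

locale central_state =
  fixes \<omega> :: "'a::cstar_algebra \<Rightarrow> complex"
  assumes add: "\<omega> (x + y) = \<omega> x + \<omega> y"
    and scaleC: "\<omega> (c *\<^sub>C x) = c * \<omega> x"
    and star: "\<omega> (star x) = cnj (\<omega> x)"
    and nonneg: "nonneg x \<Longrightarrow> Re (\<omega> x) \<ge> 0"
    and one: "\<omega> 1 = 1"
    and central_mult: "central z \<Longrightarrow> \<omega> (z * x) = \<omega> z * \<omega> x"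
begin

lemma scaleR: "\<omega> (r *\<^sub>R x) = r * \<omega> x"
  using scaleC[of "complex_of_real r" x] by (simp add: scaleC_of_real)

lemma zero: "\<omega> 0 = 0" using scaleR[of 0 0] by simp

lemma diff: "\<omega> (x - y) = \<omega> x - \<omega> y"
  using add[of "x - y" y] by simp

lemma sum: "\<omega> (sum f I) = (\<Sum>i\<in>I. \<omega> (f i))"
  by (induction I rule: infinite_finite_induct) (simp_all add: zero add)

lemma real: "star x = x \<Longrightarrow> \<omega> x = complex_of_real (Re (\<omega> x))"
  using star[of x] by (simp add: complex_eq_iff)

lemma bound:
  assumes "star x = x" shows "Re (\<omega> x) \<le> norm x"
  using nonneg[OF nonneg_bound(1)[OF assms order_refl]] by (simp add: diff scaleR one)

end

text \<open>
  If \<open>z Z = 1 + p\<close> with central \<open>z \<ge> 0\<close> and \<open>p \<ge> 0\<close>, then \<open>Z \<ge> 0\<close>; so a self-adjoint \<open>Z\<close> that is not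
  positive is compatible with a proper cone that is stable under positive central elements and contains
  \<open>-Z\<close>, and a maximal such cone defines the state.
\<close>

theorem central_state_exists:
  fixes Z :: "'a::cstar_algebra"
  assumes Z: "star Z = Z" "\<not> nonneg Z"
  obtains \<omega> where "central_state \<omega>" and "Re (\<omega> Z) < 0"
proof -
  \<comment> \<open>Membership of \<open>- Z\<close> in the cone would give only a value
    \<open>\<le> 0\<close> at \<open>Z\<close>; the margin \<open>d\<close> makes it
    negative.\<close>
  have "\<exists>d>0. \<not> nonneg (Z + d *\<^sub>R 1)"
  proof (rule ccontr)
    assume "\<not> ?thesis"
    then have *: "nonneg (Z + d *\<^sub>R 1)" if "d > 0" for d using that by blast
    have "nonneg Z" by (rule nonneg_perturb[OF *])
    then show False using Z(2) by simp
  qed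
  then obtain d where d: "d > 0" "\<not> nonneg (Z + d *\<^sub>R 1)" by blast
  have "star (Z + d *\<^sub>R 1) = Z + d *\<^sub>R 1" using Z(1) by (simp add: star_simps)
  then obtain W where W: "total_positive_module W" "- (Z + d *\<^sub>R 1) \<in> W"
    using d(2) by (rule total_positive_module_exists) (rule that)
  interpret total_positive_module W by (rule W(1))
  define v where "v x = (THE c. value_at x c)" for x
  have v_eq: "v x = c" if "value_at x c" for x c
    unfolding v_def using that value_at_unique by blast
  have v: "value_at x (v x)" if "star x = x" for x
    using value_at_exists[OF that] v_eq by metis
  have v_add: "v (x + y) = v x + v y" if "star x = x" "star y = y" for x y
    by (rule v_eq[OF value_at_add[OF v[OF that(1)] v[OF that(2)]]])
  have v_minus: "v (- x) = - v x" if "star x = x" for x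
    by (rule v_eq[OF value_at_minus[OF v[OF that]]])
  have v_scale1: "v (r *\<^sub>R 1) = r" for r by (rule v_eq[OF value_at_1])
  have v_nonneg: "v x \<ge> 0" if "nonneg x" for x
    by (rule value_at_in[OF nonneg_in[OF that] v[OF nonneg_star[OF that]]])
  have v_central: "v (z * x) = v z * v x" if z: "star z = z" "central z" and x: "star x = x" for z x
  proof -
    \<comment> \<open>A self-adjoint central \<open>z\<close> is the difference of the positive
      central elements \<open>u\<close> and \<open>norm z\<close>.\<close>
    define u where "u = norm z *\<^sub>R 1 + z"
    have u: "nonneg u" unfolding u_def by (rule nonneg_bound(2)[OF z(1) order_refl])
    have uc: "central u" unfolding u_def by (intro central_add central_scaleR central_1 z)
    have ux: "v (u * x) = v u * v x"
      by (rule v_eq[OF value_at_central_mult[OF u uc v[OF nonneg_star[OF u]] v[OF x]]])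
    have nx: "v (norm z *\<^sub>R x) = norm z * v x"
      using v_eq[OF value_at_central_mult[OF _ _ value_at_1[of "norm z"] v[OF x]]]
      by (simp add: nonneg_scaleR central_scaleR)
    have zx: "star (z * x) = z * x" using z x centralD[OF z(2), of x] by (simp add: star_mult)
    have "v (u * x) = v (norm z *\<^sub>R x) + v (z * x)"
      unfolding u_def distrib_right by (subst v_add) (simp_all add: star_scaleR x zx)
    moreover have "v u = norm z + v z"
      unfolding u_def by (subst v_add) (simp_all add: star_scaleR z v_scale1)
    ultimately show ?thesis using ux nx by (simp add: algebra_simps)
  qed
  have v_scale: "v (r *\<^sub>R x) = r * v x" if "star x = x" for r x
    using v_central[of "r *\<^sub>R 1" x] that by (simp add: star_scaleR central_scaleR v_scale1)
  define re where "re x = (1/2) *\<^sub>R (x + star x)" for x :: 'a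
  define im where "im x = (1/2) *\<^sub>R (\<i> *\<^sub>C (star x - x))" for x :: 'a
  have re_sa: "star (re x) = re x" for x by (simp add: re_def star_simps add.commute)
  have im_sa: "star (im x) = im x" for x
    by (simp add: im_def star_simps scaleC_minus_left scaleC_diff_right)
  have decomp: "x = re x + \<i> *\<^sub>C im x" for x
  proof -
    have "\<i> *\<^sub>C im x = (1/2) *\<^sub>R (x - star x)" by (simp add: im_def scaleC_scaleR scaleC_i_i)
    then have "re x + \<i> *\<^sub>C im x = (1/2) *\<^sub>R ((x + star x) + (x - star x))"
      by (simp only: re_def scaleR_add_right)
    also have "(x + star x) + (x - star x) = 2 *\<^sub>R x" by (simp add: scaleR_2)
    finally show ?thesis by simp
  qed
  have re_add: "re (x + y) = re x + re y" and im_add: "im (x + y) = im x + im y" for x y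
    by (simp_all add: re_def im_def star_simps scaleC_add_right scaleC_diff_right algebra_simps)
  have re_scale: "re (r *\<^sub>R x) = r *\<^sub>R re x" and im_scale: "im (r *\<^sub>R x) = r *\<^sub>R im x" for r x
    by (simp_all add: re_def im_def star_simps scaleC_scaleR scaleC_diff_right algebra_simps)
  have re_i: "re (\<i> *\<^sub>C x) = - im x" and im_i: "im (\<i> *\<^sub>C x) = re x" for x
    by (simp_all add: re_def im_def star_simps scaleC_minus_left scaleC_minus_right scaleC_diff_right
        scaleC_i_i algebra_simps)
  define \<omega> where "\<omega> x = complex_of_real (v (re x)) + \<i> * complex_of_real (v (im x))" for x
  have \<omega>_add: "\<omega> (x + y) = \<omega> x + \<omega> y" for x y
    by (simp add: \<omega>_def re_add im_add v_add re_sa im_sa algebra_simps)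
  have \<omega>_scaleR: "\<omega> (r *\<^sub>R x) = r * \<omega> x" for r x
    by (simp add: \<omega>_def re_scale im_scale v_scale re_sa im_sa algebra_simps)
  have \<omega>_i: "\<omega> (\<i> *\<^sub>C x) = \<i> * \<omega> x" for x
    by (simp add: \<omega>_def re_i im_i v_minus re_sa im_sa algebra_simps)
  have \<omega>_scaleC: "\<omega> (c *\<^sub>C x) = c * \<omega> x" for c x
  proof -
    have "\<omega> (c *\<^sub>C x) = (complex_of_real (Re c) + \<i> * complex_of_real (Im c)) * \<omega> x"
      by (subst scaleC_decomp) (simp add: \<omega>_add \<omega>_scaleR \<omega>_i algebra_simps)
    then show ?thesis by (simp only: complex_eq[symmetric])
  qed
  have \<omega>_sa: "\<omega> x = v x" if "star x = x" for x
  proof -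
    have "re x = x" "im x = 0" using that by (simp_all add: re_def im_def flip: scaleR_2)
    moreover have "v 0 = 0" using v_scale1[of 0] by simp
    ultimately show ?thesis by (simp add: \<omega>_def)
  qed
  have \<omega>_star: "\<omega> (star x) = cnj (\<omega> x)" for x
  proof -
    have "re (star x) = re x" "im (star x) = - im x"
      by (simp_all add: re_def im_def add.commute scaleC_diff_right algebra_simps)
    then show ?thesis by (simp add: \<omega>_def v_minus im_sa)
  qed
  have sa_mult: "\<omega> (z * x) = \<omega> z * \<omega> x" if z: "star z = z" "central z" for z x
  proof -
    have sa: "star (z * y) = z * y" if "star y = y" for y
      using z that centralD[OF z(2), of y] by (simp add: star_mult)
    have "\<omega> (z * x) = \<omega> (z * re x + \<i> *\<^sub>C (z * im x))"
      by (subst decomp[of x]) (simp add: distrib_left mult_scaleC_right)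
    also have "\<dots> = complex_of_real (v z * v (re x)) + \<i> * complex_of_real (v z * v (im x))"
      by (simp add: \<omega>_add \<omega>_i \<omega>_sa sa re_sa im_sa v_central z)
    finally show ?thesis by (simp add: \<omega>_sa z \<omega>_def[of x] algebra_simps)
  qed
  have \<omega>_central: "\<omega> (z * x) = \<omega> z * \<omega> x" if z: "central z" for z x
  proof -
    have c: "central (re z)" "central (im z)"
      unfolding re_def im_def
      by (intro central_scaleR central_scaleC central_add central_diff central_star z)+
    have "\<omega> (z * x) = \<omega> (re z * x + \<i> *\<^sub>C (im z * x))"
      by (subst decomp[of z]) (simp add: distrib_right mult_scaleC_left)
    also have "\<dots> = (\<omega> (re z) + \<i> * \<omega> (im z)) * \<omega> x"
      by (simp add: \<omega>_add \<omega>_i sa_mult re_sa im_sa c algebra_simps)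
    also have "\<omega> (re z) + \<i> * \<omega> (im z) = \<omega> z" by (simp add: \<omega>_sa re_sa im_sa \<omega>_def[of z])
    finally show ?thesis .
  qed
  have "v (- (Z + d *\<^sub>R 1)) \<ge> 0"
    by (rule value_at_in[OF W(2) v]) (simp add: star_simps Z(1))
  then have vZ: "v Z < 0"
    using d(1) by (subst (asm) v_minus) (simp_all add: star_simps Z(1) v_add v_scale1)
  show thesis
  proof (rule that)
    show "central_state \<omega>"
      by unfold_locales
        (use v_scale1[of 1] in \<open>simp_all add: \<omega>_add \<omega>_scaleC \<omega>_star \<omega>_sa nonneg_star v_nonneg \<omega>_central\<close>)
    show "Re (\<omega> Z) < 0" using vZ by (simp add: \<omega>_sa Z(1))
  qed
qed

section \<open>The exponential of an operator\<close>

text \<open>A copy of the operator space on which composition is the product, so that \<^term>\<open>exp\<close> applies.\<close>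

typedef (overloaded) ('a::cstar_algebra) operator = "UNIV :: ('a \<Rightarrow>\<^sub>L 'a) set"
  by simp

setup_lifting type_definition_operator

instantiation operator :: (cstar_algebra) real_normed_algebra_1
begin

lift_definition zero_operator :: "'a operator" is 0 .
lift_definition one_operator :: "'a operator" is id_blinfun .
lift_definition plus_operator :: "'a operator \<Rightarrow> 'a operator \<Rightarrow> 'a operator" is "(+)" .
lift_definition minus_operator :: "'a operator \<Rightarrow> 'a operator \<Rightarrow> 'a operator" is "(-)" .
lift_definition uminus_operator :: "'a operator \<Rightarrow> 'a operator" is uminus .
lift_definition times_operator :: "'a operator \<Rightarrow> 'a operator \<Rightarrow> 'a operator" is "(o\<^sub>L)" .
lift_definition scaleR_operator :: "real \<Rightarrow> 'a operator \<Rightarrow> 'a operator" is scaleR .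
lift_definition norm_operator :: "'a operator \<Rightarrow> real" is norm .
definition dist_operator :: "'a operator \<Rightarrow> 'a operator \<Rightarrow> real" where "dist_operator x y = norm (x - y)"
definition sgn_operator :: "'a operator \<Rightarrow> 'a operator" where "sgn_operator x = inverse (norm x) *\<^sub>R x"
definition uniformity_operator :: "('a operator \<times> 'a operator) filter"
  where "uniformity_operator = (INF e\<in>{0 <..}. principal {(x, y). dist x y < e})"
definition open_operator :: "'a operator set \<Rightarrow> bool"
  where "open_operator U = (\<forall>x\<in>U. eventually (\<lambda>(x', y). x' = x \<longrightarrow> y \<in> U) uniformity)"

instance
proof
  fix x y z :: "'a operator" and a b :: real
  show "x + y + z = x + (y + z)" by transfer simp
  show "x + y = y + x" by transfer simp
  show "0 + x = x" by transfer simp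
  show "- x + x = 0" by transfer simp
  show "x - y = x + - y" by transfer simp
  show "a *\<^sub>R (x + y) = a *\<^sub>R x + a *\<^sub>R y" by transfer (rule scaleR_add_right)
  show "(a + b) *\<^sub>R x = a *\<^sub>R x + b *\<^sub>R x" by transfer (rule scaleR_add_left)
  show "a *\<^sub>R b *\<^sub>R x = (a * b) *\<^sub>R x" by transfer simp
  show "1 *\<^sub>R x = x" by transfer simp
  show "x * y * z = x * (y * z)" by transfer (simp add: blinfun_eqI)
  show "(x + y) * z = x * z + y * z" by transfer (simp add: blinfun_eqI plus_blinfun.rep_eq)
  show "x * (y + z) = x * y + x * z" by transfer (simp add: blinfun_eqI plus_blinfun.rep_eq blinfun.add_right)
  show "a *\<^sub>R x * y = a *\<^sub>R (x * y)" by transfer (simp add: blinfun_eqI scaleR_blinfun.rep_eq)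
  show "x * a *\<^sub>R y = a *\<^sub>R (x * y)" by transfer (simp add: blinfun_eqI scaleR_blinfun.rep_eq blinfun.scaleR_right)
  show "1 * x = x" by transfer (simp add: blinfun_eqI)
  show "x * 1 = x" by transfer (simp add: blinfun_eqI)
  show "(0::'a operator) \<noteq> 1"
    by transfer (metis blinfun.zero_left id_blinfun.rep_eq id_apply zero_neq_one)
  show "dist x y = norm (x - y)" by (rule dist_operator_def)
  show "sgn x = inverse (norm x) *\<^sub>R x" by (rule sgn_operator_def)
  show "(uniformity :: ('a operator \<times> 'a operator) filter) = (INF e\<in>{0 <..}. principal {(x, y). dist x y < e})"
    by (rule uniformity_operator_def)
  show "open U = (\<forall>x\<in>U. eventually (\<lambda>(x', y). x' = x \<longrightarrow> y \<in> U) uniformity)" for U :: "'a operator set"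
    by (rule open_operator_def)
  show "(norm x = 0) = (x = 0)" by transfer simp
  show "norm (x + y) \<le> norm x + norm y" by transfer (rule norm_triangle_ineq)
  show "norm (a *\<^sub>R x) = \<bar>a\<bar> * norm x" by transfer simp
  show "norm (x * y) \<le> norm x * norm y" by transfer (rule norm_blinfun_compose)
  show "norm (1 :: 'a operator) = 1" by transfer simp
qed

end

instance operator :: (cstar_algebra) banach
proof
  fix X :: "nat \<Rightarrow> 'a operator"
  assume X: "Cauchy X"
  have d: "dist (Rep_operator x) (Rep_operator y) = dist x y" for x y :: "'a operator"
    by (simp add: dist_norm norm_operator.rep_eq minus_operator.rep_eq)
  have "Cauchy (\<lambda>n. Rep_operator (X n))" using X by (simp add: Cauchy_def d)
  then obtain L where "(\<lambda>n. Rep_operator (X n)) \<longlonglongrightarrow> L"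
    using Cauchy_convergent convergent_def by blast
  then have "(\<lambda>n. dist (Rep_operator (X n)) L) \<longlonglongrightarrow> 0"
    by (rule tendsto_dist_iff[THEN iffD1])
  moreover have "dist (Rep_operator (X n)) L = dist (X n) (Abs_operator L)" for n
    using d[of "X n" "Abs_operator L"] by (simp add: Abs_operator_inverse)
  ultimately have "(\<lambda>n. dist (X n) (Abs_operator L)) \<longlonglongrightarrow> 0" by simp
  then have "X \<longlonglongrightarrow> Abs_operator L" by (rule tendsto_dist_iff[THEN iffD2])
  then show "convergent X" by (auto simp: convergent_def)
qed

lemma bounded_linear_Rep_operator: "bounded_linear Rep_operator"
  by (rule bounded_linear_intro[where K = 1])
    (simp_all add: plus_operator.rep_eq scaleR_operator.rep_eq norm_operator.rep_eq)

lemma Rep_operator_power: "Rep_operator (Abs_operator T ^ k) = ((\<lambda>S. T o\<^sub>L S) ^^ k) id_blinfun"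
  by (induction k) (simp_all add: one_operator.rep_eq times_operator.rep_eq Abs_operator_inverse)

lemma op_exp_eq: "op_exp T = Rep_operator (exp (Abs_operator T))"
proof -
  have "Rep_operator (exp (Abs_operator T)) = (\<Sum>k. Rep_operator (Abs_operator T ^ k /\<^sub>R fact k))"
    unfolding exp_def by (rule bounded_linear.suminf[OF bounded_linear_Rep_operator summable_exp_generic])
  then show ?thesis by (simp add: op_exp_def scaleR_operator.rep_eq Rep_operator_power)
qed

lemma Abs_operator_scaleR: "Abs_operator (r *\<^sub>R T) = r *\<^sub>R Abs_operator T"
  by (simp add: scaleR_operator.abs_eq)

lemma op_exp_0: "op_exp (0 *\<^sub>R T) = id_blinfun"
  by (simp add: op_exp_eq Abs_operator_scaleR one_operator.rep_eq del: scaleR_zero_left) (simp add: one_operator.rep_eq)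

lemma op_exp_add: "op_exp ((s + t) *\<^sub>R T) = op_exp (s *\<^sub>R T) o\<^sub>L op_exp (t *\<^sub>R T)"
proof -
  have "exp (Abs_operator ((s + t) *\<^sub>R T)) = exp (s *\<^sub>R Abs_operator T + t *\<^sub>R Abs_operator T)"
    by (simp only: Abs_operator_scaleR scaleR_left_distrib[of s t "Abs_operator T"])
  also have "\<dots> = exp (s *\<^sub>R Abs_operator T) * exp (t *\<^sub>R Abs_operator T)"
    by (rule exp_add_commuting) simp
  finally show ?thesis by (simp add: op_exp_eq Abs_operator_scaleR times_operator.rep_eq)
qed

lemma norm_op_exp_le: "norm (op_exp T) \<le> exp (norm T)"
  using norm_exp[of "Abs_operator T"] by (simp add: op_exp_eq norm_operator.rep_eq Abs_operator_inverse)

lemma op_exp_has_vector_derivative_0: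
  "((\<lambda>t. op_exp (t *\<^sub>R T)) has_vector_derivative T) (at 0 within S)"
proof -
  have "((\<lambda>t. exp (t *\<^sub>R Abs_operator T)) has_vector_derivative exp (0 *\<^sub>R Abs_operator T) * Abs_operator T) (at 0 within S)"
    by (rule exp_scaleR_has_vector_derivative_right)
  from bounded_linear.has_vector_derivative[OF bounded_linear_Rep_operator this]
  show ?thesis by (simp add: op_exp_eq Abs_operator_scaleR Abs_operator_inverse)
qed

text \<open>Meant for the complex-linear and for the star-preserving maps: the partial sums of the
  series stay in the closed real subspace.\<close>

lemma op_exp_in_closed:
  assumes "closed S" and "0 \<in> S" "id_blinfun \<in> S"
    and "\<And>A B. A \<in> S \<Longrightarrow> B \<in> S \<Longrightarrow> A + B \<in> S" and "\<And>A r. A \<in> S \<Longrightarrow> r *\<^sub>R A \<in> S"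
    and "\<And>A. A \<in> S \<Longrightarrow> T o\<^sub>L A \<in> S"
  shows "op_exp T \<in> S"
proof -
  define p where "p k = ((\<lambda>A. T o\<^sub>L A) ^^ k) id_blinfun /\<^sub>R fact k" for k
  have p: "p k \<in> S" for k
  proof -
    have "((\<lambda>A. T o\<^sub>L A) ^^ k) id_blinfun \<in> S" by (induction k) (simp_all add: assms)
    then show ?thesis unfolding p_def by (rule assms(5))
  qed
  have "p = (\<lambda>k. Rep_operator (Abs_operator T ^ k /\<^sub>R fact k))"
    by (simp add: p_def fun_eq_iff scaleR_operator.rep_eq Rep_operator_power)
  then have "summable p"
    using bounded_linear.summable[OF bounded_linear_Rep_operator summable_exp_generic] by simp
  then have "(\<lambda>n. \<Sum>k<n. p k) \<longlonglongrightarrow> op_exp T"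
    unfolding op_exp_def p_def[symmetric] by (rule summable_LIMSEQ)
  moreover have "(\<Sum>k<n. p k) \<in> S" for n
    by (induction n) (simp_all add: assms p)
  ultimately show ?thesis using assms(1) by (meson closed_sequentially)
qed

section \<open>Bounded complex-linear maps\<close>

lemma B_opD: "T \<in> B_op \<Longrightarrow> T (c *\<^sub>C x) = c *\<^sub>C T x"
  by (simp add: B_op_def)

lemma B_op_add: "S \<in> B_op \<Longrightarrow> T \<in> B_op \<Longrightarrow> S + T \<in> B_op"
  by (simp add: B_op_def blinfun.add_left scaleC_add_right)

lemma B_op_scaleR: "T \<in> B_op \<Longrightarrow> r *\<^sub>R T \<in> B_op"
  by (simp add: B_op_def blinfun.scaleR_left scaleC_scaleR)

lemma B_op_diff: "S \<in> B_op \<Longrightarrow> T \<in> B_op \<Longrightarrow> S - T \<in> B_op"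
  by (simp add: B_op_def blinfun.diff_left scaleC_diff_right)

lemma B_op_mult_right: "blinfun_mult_right h \<in> B_op"
  by (simp add: B_op_def mult_scaleC_right)

lemma tendsto_blinfun_apply_const:
  assumes "(f \<longlongrightarrow> T) F" shows "((\<lambda>t. blinfun_apply (f t) x) \<longlongrightarrow> T x) F"
  by (rule blinfun.tendsto[OF assms tendsto_const])

lemma closed_B_op: "closed (B_op :: ('a::cstar_algebra \<Rightarrow>\<^sub>L 'a) set)"
proof -
  have "closed {T :: 'a \<Rightarrow>\<^sub>L 'a. T (c *\<^sub>C x) = c *\<^sub>C T x}" for c x
    by (intro closed_Collect_eq linear_continuous_on bounded_linear_compose[OF bounded_linear_scaleC]
        bounded_linear_intros)
  then have "closed (\<Inter>c x. {T :: 'a \<Rightarrow>\<^sub>L 'a. T (c *\<^sub>C x) = c *\<^sub>C T x})"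
    by (intro closed_INT ballI)
  moreover have "(\<Inter>c x. {T :: 'a \<Rightarrow>\<^sub>L 'a. T (c *\<^sub>C x) = c *\<^sub>C T x}) = B_op"
    by (auto simp: B_op_def)
  ultimately show ?thesis by simp
qed

lemma closed_star_preserving:
  "closed {T :: 'a::cstar_algebra \<Rightarrow>\<^sub>L 'a. \<forall>x. T (star x) = star (T x)}"
proof -
  have "closed {T :: 'a \<Rightarrow>\<^sub>L 'a. T (star x) = star (T x)}" for x
    by (intro closed_Collect_eq linear_continuous_on bounded_linear_compose[OF bounded_linear_star]
        bounded_linear_intros)
  then have "closed (\<Inter>x. {T :: 'a \<Rightarrow>\<^sub>L 'a. T (star x) = star (T x)})"
    by (intro closed_INT ballI)
  moreover have "(\<Inter>x. {T :: 'a \<Rightarrow>\<^sub>L 'a. T (star x) = star (T x)}) = {T. \<forall>x. blinfun_apply T (star x) = star (T x)}"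
    by auto
  ultimately show ?thesis by simp
qed

lemma tendsto_mat_form:
  assumes "(f \<longlongrightarrow> T) F"
  shows "((\<lambda>t. mat_form n (\<lambda>i j. blinfun_apply (f t) (x i j)) v) \<longlongrightarrow> mat_form n (\<lambda>i j. T (x i j)) v) F"
  unfolding mat_form_def
  by (intro tendsto_sum tendsto_mult tendsto_const tendsto_blinfun_apply_const[OF assms])

text \<open>The form vanishes as soon as the sum of the \<open>a j * v j\<close> is 0, so
  multiplication by a central element can be subtracted from a map without affecting its conditional
  positivity.\<close>

lemma mat_form_central:
  assumes "central h"
  shows "mat_form n (\<lambda>i j. h * (star (a i) * a j)) v = h * (star (\<Sum>j<n. a j * v j) * (\<Sum>j<n. a j * v j))"
proof -
  have "star (v i) * (h * (star (a i) * a j)) * v j = h * (star (a i * v i) * (a j * v j))" for i j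
    by (simp only: mult.assoc[symmetric] centralD[OF assms, of "star (v i)"] star_mult)
  then show ?thesis
    by (simp add: mat_form_def star_sum flip: sum_distrib_left sum_distrib_right)
qed

section \<open>Decompositions of the identity\<close>

text \<open>Polarization of the hypothesis at \<open>x + c *\<^sub>C star y\<close>; the values
  \<open>c = 1\<close> and \<open>c = \<i>\<close> separate the commutator of \<open>x\<close> and
  \<open>y\<close> from that of the adjoints.\<close>

lemma commutator_annihilated:
  fixes h :: "'a::cstar_algebra"
  assumes H: "\<And>x. h * (x * star x) = h * (star x * x)"
  shows "h * (x * y) = h * (y * x)"
proof -
  define A where "A = h * (x * y - y * x)"
  define B where "B = h * (star y * star x - star x * star y)"
  have e: "cnj c *\<^sub>C A + c *\<^sub>C B = 0" for c
  proof -
    define w where "w = x + c *\<^sub>C star y"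
    have "w * star w - star w * w = (x * star x - star x * x)
        + (cnj c * c) *\<^sub>C (star y * y - y * star y)
        + (cnj c *\<^sub>C (x * y - y * x) + c *\<^sub>C (star y * star x - star x * star y))"
      by (simp add: w_def star_simps algebra_simps mult_scaleC_left mult_scaleC_right scaleC_add_right
          scaleC_diff_right scaleC_scaleC)
    moreover have "h * (w * star w - star w * w) = 0" by (simp add: right_diff_distrib H)
    moreover have "h * (x * star x - star x * x) = 0" by (simp add: right_diff_distrib H)
    moreover have "h * (star y * y - y * star y) = 0" by (simp add: right_diff_distrib H)
    ultimately have "h * (cnj c *\<^sub>C (x * y - y * x) + c *\<^sub>C (star y * star x - star x * star y)) = 0"
      by (simp only: distrib_left mult_scaleC_right scaleC_zero_right add_0)
    then show ?thesis by (simp only: A_def B_def distrib_left mult_scaleC_right)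
  qed
  have "A + B = 0" using e[of 1] by simp
  moreover have "\<i> *\<^sub>C (cnj \<i> *\<^sub>C A + \<i> *\<^sub>C B) = 0" by (simp only: e scaleC_zero_right)
  then have "A - B = 0" by (simp add: scaleC_add_right scaleC_diff_right scaleC_scaleC scaleC_minus_left)
  ultimately have "2 *\<^sub>R A = 0" by (simp add: scaleR_2)
  then show ?thesis by (simp add: A_def right_diff_distrib)
qed

lemma CP_nonneg: "T \<in> CP \<Longrightarrow> nonneg x \<Longrightarrow> nonneg (T x)"
proof -
  assume T: "T \<in> CP" and "nonneg x"
  then obtain s where s: "star s = s" "x = s * s" by (auto simp: nonneg_def)
  have "nonneg (mat_form 1 (\<lambda>i j. T (star s * s)) (\<lambda>_. 1))" using T by (simp add: CP_iff)
  then show "nonneg (T x)" by (simp add: mat_form_def s)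
qed

lemma coCP_nonneg: "T \<in> coCP \<Longrightarrow> nonneg x \<Longrightarrow> nonneg (T x)"
proof -
  assume T: "T \<in> coCP" and "nonneg x"
  then obtain s where s: "star s = s" "x = s * s" by (auto simp: nonneg_def)
  have "nonneg (mat_form 1 (\<lambda>i j. T (star s * s)) (\<lambda>_. 1))" using T by (simp add: coCP_iff)
  then show "nonneg (T x)" by (simp add: mat_form_def s)
qed

lemma CP_dissipator_nonneg:
  assumes "T \<in> CP" shows "nonneg (dissipator T x x)"
proof -
  have "nonneg (mat_form 1 (\<lambda>i j. dissipator T x x) (\<lambda>_. 1))"
    by (rule dissipator_form_nonneg[of T 1 "\<lambda>_. x"]) (use assms in \<open>simp add: CP_iff\<close>)
  then show ?thesis by (simp add: mat_form_def)
qed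

text \<open>The row \<open>(star x, 1)\<close> is tested against the vector \<open>(1, - x)\<close>.
  Only the leading term differs from \<open>dissipator\<close>, by the reversed product; for two
  maps with sum the identity, this makes the sum of both expressions odd under exchange of
  \<open>x\<close> and \<open>star x\<close>.\<close>

lemma coCP_codissipator_nonneg:
  assumes "T \<in> coCP" shows "nonneg (T (x * star x) - T (star x) * x - star x * T x + star x * T 1 * x)"
proof -
  let ?a = "\<lambda>i::nat. if i = 0 then star x else 1" and ?v = "\<lambda>i::nat. if i = 0 then 1 else - x"
  have "nonneg (mat_form (Suc (Suc 0)) (\<lambda>i j. T (star (?a j) * ?a i)) ?v)" using assms by (simp add: coCP_iff)
  then show ?thesis by (simp add: mat_form_def star_minus algebra_simps)
qed

lemma identity_decomposition:
  fixes \<phi> \<psi> :: "'a::cstar_algebra \<Rightarrow>\<^sub>L 'a"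
  assumes \<phi>: "\<phi> \<in> CP" and \<psi>: "\<psi> \<in> coCP" and id: "\<phi> + \<psi> = id_blinfun"
  obtains h where "nonneg h" "nonneg (1 - h)" "central h" "\<And>x. \<phi> x = (1 - h) * x" "\<And>x. \<psi> x = h * x"
    "\<And>x y. h * (x * y) = h * (y * x)"
proof -
  have sum: "\<phi> x + \<psi> x = x" for x
    using id by (metis blinfun.add_left id_blinfun.rep_eq id_apply)
  have \<psi>_eq: "\<psi> x = x - \<phi> x" for x using sum[of x] by (simp add: eq_diff_eq add.commute)
  define D where "D x = dissipator \<phi> x x" for x
  define E where "E x = \<psi> (x * star x) - \<psi> (star x) * x - star x * \<psi> x + star x * \<psi> 1 * x" for x
  have D: "nonneg (D x)" for x unfolding D_def by (rule CP_dissipator_nonneg[OF \<phi>])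
  have E: "nonneg (E x)" for x unfolding E_def by (rule coCP_codissipator_nonneg[OF \<psi>])
  have DE: "D x + E x = \<psi> (x * star x) - \<psi> (star x * x)" for x
    by (simp add: D_def E_def dissipator_def \<psi>_eq algebra_simps)
  have "nonneg (- (D x + E x))" for x
    using nonneg_add[OF D[of "star x"] E[of "star x"]] by (simp add: DE)
  then have "D x + E x = 0" for x by (rule nonneg_antisym[OF nonneg_add[OF D E]])
  then have DE0: "E x = - D x" for x by (metis add_eq_0_iff)
  have D0: "D x = 0" for x using E[of x] unfolding DE0 by (rule nonneg_antisym[OF D])
  then have E0: "E x = 0" for x by (simp add: DE0)
  define g where "g = \<phi> 1"
  have g: "nonneg g" unfolding g_def by (rule CP_nonneg[OF \<phi>]) simp
  have gsa: "star g = g" by (rule nonneg_star[OF g])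
  have \<phi>_left: "\<phi> x = g * x" for x
  proof -
    define w where "w = \<phi> x - g * x"
    have sw: "star w = \<phi> (star x) - star x * g"
      by (simp add: w_def star_simps gsa CP_star[OF \<phi>])
    \<comment> \<open>As \<open>D x = 0\<close>, the form of \<open>\<phi>\<close> for the row
      \<open>(x, 1)\<close> has its minimum 0 at \<open>(1, - x)\<close>. Moving the vector by
      \<open>- e w\<close> in the second coordinate contributes \<open>- 2 e star w * w\<close> to
      first order, so positivity for all small \<open>e\<close> leaves only
      \<open>w = 0\<close>.\<close>
    have step: "nonneg (- (2 *\<^sub>R (star w * w)) + e *\<^sub>R (star w * g * w))" if e: "e > 0" for e
    proof -
      let ?a = "\<lambda>i::nat. if i = 0 then x else 1" and ?v = "\<lambda>i::nat. if i = 0 then 1 else - x - e *\<^sub>R w"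
      have "nonneg (mat_form (Suc (Suc 0)) (\<lambda>i j. \<phi> (star (?a i) * ?a j)) ?v)" using \<phi> by (simp add: CP_iff)
      also have "mat_form (Suc (Suc 0)) (\<lambda>i j. \<phi> (star (?a i) * ?a j)) ?v
          = D x - e *\<^sub>R (star w * (\<phi> x - g * x) + (\<phi> (star x) - star x * g) * w) + (e * e) *\<^sub>R (star w * g * w)"
        by (simp add: mat_form_def D_def dissipator_def g_def star_simps algebra_simps)
      also have "\<dots> = e *\<^sub>R (- (2 *\<^sub>R (star w * w)) + e *\<^sub>R (star w * g * w))"
        by (simp add: D0 sw[symmetric] w_def[symmetric] scaleR_2 algebra_simps)
      finally have "nonneg (e *\<^sub>R (- (2 *\<^sub>R (star w * w)) + e *\<^sub>R (star w * g * w)))" .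
      from nonneg_scaleR[OF this, of "inverse e"] show ?thesis using e by simp
    qed
    have "nonneg (- (2 *\<^sub>R (star w * w)))" by (rule nonneg_perturb[OF step])
    then have "2 *\<^sub>R (star w * w) = 0"
      by (intro nonneg_antisym[OF nonneg_scaleR[OF nonneg_star_mult]]) simp_all
    then have "w = 0" using cstar_identity[of w] by simp
    then show ?thesis by (simp add: w_def)
  qed
  \<comment> \<open>Taking adjoints in \<open>\<phi> x = g x\<close> shows that
    \<open>\<phi>\<close> is also multiplication by \<open>g\<close> from the right.\<close>
  have g_central: "g * x = x * g" for x
  proof -
    have "g * x = star (\<phi> (star x))" using CP_star[OF \<phi>, of x] \<phi>_left[of x] by simp
    then show ?thesis by (simp add: \<phi>_left star_simps gsa)
  qed
  define h where "h = 1 - g"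
  have \<psi>h: "\<psi> x = h * x" for x by (simp add: \<psi>_eq \<phi>_left h_def left_diff_distrib)
  have "h = \<psi> 1" by (simp add: \<psi>h)
  then have hn: "nonneg h" using coCP_nonneg[OF \<psi> nonneg_1] by simp
  have hc: "central h" unfolding h_def by (intro central_diff central_1 centralI g_central)
  have com: "h * (x * star x) = h * (star x * x)" for x
  proof -
    have "star x * (h * x) = h * (star x * x)" by (simp only: mult.assoc[symmetric] centralD[OF hc, of "star x"])
    then show ?thesis using E0[of x] by (simp add: E_def \<psi>h mult.assoc)
  qed
  show thesis
  proof (rule that[OF hn _ hc _ \<psi>h commutator_annihilated[OF com]])
    show "nonneg (1 - h)" using g by (simp add: h_def)
    show "\<phi> x = (1 - h) * x" for x by (simp add: h_def \<phi>_left)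
  qed
qed

section \<open>Smoothly decomposable semigroups\<close>

text \<open>The mean value inequality is applied twice, to \<open>D 1\<close> and to
  \<open>f t - t K\<close>. The constant \<open>M\<close> bounds the second derivative on [0, 1],
  where it is continuous because it has a derivative itself.\<close>

lemma smooth_halfline_taylor:
  fixes f :: "real \<Rightarrow> 'b::real_normed_vector"
  assumes "smooth_halfline f"
  obtains K M where "(f has_vector_derivative K) (at 0 within {0..})" and "M \<ge> 0"
    and "\<And>t. 0 \<le> t \<Longrightarrow> t \<le> 1 \<Longrightarrow> norm (f t - f 0 - t *\<^sub>R K) \<le> M * t\<^sup>2"
proof -
  obtain D where D0: "D 0 = f"
    and D: "\<And>k t. t \<ge> 0 \<Longrightarrow> (D k has_vector_derivative D (Suc k) t) (at t within {0..})"
    using assms unfolding smooth_halfline_def by blast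
  have D': "(D k has_vector_derivative D (Suc k) t) (at t within {0..T})" if "t \<ge> 0" for k t T
    by (rule has_vector_derivative_within_subset[OF D[OF that]]) auto
  have "continuous_on {0..1} (D 2)"
    unfolding continuous_on_eq_continuous_within
    using D'[of _ 2 1] has_vector_derivative_continuous by fastforce
  then have "bounded (D 2 ` {0..1})"
    by (intro compact_imp_bounded compact_continuous_image) auto
  then obtain M where M: "\<And>t. t \<in> {0..1} \<Longrightarrow> norm (D 2 t) \<le> M"
    unfolding bounded_iff by blast
  have M0: "M \<ge> 0" using M[of 0] norm_ge_zero[of "D 2 0"] by (meson atLeastAtMost_iff order_refl order_trans zero_le_one)
  have mvt: "norm (g t - g 0) \<le> B * t"
    if t: "t \<ge> 0" and g: "\<And>s. s \<in> {0..t} \<Longrightarrow> (g has_vector_derivative g' s) (at s within {0..t})"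
      and B: "\<And>s. s \<in> {0..t} \<Longrightarrow> norm (g' s) \<le> B" for g g' :: "real \<Rightarrow> 'b" and t B
  proof -
    have "norm (g t - g 0) \<le> B * norm (t - 0)"
    proof (rule differentiable_bound[where S = "{0..t}" and f' = "\<lambda>s h. h *\<^sub>R g' s"])
      fix s assume s: "s \<in> {0..t}"
      show "(g has_derivative (\<lambda>h. h *\<^sub>R g' s)) (at s within {0..t})"
        using g[OF s] by (simp add: has_vector_derivative_def)
      show "onorm (\<lambda>h. h *\<^sub>R g' s) \<le> B"
      proof (rule onorm_le)
        fix h show "norm (h *\<^sub>R g' s) \<le> B * norm h"
          using mult_left_mono[OF B[OF s], of "\<bar>h\<bar>"] by (simp add: mult.commute)
      qed
    qed (use t in auto)
    then show ?thesis using t by simp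
  qed
  have D1: "norm (D 1 t - D 1 0) \<le> M * t" if "0 \<le> t" "t \<le> 1" for t
  proof (rule mvt[OF that(1)])
    fix s assume "s \<in> {0..t}"
    then show "(D 1 has_vector_derivative D 2 s) (at s within {0..t})"
      using D'[of s 1 t] by (simp add: numeral_2_eq_2)
    show "norm (D 2 s) \<le> M" using M[of s] \<open>s \<in> {0..t}\<close> that by simp
  qed
  show thesis
  proof (rule that)
    show "(f has_vector_derivative D 1 0) (at 0 within {0..})" using D[of 0 0] by (simp add: D0)
    show "M \<ge> 0" by (rule M0)
    fix t :: real assume t: "0 \<le> t" "t \<le> 1"
    have "norm ((f t - t *\<^sub>R D 1 0) - (f 0 - 0 *\<^sub>R D 1 0)) \<le> (M * t) * t"
    proof (rule mvt[OF t(1), where g' = "\<lambda>s. D 1 s - D 1 0"])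
      fix s assume s: "s \<in> {0..t}"
      have "(f has_vector_derivative D 1 s) (at s within {0..t})" using D'[of s 0 t] s by (simp add: D0)
      moreover have "((\<lambda>s. s *\<^sub>R D 1 0) has_vector_derivative 1 *\<^sub>R D 1 0) (at s within {0..t})"
        by (intro derivative_eq_intros) auto
      ultimately show "((\<lambda>s. f s - s *\<^sub>R D 1 0) has_vector_derivative D 1 s - D 1 0) (at s within {0..t})"
        using has_vector_derivative_diff by fastforce
      have "norm (D 1 s - D 1 0) \<le> M * s" using D1[of s] s t by simp
      also have "\<dots> \<le> M * t" using s M0 by (intro mult_left_mono) auto
      finally show "norm (D 1 s - D 1 0) \<le> M * t" .
    qed
    then show "norm (f t - f 0 - t *\<^sub>R D 1 0) \<le> M * t\<^sup>2"
      by (simp add: power2_eq_square algebra_simps)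
  qed
qed

text \<open>The rational cutoff \<open>G = 2 l F\<^sup>2 (l\<^sup>2 + F\<^sup>2)\<^sup>-\<^sup>1 \<le> F\<close> touches \<open>F\<close> where \<open>F\<close> takes the value \<open>l\<close>.\<close>

lemma cutoff_exists:
  fixes F :: "'a::cstar_algebra"
  assumes F: "nonneg F" and l: "l > 0"
  obtains G y where "nonneg G" "nonneg (F - G)" "norm G \<le> 2 * l"
    and "((l * l) *\<^sub>R 1 + F * F) * y = 1" "G = (2 * l) *\<^sub>R (F * F * y)"
proof -
  have Fsa: "star F = F" by (rule nonneg_star[OF F])
  have FF: "nonneg (F * F)" using Fsa unfolding nonneg_def by blast
  define P where "P = (l * l) *\<^sub>R 1 + F * F"
  have "nonneg (P - (l * l) *\<^sub>R 1)" by (simp add: P_def FF)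
  moreover have "l * l > 0" using l by simp
  ultimately obtain y where y: "P * y = 1" "y * P = 1" "nonneg y"
    "\<And>z. z * P = P * z \<Longrightarrow> z * y = y * z" by (rule nonneg_inverse) (rule that)
  have Fy: "F * y = y * F" by (rule y(4)) (simp add: P_def algebra_simps)
  have comm: "(a * b) * y = y * (a * b)" if "a * y = y * a" "b * y = y * b" for a b
    by (metis that mult.assoc)
  have FFy: "F * F * y = y * (F * F)" by (rule comm[OF Fy Fy])
  define G where "G = (2 * l) *\<^sub>R (F * F * y)"
  show thesis
  proof (rule that[of G y])
    show "nonneg G"
      unfolding G_def using l by (intro nonneg_scaleR nonneg_mult FF y(3) FFy) simp
    have "nonneg ((F - l *\<^sub>R 1) * (F - l *\<^sub>R 1))"
      unfolding nonneg_def using Fsa by (intro exI[of _ "F - l *\<^sub>R 1"]) (simp add: star_simps)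
    then have "nonneg (F * ((F - l *\<^sub>R 1) * (F - l *\<^sub>R 1)))"
      by (rule nonneg_mult[OF F]) (simp add: algebra_simps)
    then have "nonneg (y * (F * ((F - l *\<^sub>R 1) * (F - l *\<^sub>R 1))))"
    proof (rule nonneg_mult[OF y(3)])
      have c: "(F - l *\<^sub>R 1) * y = y * (F - l *\<^sub>R 1)" by (simp add: left_diff_distrib right_diff_distrib Fy)
      show "y * (F * ((F - l *\<^sub>R 1) * (F - l *\<^sub>R 1))) = F * ((F - l *\<^sub>R 1) * (F - l *\<^sub>R 1)) * y"
        by (rule comm[OF Fy comm[OF c c], symmetric])
    qed
    \<comment> \<open>The identity \<open>F (l^2 + F^2) - 2 l F^2 = F (F - l)^2\<close>, multiplied
      by the inverse \<open>y\<close> of \<open>l^2 + F^2\<close>.\<close>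
    moreover have "F - G = y * (F * ((F - l *\<^sub>R 1) * (F - l *\<^sub>R 1)))"
    proof -
      have "F - G = y * P * F - (2 * l) *\<^sub>R (y * (F * F))" by (simp add: y(2) G_def FFy)
      moreover have "(2 * l) *\<^sub>R (y * (F * F)) = l *\<^sub>R (y * (F * F)) + l *\<^sub>R (y * (F * F))"
        by (simp only: mult_2 scaleR_left_distrib)
      ultimately have "F - G = y * P * F - (l *\<^sub>R (y * (F * F)) + l *\<^sub>R (y * (F * F)))" by (simp only:)
      also have "\<dots> = y * (F * ((F - l *\<^sub>R 1) * (F - l *\<^sub>R 1)))" by (simp add: P_def algebra_simps)
      finally show ?thesis .
    qed
    ultimately show "nonneg (F - G)" by simp
    \<comment> \<open>The height bound rests on \<open>2 l - G = 2 l^3 y \<ge> 0\<close>.\<close>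
    have "(2 * l) *\<^sub>R 1 - G = (2 * l) *\<^sub>R (P * y - F * F * y)" by (simp add: y(1) G_def scaleR_diff_right)
    also have "P * y - F * F * y = (l * l) *\<^sub>R y" by (simp add: P_def algebra_simps)
    finally have "(2 * l) *\<^sub>R 1 - G = (2 * l) *\<^sub>R (l * l) *\<^sub>R y" .
    moreover have "nonneg ((2 * l) *\<^sub>R (l * l) *\<^sub>R y)" using l by (intro nonneg_scaleR y(3)) simp_all
    ultimately have "nonneg ((2 * l) *\<^sub>R 1 - G)" by simp
    with \<open>nonneg G\<close> show "norm G \<le> 2 * l" using l by (intro nonneg_norm_mono) simp_all
    show "((l * l) *\<^sub>R 1 + F * F) * y = 1" using y(1) by (simp add: P_def)
    show "G = (2 * l) *\<^sub>R (F * F * y)" by (rule G_def)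
  qed
qed

lemma nonneg_of_le_multiples:
  fixes x c :: real
  assumes "\<And>t. 0 < t \<Longrightarrow> t \<le> 1 \<Longrightarrow> - (c * t) \<le> x" shows "x \<ge> 0"
proof -
  have "((\<lambda>t. - (c * t)) \<longlongrightarrow> - (c * 0)) (at_right 0)"
    by (intro tendsto_minus tendsto_mult tendsto_const tendsto_ident_at)
  moreover have "eventually (\<lambda>t::real. - (c * t) \<le> x) (at_right 0)"
    unfolding eventually_at_right_field using assms by (intro exI[of _ 1]) auto
  ultimately have "- (c * 0) \<le> x" by (rule tendsto_upperbound) simp
  then show ?thesis by simp
qed

lemma norm_mat_form_le:
  fixes E :: "'a::cstar_algebra \<Rightarrow>\<^sub>L 'a"
  shows "norm (mat_form n (\<lambda>i j. E (x i j)) v) \<le> norm E * (\<Sum>i<n. \<Sum>j<n. norm (v i) * norm (x i j) * norm (v j))"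
proof -
  have "norm (star (v i) * E (x i j) * v j) \<le> norm E * (norm (v i) * norm (x i j) * norm (v j))" for i j
  proof -
    have "norm (star (v i) * E (x i j) * v j) \<le> norm (star (v i) * E (x i j)) * norm (v j)"
      by (rule norm_mult_ineq)
    also have "\<dots> \<le> norm (v i) * norm (E (x i j)) * norm (v j)"
      using norm_mult_ineq[of "star (v i)" "E (x i j)"] by (intro mult_right_mono) simp_all
    also have "\<dots> \<le> norm (v i) * (norm E * norm (x i j)) * norm (v j)"
      by (intro mult_right_mono mult_left_mono norm_blinfun) simp_all
    finally show ?thesis by (simp add: mult_ac)
  qed
  then show ?thesis
    unfolding mat_form_def sum_distrib_left by (intro sum_norm_le) 
qed

text \<open>
  Let \<open>\<psi>\<^sub>t = h + t K + O(t\<^sup>2)\<close> with \<open>h\<close> central.  Testing with a state \<open>\<omega>\<close> that is multiplicative on the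
  centre, there are two cases.  If \<open>\<omega> h = 0\<close>, the term of order \<open>t\<close> is positive.  If \<open>\<omega> h > 0\<close>, then \<open>\<omega>\<close> is
  a character, because \<open>h\<close> annihilates commutators, and it remains to bound \<open>\<omega> (K F)\<close> from below for
  \<open>F \<ge> 0\<close>: passing to the cutoff \<open>G\<close> of \<open>F\<close> at height \<open>\<omega> F\<close> and choosing \<open>t = \<surd>(\<omega> h)\<close>, positivity of
  \<open>\<psi>\<^sub>t\<close> gives \<open>\<omega> (K F) \<ge> - C \<surd>(\<omega> h) \<omega> F\<close>.
\<close>

lemma coCP_corrected_derivative:
  fixes \<psi> :: "real \<Rightarrow> 'a::cstar_algebra \<Rightarrow>\<^sub>L 'a" and K :: "'a \<Rightarrow>\<^sub>L 'a"
  assumes \<psi>: "\<And>t. 0 \<le> t \<Longrightarrow> t \<le> 1 \<Longrightarrow> \<psi> t \<in> coCP"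
    and \<psi>0: "\<And>x. \<psi> 0 x = h * x"
    and h: "nonneg h" "nonneg (1 - h)" "central h" "\<And>x y. h * (x * y) = h * (y * x)"
    and k: "star k = k" "k * k = h" "central k" "nonneg k"
    and K: "K \<in> B_op" "\<And>x. K (star x) = star (K x)"
    and M: "M \<ge> 0" "\<And>t. 0 \<le> t \<Longrightarrow> t \<le> 1 \<Longrightarrow> norm (\<psi> t - \<psi> 0 - t *\<^sub>R K) \<le> M * t\<^sup>2"
  shows "K + (1 + 2 * M) *\<^sub>R blinfun_mult_right k \<in> coCP"
proof -
  \<comment> \<open>In the final estimate, at \<open>t = s\<close> with \<open>s^2 = q\<close>, the
    term \<open>q l / t\<close> contributes \<open>s l\<close> and the Taylor remainder at most
    \<open>M s (2 l)\<close>, since the cutoff has norm at most \<open>2 l\<close>.\<close>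
  define C where "C = 1 + 2 * M"
  define T where "T = K + C *\<^sub>R blinfun_mult_right k"
  have T_apply: "T x = K x + C *\<^sub>R (k * x)" for x
    by (simp add: T_def blinfun.add_left blinfun.scaleR_left)
  have T_star: "T (star x) = star (T x)" for x
    by (simp add: T_apply star_simps K(2) k(1) centralD[OF k(3)])
  have T_B: "T \<in> B_op" unfolding T_def by (intro B_op_add B_op_scaleR B_op_mult_right K(1))
  define R where "R t = \<psi> t - \<psi> 0 - t *\<^sub>R K" for t
  have \<psi>_eq: "\<psi> t x = h * x + t *\<^sub>R K x + R t x" for t x
    by (simp add: R_def blinfun.diff_left blinfun.scaleR_left \<psi>0)
  have nR: "norm (R t) \<le> M * t\<^sup>2" if "0 \<le> t" "t \<le> 1" for t
    unfolding R_def by (rule M(2)[OF that])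
  have R_star: "R t (star x) = star (R t x)" if "0 \<le> t" "t \<le> 1" for t x
    using coCP_star[OF \<psi>[OF that], of x] coCP_star[OF \<psi>[of 0], of x]
    by (simp add: R_def blinfun.diff_left blinfun.scaleR_left star_simps K(2))
  have "nonneg (mat_form n (\<lambda>i j. T (star (a j) * a i)) v)" for n a v
  proof (rule ccontr)
    define Q where "Q S = mat_form n (\<lambda>i j. blinfun_apply S (star (a j) * a i)) v" for S
    assume neg: "\<not> nonneg (mat_form n (\<lambda>i j. T (star (a j) * a i)) v)"
    have Q_star: "star (Q S) = Q S" if "\<And>x. blinfun_apply S (star x) = star (S x)" for S
      unfolding Q_def by (rule mat_form_star) (simp add: hermitian_def that[symmetric] star_mult)
    obtain \<omega> where "central_state \<omega>" and neg\<omega>: "Re (\<omega> (Q T)) < 0"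
      using central_state_exists[of "Q T"] Q_star[OF T_star] neg unfolding Q_def by blast
    interpret central_state \<omega> by fact
    define q where "q = Re (\<omega> h)"
    have q: "\<omega> h = q" unfolding q_def by (rule real[OF nonneg_star[OF h(1)]])
    have q0: "q \<ge> 0" unfolding q_def by (rule nonneg[OF h(1)])
    have q1: "q \<le> 1" using nonneg[OF h(2)] by (simp add: diff one q)
    define s where "s = Re (\<omega> k)"
    have s: "\<omega> k = s" unfolding s_def by (rule real[OF k(1)])
    have s0: "s \<ge> 0" unfolding s_def by (rule nonneg[OF k(4)])
    have ss: "s * s = q"
      using central_mult[OF k(3), of k] by (simp add: k(2) q s flip: of_real_mult)
    show False
    proof (cases "q = 0")
      case True
      then have s_zero: "s = 0" using ss by simp
      define c where "c = (\<Sum>i<n. \<Sum>j<n. norm (v i) * norm (star (a j) * a i) * norm (v j))"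
      \<comment> \<open>A central factor of value 0 makes every form vanish under
        \<open>\<omega>\<close>; this removes both the zeroth-order term with \<open>h\<close> and
        the correction by \<open>k\<close>.\<close>
      have \<omega>_zero: "\<omega> (mat_form n (\<lambda>i j. z * x i j) v) = 0" if "central z" "\<omega> z = 0" for z x
      proof -
        have "star (v i) * (z * x i j) * v j = z * (star (v i) * x i j * v j)" for i j
          by (simp only: mult.assoc[symmetric] centralD[OF that(1), of "star (v i)"])
        then have "mat_form n (\<lambda>i j. z * x i j) v = z * mat_form n x v"
          by (simp add: mat_form_def sum_distrib_left)
        then show ?thesis by (simp add: central_mult[OF that(1)] that(2))
      qed
      have "- (M * c * t) \<le> Re (\<omega> (Q K))" if t: "0 < t" "t \<le> 1" for t
      proof -
        have "Q (\<psi> t) = mat_form n (\<lambda>i j. h * (star (a j) * a i)) v + t *\<^sub>R Q K + Q (R t)"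
          by (simp add: Q_def \<psi>_eq mat_form_add mat_form_scaleR)
        then have "\<omega> (Q (\<psi> t)) = t * \<omega> (Q K) + \<omega> (Q (R t))"
          using True q by (simp add: add scaleR \<omega>_zero[OF h(3)])
        moreover have "Re (\<omega> (Q (\<psi> t))) \<ge> 0"
          using t \<psi>[of t] by (intro nonneg) (simp add: Q_def coCP_iff)
        moreover have "Re (\<omega> (Q (R t))) \<le> M * t\<^sup>2 * c"
        proof -
          have "Re (\<omega> (Q (R t))) \<le> norm (Q (R t))"
            using t by (intro bound Q_star R_star) simp_all
          also have "\<dots> \<le> norm (R t) * c"
            unfolding Q_def c_def by (rule norm_mat_form_le)
          also have "\<dots> \<le> M * t\<^sup>2 * c"
            using nR[of t] t by (intro mult_right_mono) (auto simp: c_def intro!: sum_nonneg)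
          finally show ?thesis .
        qed
        ultimately have "t * (Re (\<omega> (Q K)) + M * c * t) \<ge> 0"
          by (simp add: power2_eq_square algebra_simps)
        then show ?thesis using t by (simp add: zero_le_mult_iff)
      qed
      then have "Re (\<omega> (Q K)) \<ge> 0" by (rule nonneg_of_le_multiples)
      moreover have "Q T = Q K + C *\<^sub>R mat_form n (\<lambda>i j. k * (star (a j) * a i)) v"
        by (simp add: Q_def T_apply mat_form_add mat_form_scaleR)
      then have "\<omega> (Q T) = \<omega> (Q K)"
        using s_zero s by (simp add: add scaleR \<omega>_zero[OF k(3)])
      ultimately show False using neg\<omega> by simp
    next
      case False
      then have qpos: "q > 0" and spos: "s > 0" using q0 s0 ss by (auto simp: less_le)
      have s1: "s \<le> 1" using ss q1 s0 by (metis abs_square_le_1 abs_of_nonneg power2_eq_square)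
      \<comment> \<open>\<open>h x\<close> is central because \<open>h\<close> annihilates
        commutators. So \<open>\<omega> (h x y)\<close> factors in two ways, and
        \<open>\<omega> h > 0\<close> can be cancelled.\<close>
      have mult: "\<omega> (x * y) = \<omega> x * \<omega> y" for x y
      proof -
        have "central (h * x)"
        proof (rule centralI)
          fix u
          have "h * x * u = h * (u * x)" by (simp only: mult.assoc h(4)[of x u])
          also have "\<dots> = u * (h * x)" by (simp only: mult.assoc[symmetric] centralD[OF h(3), of u])
          finally show "h * x * u = u * (h * x)" .
        qed
        then have "\<omega> (h * x * y) = \<omega> h * \<omega> x * \<omega> y" by (simp add: central_mult[OF h(3)] central_mult)
        moreover have "\<omega> (h * x * y) = \<omega> h * \<omega> (x * y)" by (simp add: mult.assoc central_mult[OF h(3)])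
        ultimately show ?thesis using qpos by (simp add: q)
      qed
      have lower: "- (q * g / t + M * t * norm G) \<le> Re (\<omega> (K G))"
        if G: "nonneg G" "\<omega> G = complex_of_real g" and t: "0 < t" "t \<le> 1" for G g t
      proof -
        have Gsa: "star G = G" by (rule nonneg_star[OF G(1)])
        have "Re (\<omega> (\<psi> t G)) \<ge> 0" using t by (intro nonneg coCP_nonneg[OF \<psi> G(1)]) simp_all
        moreover have "\<omega> (\<psi> t G) = complex_of_real (q * g) + complex_of_real t * \<omega> (K G) + \<omega> (R t G)"
          by (simp add: \<psi>_eq add scaleR mult q G(2))
        moreover have "Re (\<omega> (R t G)) \<le> M * t\<^sup>2 * norm G"
        proof -
          have "star (R t G) = R t G" using R_star[of t G] t Gsa by simp
          then have "Re (\<omega> (R t G)) \<le> norm (R t G)" by (rule bound)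
          also have "\<dots> \<le> norm (R t) * norm G" by (rule norm_blinfun)
          also have "\<dots> \<le> M * t\<^sup>2 * norm G" using nR[of t] t by (intro mult_right_mono) simp_all
          finally show ?thesis .
        qed
        ultimately have "0 \<le> q * g + t * Re (\<omega> (K G)) + M * t\<^sup>2 * norm G" by simp
        also have "\<dots> = t * ((q * g / t + M * t * norm G) + Re (\<omega> (K G)))"
          using t by (simp add: field_simps power2_eq_square)
        finally show ?thesis using t by (simp add: zero_le_mult_iff)
      qed
      \<comment> \<open>With \<open>\<omega> G = 0\<close> the zeroth-order term disappears, and
        \<open>t\<close> can tend to 0.\<close>
      have vanish: "Re (\<omega> (K G)) \<ge> 0" if G: "nonneg G" "\<omega> G = 0" for G
      proof (rule nonneg_of_le_multiples)
        fix t :: real assume "0 < t" "t \<le> 1"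
        then show "- ((M * norm G) * t) \<le> Re (\<omega> (K G))"
          using lower[of G 0 t] G by (simp add: mult_ac)
      qed
      have KF: "Re (\<omega> (K F)) + C * s * l \<ge> 0" if F: "nonneg F" "\<omega> F = complex_of_real l" "l \<ge> 0" for F l
      proof (cases "l = 0")
        case True
        then show ?thesis using vanish[of F] F by simp
      next
        case False
        then have l: "l > 0" using F(3) by simp
        obtain G y where G: "nonneg G" "nonneg (F - G)" "norm G \<le> 2 * l"
          "((l * l) *\<^sub>R 1 + F * F) * y = 1" "G = (2 * l) *\<^sub>R (F * F * y)"
          using F(1) l by (rule cutoff_exists) (rule that)
        \<comment> \<open>The norm of \<open>F\<close> is not controlled by \<open>l\<close>. But
          the character sends \<open>y\<close> to \<open>1 / (2 l^2)\<close> and hence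
          \<open>G\<close> to \<open>l\<close>, the value of \<open>F\<close>: thus
          \<open>F - G\<close> falls under \<open>vanish\<close>, and only \<open>G\<close>, of norm
          at most \<open>2 l\<close>, needs the estimate \<open>lower\<close>.\<close>
        have "\<omega> (((l * l) *\<^sub>R 1 + F * F) * y) = 1" by (simp only: G(4) one)
        then have "complex_of_real (2 * (l * l)) * \<omega> y = 1"
          by (simp add: mult add scaleR one F(2))
        moreover have "\<omega> G = complex_of_real l * (complex_of_real (2 * (l * l)) * \<omega> y)"
          by (simp add: G(5) scaleR mult F(2))
        ultimately have \<omega>G: "\<omega> G = complex_of_real l" by simp
        have "Re (\<omega> (K (F - G))) \<ge> 0" using G(2) by (rule vanish) (simp add: diff F(2) \<omega>G)
        moreover have "- (q * l / s + M * s * norm G) \<le> Re (\<omega> (K G))"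
          using G(1) \<omega>G spos s1 by (rule lower)
        moreover have "q * l / s = s * l" using ss spos by (simp add: field_simps)
        moreover have "M * s * norm G \<le> M * s * (2 * l)" using G(3) M(1) s0 by (intro mult_left_mono) simp_all
        ultimately show ?thesis
          by (simp add: blinfun.diff_right diff C_def algebra_simps)
      qed
      \<comment> \<open>Under a character the outer factors \<open>v i\<close> act as scalars and
        can be moved inside, so the form of \<open>T\<close> has the value of
        \<open>T (star y * y)\<close>. This reduces the matrix case to one positive element.\<close>
      define y where "y = (\<Sum>i<n. cnj (\<omega> (v i)) *\<^sub>C a i)"
      define l where "l = Re (\<omega> (star y * y))"
      have yy: "nonneg (star y * y)" by (rule nonneg_star_mult)
      have l: "\<omega> (star y * y) = l" unfolding l_def by (rule real[OF nonneg_star[OF yy]])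
      have l0: "l \<ge> 0" unfolding l_def by (rule nonneg[OF yy])
      have "star y * y = (\<Sum>i<n. \<Sum>j<n. (cnj (\<omega> (v i)) * \<omega> (v j)) *\<^sub>C (star (a j) * a i))"
      proof -
        have "star y * y = (\<Sum>j<n. \<Sum>i<n. (cnj (\<omega> (v i)) * \<omega> (v j)) *\<^sub>C (star (a j) * a i))"
          by (simp add: y_def star_sum star_scaleC sum_product mult_scaleC_left mult_scaleC_right scaleC_scaleC)
        also have "\<dots> = (\<Sum>i<n. \<Sum>j<n. (cnj (\<omega> (v i)) * \<omega> (v j)) *\<^sub>C (star (a j) * a i))"
          by (rule sum.swap)
        finally show ?thesis .
      qed
      then have "\<omega> (T (star y * y)) = (\<Sum>i<n. \<Sum>j<n. cnj (\<omega> (v i)) * \<omega> (v j) * \<omega> (T (star (a j) * a i)))"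
        by (simp add: blinfun.sum_right sum B_opD[OF T_B] scaleC)
      also have "\<dots> = \<omega> (Q T)"
        by (simp add: Q_def mat_form_def sum mult star mult_ac)
      finally have "\<omega> (Q T) = \<omega> (K (star y * y)) + C * (s * l)"
        by (simp add: T_apply add scaleR mult s l[unfolded mult])
      then have "Re (\<omega> (Q T)) = Re (\<omega> (K (star y * y))) + C * s * l" by simp
      then show False using neg\<omega> KF[OF yy l l0] by simp
    qed
  qed
  then show ?thesis using T_B unfolding coCP_iff T_def C_def by blast
qed


section \<open>Splitting the generator of a smoothly decomposable semigroup\<close>

lemma mat_star_map_if_star_map:
  assumes "star_map T"
  shows "mat_star_map n (map_mat (blinfun_apply T))"
  unfolding mat_star_map_def
proof (intro conjI ballI allI)
  have T: "T (c *\<^sub>C x) = c *\<^sub>C T x" "T (star x) = star (T x)" for c x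
    using assms by (simp_all add: star_map_def B_op_def)
  fix X Y :: "'a mat" and c
  assume X: "X \<in> carrier_mat n n"
  show "map_mat T X \<in> carrier_mat n n" using X by simp
  show "map_mat T (mat_scaleC c X) = mat_scaleC c (map_mat T X)"
    using X by (intro eq_matI) (simp_all add: mat_scaleC_def T)
  show "map_mat T (mat_star X) = mat_star (map_mat T X)"
    using X by (intro eq_matI) (simp_all add: mat_star_def T)
  assume Y: "Y \<in> carrier_mat n n"
  show "map_mat T (X + Y) = map_mat T X + map_mat T Y"
    using X Y by (intro eq_matI) (auto simp: blinfun.add_right)
qed

lemma has_vector_derivative_0_tendsto:
  fixes f :: "real \<Rightarrow> 'b::real_normed_vector"
  assumes "(f has_vector_derivative K) (at 0 within {0..})"
  shows "((\<lambda>t. inverse t *\<^sub>R (f t - f 0)) \<longlongrightarrow> K) (at_right 0)"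
proof -
  have "(f has_vector_derivative K) (at 0 within {0<..})"
    by (rule has_vector_derivative_within_subset[OF assms]) auto
  then have "((\<lambda>t. norm (f t - f 0 - (t - 0) *\<^sub>R K) / norm (t - 0)) \<longlongrightarrow> 0) (at_right 0)"
    unfolding has_vector_derivative_def has_derivative_iff_norm by blast
  moreover have "eventually (\<lambda>t. norm (f t - f 0 - (t - 0) *\<^sub>R K) / norm (t - 0)
      = norm (inverse t *\<^sub>R (f t - f 0) - K)) (at_right 0)"
  proof (rule eventually_mono[OF eventually_at_right_less[of 0]])
    fix t :: real assume t: "0 < t"
    have "inverse t *\<^sub>R (f t - f 0) - K = inverse t *\<^sub>R (f t - f 0 - (t - 0) *\<^sub>R K)"
      using t by (simp add: scaleR_diff_right)
    then show "norm (f t - f 0 - (t - 0) *\<^sub>R K) / norm (t - 0) = norm (inverse t *\<^sub>R (f t - f 0) - K)"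
      using t by (simp add: divide_inverse mult.commute)
  qed
  ultimately have "((\<lambda>t. norm (inverse t *\<^sub>R (f t - f 0) - K)) \<longlongrightarrow> 0) (at_right 0)"
    by (rule Lim_transform_eventually)
  then show ?thesis by (rule LIM_zero_cancel[OF tendsto_norm_zero_cancel])
qed

theorem smoothly_decomposable_generator:
  fixes L :: "'a::cstar_algebra \<Rightarrow>\<^sub>L 'a"
  assumes "smoothly_decomposable (\<lambda>t. op_exp (t *\<^sub>R L))"
  obtains L1 L2 where "L1 \<in> B_op" "L2 \<in> coCP" "L = L1 + L2" "star_map L1"
    "\<And>n. dissipation_ineq n (map_mat (blinfun_apply L1))"
proof -
  obtain \<phi> \<psi> where smooth: "smooth_halfline \<phi>" "smooth_halfline \<psi>"
    and CP: "\<And>t. t \<ge> 0 \<Longrightarrow> \<phi> t \<in> CP" and coCP: "\<And>t. t \<ge> 0 \<Longrightarrow> \<psi> t \<in> coCP"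
    and decomp: "\<And>t. t \<ge> 0 \<Longrightarrow> op_exp (t *\<^sub>R L) = \<phi> t + \<psi> t"
    using assms unfolding smoothly_decomposable_def by blast
  have "\<phi> 0 + \<psi> 0 = id_blinfun" using decomp[of 0] by (simp only: op_exp_0) 
  then obtain h where h: "nonneg h" "nonneg (1 - h)" "central h" "\<And>x. \<phi> 0 x = (1 - h) * x"
      "\<And>x. \<psi> 0 x = h * x" "\<And>x y. h * (x * y) = h * (y * x)"
    using identity_decomposition[OF CP[OF order_refl] coCP[OF order_refl]] by metis
  obtain k where k: "nonneg k" "star k = k" "k * k = h" "\<And>x. x * h = h * x \<Longrightarrow> x * k = k * x"
    using h(1) by (rule nonneg_sqrt) (rule that)
  have kc: "central k"
    by (rule centralI) (rule k(4)[symmetric], rule centralD[OF h(3), symmetric])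
  obtain K' N where K': "(\<phi> has_vector_derivative K') (at 0 within {0..})"
    using smooth(1) by (rule smooth_halfline_taylor)
  obtain K M where K: "(\<psi> has_vector_derivative K) (at 0 within {0..})" and M: "M \<ge> 0"
    "\<And>t. 0 \<le> t \<Longrightarrow> t \<le> 1 \<Longrightarrow> norm (\<psi> t - \<psi> 0 - t *\<^sub>R K) \<le> M * t\<^sup>2"
    using smooth(2) by (rule smooth_halfline_taylor) (rule that)
  let ?S = "{T :: 'a \<Rightarrow>\<^sub>L 'a. \<forall>x. T (star x) = star (T x)}"
  \<comment> \<open>Complex linearity and compatibility with the involution define closed real
    subspaces, which contain the limit of the difference quotients.\<close>
  have deriv_closed: "D \<in> B_op \<and> (\<forall>x. D (star x) = star (D x))"
    if "(f has_vector_derivative D) (at 0 within {0..})"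
      and "\<And>t. t \<ge> 0 \<Longrightarrow> f t \<in> B_op \<and> (\<forall>x. f t (star x) = star (f t x))" for f and D :: "'a \<Rightarrow>\<^sub>L 'a"
  proof -
    have ev: "eventually (\<lambda>t. inverse t *\<^sub>R (f t - f 0) \<in> B_op \<inter> ?S) (at_right 0)"
    proof (rule eventually_mono[OF eventually_at_right_less[of 0]])
      fix t :: real assume "0 < t"
      then show "inverse t *\<^sub>R (f t - f 0) \<in> B_op \<inter> ?S"
        using that(2)[of t] that(2)[of 0]
        by (auto simp: blinfun.scaleR_left blinfun.diff_left star_simps intro!: B_op_scaleR B_op_diff)
    qed
    have "D \<in> B_op \<inter> ?S"
      by (rule Lim_in_closed_set[OF closed_Int[OF closed_B_op closed_star_preserving] ev _
            has_vector_derivative_0_tendsto[OF that(1)]]) simp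
    then show ?thesis by simp
  qed
  have K'_prop: "K' \<in> B_op" "K' (star x) = star (K' x)" for x
    using deriv_closed[OF K'] CP CP_star[OF CP] by (auto simp: CP_def)
  have K_prop: "K \<in> B_op" "K (star x) = star (K x)" for x
    using deriv_closed[OF K] coCP coCP_star[OF coCP] by (auto simp: coCP_def)
  define C where "C = 1 + 2 * M"
  define L1 where "L1 = K' - C *\<^sub>R blinfun_mult_right k"
  define L2 where "L2 = K + C *\<^sub>R blinfun_mult_right k"
  have L1_apply: "L1 x = K' x - C *\<^sub>R (k * x)" for x
    by (simp add: L1_def blinfun.diff_left blinfun.scaleR_left)
  have L2: "L2 \<in> coCP"
    unfolding L2_def C_def
    by (rule coCP_corrected_derivative[OF coCP h(5) h(1,2,3,6) k(2,3) kc k(1) K_prop M])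
  have L1_B: "L1 \<in> B_op"
    unfolding L1_def by (intro B_op_diff B_op_scaleR B_op_mult_right K'_prop)
  have "star_map L1"
    unfolding star_map_def
    by (simp add: L1_B L1_apply K'_prop star_simps k(2) centralD[OF kc])
  moreover have "L = L1 + L2"
  proof -
    have "((\<lambda>t. \<phi> t + \<psi> t) has_vector_derivative K' + K) (at 0 within {0..})"
      by (rule has_vector_derivative_add[OF K' K])
    then have "((\<lambda>t. op_exp (t *\<^sub>R L)) has_vector_derivative K' + K) (at 0 within {0..})"
      by (rule has_vector_derivative_transform[rotated 2]) (simp_all add: decomp)
    from has_vector_derivative_0_tendsto[OF this]
      has_vector_derivative_0_tendsto[OF op_exp_has_vector_derivative_0[of L]]
    have "K' + K = L" by (rule tendsto_unique[rotated]) simp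
    then show ?thesis by (simp add: L1_def L2_def)
  qed
  moreover have "\<forall>n. dissipation_ineq n (map_mat (blinfun_apply L1))"
    unfolding dissipation_ineq_iff
  proof (intro allI, rule dissipator_form_nonneg)
    fix n and a v :: "nat \<Rightarrow> 'a"
    assume 0: "(\<Sum>i<n. a i * v i) = 0"
    \<comment> \<open>On vectors with sum 0 the forms of both central multiplications vanish, by
      \<open>k\<close> and by \<open>1 - h\<close>, the latter being \<open>\<phi> 0\<close>. What
      remains is a limit of forms of \<open>\<phi> t\<close> divided by \<open>t\<close>.\<close>
    have "mat_form n (\<lambda>i j. L1 (star (a i) * a j)) v
        = mat_form n (\<lambda>i j. K' (star (a i) * a j)) v - C *\<^sub>R mat_form n (\<lambda>i j. k * (star (a i) * a j)) v"
      by (simp add: L1_apply mat_form_diff mat_form_scaleR)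
    then have "mat_form n (\<lambda>i j. L1 (star (a i) * a j)) v = mat_form n (\<lambda>i j. K' (star (a i) * a j)) v"
      by (simp add: mat_form_central[OF kc] 0)
    moreover have "nonneg (mat_form n (\<lambda>i j. K' (star (a i) * a j)) v)"
    proof (rule nonneg_limit[OF tendsto_mat_form[OF has_vector_derivative_0_tendsto[OF K']]])
      show "eventually (\<lambda>t. nonneg (mat_form n
          (\<lambda>i j. (inverse t *\<^sub>R (\<phi> t - \<phi> 0)) (star (a i) * a j)) v)) (at_right 0)"
      proof (rule eventually_mono[OF eventually_at_right_less[of 0]])
        fix t :: real assume t: "0 < t"
        have "central (1 - h)" by (intro central_diff central_1 h)
        then have "mat_form n (\<lambda>i j. \<phi> 0 (star (a i) * a j)) v = 0"
          by (simp add: h(4) mat_form_central 0)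
        then have "mat_form n (\<lambda>i j. (inverse t *\<^sub>R (\<phi> t - \<phi> 0)) (star (a i) * a j)) v
            = inverse t *\<^sub>R mat_form n (\<lambda>i j. \<phi> t (star (a i) * a j)) v"
          by (simp add: blinfun.scaleR_left blinfun.diff_left mat_form_scaleR mat_form_diff)
        moreover have "nonneg (mat_form n (\<lambda>i j. \<phi> t (star (a i) * a j)) v)"
          using CP[of t] t by (simp add: CP_iff)
        ultimately show "nonneg (mat_form n (\<lambda>i j. (inverse t *\<^sub>R (\<phi> t - \<phi> 0)) (star (a i) * a j)) v)"
          using t by (simp add: nonneg_scaleR)
      qed
    qed simp
    ultimately show "nonneg (mat_form n (\<lambda>i j. L1 (star (a i) * a j)) v)" by simp
  qed
  ultimately show thesis using L1_B L2 by (intro that[of L1 L2]) simp_all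
qed

section \<open>The generated semigroup is decomposable\<close>

text \<open>\<open>P t d\<close> is to be read as: at time \<open>t\<close> the defect of positivity
  is at most \<open>d\<close>. A step of length \<open>e\<close> multiplies the defect by
  \<open>1 + c e\<close> and adds \<open>\<eta> e\<close>, with \<open>\<eta>\<close> as small as
  desired, so the final defect is as small as desired. The step is available only for defects up to
  1, which the bound along the whole chain has to respect.\<close>

lemma discrete_gronwall:
  fixes P :: "real \<Rightarrow> real \<Rightarrow> bool" and c T :: real
  assumes P0: "P 0 0" and c: "c \<ge> 0" and T: "T \<ge> 0" and \<tau>: "\<tau> > 0"
    and mono: "\<And>t d d'. P t d \<Longrightarrow> d \<le> d' \<Longrightarrow> P t d'"
    and step: "\<And>\<eta>. \<eta> > 0 \<Longrightarrow> \<exists>e0>0. \<forall>e t d. 0 < e \<and> e < e0 \<and> 0 \<le> t \<and> t \<le> T \<and> 0 \<le> d \<and> d \<le> 1 \<and> P t d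
      \<longrightarrow> P (t + e) (d * (1 + c * e) + \<eta> * e)"
  shows "P T \<tau>"
proof (cases "T = 0")
  case True
  then show ?thesis using mono[OF P0, of \<tau>] \<tau> by simp
next
  case False
  then have T: "T > 0" using T by simp
  define b where "b = min \<tau> 1"
  have b: "b > 0" "b \<le> \<tau>" "b \<le> 1" using \<tau> by (auto simp: b_def)
  \<comment> \<open>The choice makes the final bound \<open>T \<eta> exp (c T)\<close> equal to
    \<open>b\<close>, which is at most 1 and at most \<open>\<tau>\<close>.\<close>
  define \<eta> where "\<eta> = b / (T * exp (c * T))"
  have \<eta>: "\<eta> > 0" using b T by (simp add: \<eta>_def)
  have \<eta>T: "T * \<eta> * exp (c * T) = b" using T by (simp add: \<eta>_def)
  obtain e0 where e0: "e0 > 0" and e0_step: "\<And>e t d. 0 < e \<Longrightarrow> e < e0 \<Longrightarrow> 0 \<le> t \<Longrightarrow> t \<le> T \<Longrightarrow> 0 \<le> d \<Longrightarrow> d \<le> 1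
      \<Longrightarrow> P t d \<Longrightarrow> P (t + e) (d * (1 + c * e) + \<eta> * e)"
    using step[OF \<eta>] by blast
  obtain N :: nat where N: "T / e0 < N" using reals_Archimedean2 by blast
  have N0: "N > 0" using N T e0 by (metis divide_pos_pos gr0I less_asym of_nat_0)
  define e where "e = T / N"
  have e: "e > 0" "e < e0" using N N0 T e0 by (simp_all add: e_def field_simps)
  \<comment> \<open>A closed-form majorant of the recursion: \<open>k\<close> increments
    \<open>\<eta> e\<close>, each enlarged by the full growth factor up to the present time.\<close>
  define d where "d k = real k * e * \<eta> * exp (c * (real k * e))" for k
  have ke: "real k * e \<le> T" if "k \<le> N" for k
    using that N0 T mult_right_mono[of "real k" "real N" e] e by (simp add: e_def)
  have d_le: "d k \<le> b" if "k \<le> N" for k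
  proof -
    have "d k \<le> T * \<eta> * exp (c * T)"
      unfolding d_def using ke[OF that] c \<eta> e T
      by (intro mult_mono) (auto intro: mult_left_mono)
    then show ?thesis by (simp add: \<eta>T)
  qed
  have d_ge: "d k \<ge> 0" for k unfolding d_def using e \<eta> by simp
  have "k \<le> N \<Longrightarrow> P (real k * e) (d k)" for k
  proof (induction k)
    case 0
    then show ?case using P0 by (simp add: d_def)
  next
    case (Suc k)
    have "P (real k * e + e) (d k * (1 + c * e) + \<eta> * e)"
      using Suc e d_ge[of k] d_le[of k] b ke[of k] by (intro e0_step) auto
    moreover have "d k * (1 + c * e) + \<eta> * e \<le> d (Suc k)"
    proof -
      have "d k * (1 + c * e) \<le> d k * exp (c * e)"
        using d_ge[of k] by (intro mult_left_mono exp_ge_add_one_self)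
      moreover define E where "E = exp (c * (real (Suc k) * e))"
      moreover have "c * (real (Suc k) * e) = c * (real k * e) + c * e" by (simp add: algebra_simps)
      then have "d k * exp (c * e) = real k * e * \<eta> * E"
        by (simp only: d_def E_def exp_add mult.assoc)
      moreover have "\<eta> * e * 1 \<le> \<eta> * e * E"
        unfolding E_def using \<eta> e c by (intro mult_left_mono) simp_all
      moreover have "d (Suc k) = real (Suc k) * e * \<eta> * E" by (simp only: d_def E_def)
      then have "d (Suc k) = real k * e * \<eta> * E + \<eta> * e * E" by (simp add: algebra_simps)
      ultimately show ?thesis by linarith
    qed
    ultimately have "P (real k * e + e) (d (Suc k))" by (rule mono)
    then show ?case by (simp add: algebra_simps)
  qed
  from this[of N] have "P T (d N)" using N0 by (simp add: e_def)
  then show ?thesis using d_le[of N] b by (intro mono[of T "d N" \<tau>]) simp_all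
qed

section \<open>Euler steps for dissipative and copositive generators\<close>

lemma mat_form_outer:
  "mat_form n (\<lambda>i j. star (y i) * y j) v = star (\<Sum>j<n. y j * v j) * (\<Sum>j<n. y j * v j)"
  using mat_form_central[OF central_1, of n y v] by simp

text \<open>Completing the square: \<open>s\<^sup>* s + e (s\<^sup>* w + w\<^sup>* s)\<close> is bounded below by \<open>- 2 e\<^sup>2 w\<^sup>* w\<close>, with room for
  a multiple of \<open>s\<^sup>* s\<close>.\<close>

lemma dissipative_row:
  fixes L :: "'a::cstar_algebra \<Rightarrow>\<^sub>L 'a"
  assumes star: "\<And>x. L (star x) = star (L x)"
    and diss: "nonneg (mat_form n (\<lambda>i j. dissipator L (y i) (y j)) v)"
    and e: "e \<ge> 0" "e * norm (L 1) \<le> 1 / 2"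
  shows "nonneg (mat_form n (\<lambda>i j. star (y i) * y j) v + e *\<^sub>R mat_form n (\<lambda>i j. L (star (y i) * y j)) v
    + (2 * e * e) *\<^sub>R mat_form n (\<lambda>i j. star (L (y i)) * L (y j)) v)"
proof -
  define s where "s = (\<Sum>j<n. y j * v j)"
  define w where "w = (\<Sum>j<n. L (y j) * v j)"
  define l where "l = norm (L 1)"
  define D where "D = mat_form n (\<lambda>i j. dissipator L (y i) (y j)) v"
  define p where "p = star s * s"
  define q where "q = star w * w"
  define u where "u = star s * w + star w * s"
  define b where "b = star s * L 1 * s"
  have "star w = (\<Sum>i<n. star (v i) * L (star (y i)))"
    by (simp add: w_def star_sum star_mult star)
  then have "D = mat_form n (\<lambda>i j. L (star (y i) * y j)) v - star w * s - star s * w + b"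
    by (simp add: D_def mat_form_dissipator s_def[symmetric] w_def[symmetric] b_def)
  then have form: "mat_form n (\<lambda>i j. L (star (y i) * y j)) v = D + u - b"
    by (simp add: u_def)
  \<comment> \<open>The summand \<open>p\<close> is divided into three: \<open>e l p\<close>
    dominates the term with \<open>L 1\<close>, one half completes the square, and
    \<open>(1 / 2 - e l) p\<close> is left over, which is where \<open>e l \<le> 1 / 2\<close>
    enters.\<close>
  have "star (L 1) = L 1" using star[of 1] by simp
  then have 1: "nonneg (e *\<^sub>R (l *\<^sub>R p - b))"
    unfolding p_def b_def l_def using e(1) by (intro nonneg_scaleR nonneg_conj_bound) simp_all
  have 2: "nonneg ((1 / 2 - e * l) *\<^sub>R p)"
    unfolding p_def l_def using e(2) by (intro nonneg_scaleR nonneg_star_mult) simp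
  have 3: "nonneg ((1 / 2) *\<^sub>R (star (s + (2 * e) *\<^sub>R w) * (s + (2 * e) *\<^sub>R w)))"
    by (intro nonneg_scaleR nonneg_star_mult) simp
  have sq: "(1 / 2) *\<^sub>R (star (s + (2 * e) *\<^sub>R w) * (s + (2 * e) *\<^sub>R w)) = (1 / 2) *\<^sub>R p + e *\<^sub>R u + (2 * e * e) *\<^sub>R q"
    by (simp add: p_def q_def u_def star_simps distrib_left distrib_right scaleR_add_right mult_ac)
  have "(1 / 2 - e * l) *\<^sub>R p + (1 / 2) *\<^sub>R p = ((1 / 2 - e * l) + 1 / 2) *\<^sub>R p"
    by (simp only: scaleR_left_distrib)
  also have "(1 / 2 - e * l) + 1 / 2 = 1 - e * l" by simp
  finally have half: "(1 / 2 - e * l) *\<^sub>R p + (1 / 2) *\<^sub>R p = p - (e * l) *\<^sub>R p"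
    by (simp only: scaleR_diff_left scaleR_one)
  have "p + e *\<^sub>R (D + u - b) + (2 * e * e) *\<^sub>R q
      = e *\<^sub>R D + e *\<^sub>R (l *\<^sub>R p - b) + (1 / 2 - e * l) *\<^sub>R p + ((1 / 2) *\<^sub>R p + e *\<^sub>R u + (2 * e * e) *\<^sub>R q)"
    (is "_ = ?d + ?b + ?p1 + (?p2 + ?u + ?q)")
  proof -
    have "?d + ?b + ?p1 + (?p2 + ?u + ?q) = ?d + ?b + (?p1 + ?p2) + ?u + ?q" by (simp only: add.assoc)
    then show ?thesis unfolding half by (simp add: scaleR_add_right scaleR_diff_right)
  qed
  also have "nonneg \<dots>"
    unfolding sq[symmetric] using e(1) diss by (intro nonneg_add 1 2 3 nonneg_scaleR) (simp_all add: D_def)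
  finally show ?thesis
    by (simp add: form mat_form_outer s_def[symmetric] w_def[symmetric] p_def q_def)
qed

lemma norm_nonneg_mono:
  fixes a b :: "'a::cstar_algebra"
  assumes "nonneg a" "nonneg (b - a)" shows "norm a \<le> norm b"
proof (rule nonneg_norm_mono[OF assms(1)])
  have "nonneg b" using nonneg_add[OF assms] by simp
  then have "nonneg (norm b *\<^sub>R 1 - b)" by (intro nonneg_bound nonneg_star) simp_all
  from nonneg_add[OF this assms(2)] show "nonneg (norm b *\<^sub>R 1 - a)" by simp
qed simp

text \<open>\<open>X\<close> is a sum of Gram matrices of rows, to which
  \<open>dissipative_row\<close> applies separately. Products of two entries of a row are bounded by
  the diagonal of \<open>X\<close>, so the second-order loss depends on \<open>X\<close> only
  through \<open>m\<close>. Of the three factors \<open>n\<close>, two count the entries of a matrix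
  and one counts the rows.\<close>

lemma dissipative_matrix_step:
  fixes L :: "'a::cstar_algebra \<Rightarrow>\<^sub>L 'a"
  assumes star: "\<And>x. L (star x) = star (L x)"
    and diss: "\<And>y v. nonneg (mat_form n (\<lambda>i j. dissipator L (y i) (y j)) v)"
    and e: "e \<ge> 0" "e * norm (L 1) \<le> 1 / 2"
    and X: "\<And>v. nonneg (mat_form n X v)" and m: "\<And>j. j < n \<Longrightarrow> norm (X j j) \<le> m"
  shows "nonneg (mat_form n X v + e *\<^sub>R mat_form n (\<lambda>i j. L (X i j)) v
    + (2 * e * e * (real n * (real n * (real n * ((norm L)\<^sup>2 * m))))) *\<^sub>R vec_inner n v v)"
proof -
  obtain Y where Y: "\<And>i j. i < n \<Longrightarrow> j < n \<Longrightarrow> X i j = (\<Sum>k<n. star (Y k i) * Y k j)"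
    using positive_form_gram[of n X] X by metis
  have nY: "norm (Y k i) * norm (Y k j) \<le> m" if ij: "k < n" "i < n" "j < n" for k i j
  proof -
    have sq: "norm (Y k j) * norm (Y k j) \<le> m" if "j < n" for j
    proof -
      have "X j j - star (Y k j) * Y k j = (\<Sum>l\<in>{..<n} - {k}. star (Y l j) * Y l j)"
        unfolding Y[OF that that] using ij(1) by (subst sum.remove[of _ k]) auto
      then have "nonneg (X j j - star (Y k j) * Y k j)" by (simp add: nonneg_sum nonneg_star_mult)
      then have "norm (star (Y k j) * Y k j) \<le> norm (X j j)" by (intro norm_nonneg_mono nonneg_star_mult)
      then show ?thesis using m[OF that] by (simp add: cstar_identity power2_eq_square)
    qed
    have "0 \<le> (norm (Y k i) - norm (Y k j))\<^sup>2" by simp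
    then have "2 * (norm (Y k i) * norm (Y k j)) \<le> norm (Y k i) * norm (Y k i) + norm (Y k j) * norm (Y k j)"
      by (simp add: power2_eq_square algebra_simps)
    then show ?thesis using sq[OF ij(2)] sq[OF ij(3)] by linarith
  qed
  define Q where "Q k i j = star (L (Y k i)) * L (Y k j)" for k i j
  define r where "r = real n * (real n * ((norm L)\<^sup>2 * m))"
  have row: "nonneg (mat_form n (\<lambda>i j. star (Y k i) * Y k j) v + e *\<^sub>R mat_form n (\<lambda>i j. L (star (Y k i) * Y k j)) v
      + (2 * e * e) *\<^sub>R (r *\<^sub>R vec_inner n v v))" if k: "k < n" for k
  proof -
    have "mat_norm_bound n (\<lambda>i j. - Q k i j) \<le> (\<Sum>i<n. \<Sum>j<n. (norm L)\<^sup>2 * m)"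
      unfolding mat_norm_bound_def
    proof (intro sum_mono)
      fix i j assume ij: "i \<in> {..<n}" "j \<in> {..<n}"
      have "norm (- Q k i j) \<le> norm (L (Y k i)) * norm (L (Y k j))"
        unfolding Q_def norm_minus_cancel using norm_mult_ineq[of "star (L (Y k i))" "L (Y k j)"] by simp
      also have "\<dots> \<le> (norm L * norm (Y k i)) * (norm L * norm (Y k j))"
        by (intro mult_mono norm_blinfun) simp_all
      also have "\<dots> = (norm L)\<^sup>2 * (norm (Y k i) * norm (Y k j))" by (simp add: power2_eq_square)
      also have "\<dots> \<le> (norm L)\<^sup>2 * m" using nY[OF k] ij by (intro mult_left_mono) simp_all
      finally show "norm (- Q k i j) \<le> (norm L)\<^sup>2 * m" .
    qed
    then have rb: "mat_norm_bound n (\<lambda>i j. - Q k i j) \<le> r" by (simp add: r_def)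
    have "hermitian n (\<lambda>i j. - Q k i j)" by (simp add: hermitian_def Q_def star_simps)
    from mat_form_bounded[OF this, of v]
    have "nonneg (mat_norm_bound n (\<lambda>i j. - Q k i j) *\<^sub>R vec_inner n v v - mat_form n (Q k) v)"
      by (simp add: mat_form_def sum_negf)
    from nonneg_add[OF this nonneg_scaleR[OF vec_inner_self_nonneg[of n v], of "r - mat_norm_bound n (\<lambda>i j. - Q k i j)"]]
    have "nonneg (r *\<^sub>R vec_inner n v v - mat_form n (Q k) v)" using rb by (simp add: scaleR_diff_left)
    then have "nonneg ((2 * e * e) *\<^sub>R (r *\<^sub>R vec_inner n v v - mat_form n (Q k) v))"
      using e(1) by (intro nonneg_scaleR) simp_all
    from nonneg_add[OF dissipative_row[OF star diss[of "Y k" v] e] this]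
    show ?thesis by (simp add: Q_def[abs_def] scaleR_diff_right add.assoc)
  qed
  have "nonneg (\<Sum>k<n. mat_form n (\<lambda>i j. star (Y k i) * Y k j) v + e *\<^sub>R mat_form n (\<lambda>i j. L (star (Y k i) * Y k j)) v
      + (2 * e * e) *\<^sub>R (r *\<^sub>R vec_inner n v v))"
    by (intro nonneg_sum row) simp
  also have "(\<Sum>k<n. mat_form n (\<lambda>i j. star (Y k i) * Y k j) v + e *\<^sub>R mat_form n (\<lambda>i j. L (star (Y k i) * Y k j)) v
      + (2 * e * e) *\<^sub>R (r *\<^sub>R vec_inner n v v))
    = mat_form n (\<lambda>i j. \<Sum>k<n. star (Y k i) * Y k j) v
      + e *\<^sub>R mat_form n (\<lambda>i j. L (\<Sum>k<n. star (Y k i) * Y k j)) v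
      + (real n * ((2 * e * e) * r)) *\<^sub>R vec_inner n v v"
    by (simp add: sum.distrib mat_form_sum blinfun.sum_right scaleR_sum_right sum_constant_scaleR del: sum_constant)
  also have "mat_form n (\<lambda>i j. \<Sum>k<n. star (Y k i) * Y k j) v = mat_form n X v"
    by (intro mat_form_cong) (simp add: Y)
  also have "mat_form n (\<lambda>i j. L (\<Sum>k<n. star (Y k i) * Y k j)) v = mat_form n (\<lambda>i j. L (X i j)) v"
    by (intro mat_form_cong) (simp add: Y)
  also have "real n * ((2 * e * e) * r) = 2 * e * e * (real n * (real n * (real n * ((norm L)\<^sup>2 * m))))"
    by (simp add: r_def mult_ac)
  finally show ?thesis .
qed

lemma coCP_transpose_nonneg:
  fixes T :: "'a::cstar_algebra \<Rightarrow>\<^sub>L 'a"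
  assumes T: "T \<in> coCP" and W: "\<And>v. nonneg (mat_form n W v)"
  shows "nonneg (mat_form n (\<lambda>i j. T (W j i)) v)"
proof -
  obtain Y where Y: "\<And>i j. i < n \<Longrightarrow> j < n \<Longrightarrow> W i j = (\<Sum>k<n. star (Y k i) * Y k j)"
    using positive_form_gram[of n W] W by metis
  have "mat_form n (\<lambda>i j. T (W j i)) v = (\<Sum>k<n. mat_form n (\<lambda>i j. T (star (Y k j) * Y k i)) v)"
    unfolding mat_form_sum[symmetric] by (intro mat_form_cong) (simp add: Y blinfun.sum_right)
  also have "nonneg \<dots>" using T by (intro nonneg_sum) (simp add: coCP_iff)
  finally show ?thesis .
qed

lemma mat_form_unit_bound:
  fixes T :: "'a::cstar_algebra \<Rightarrow>\<^sub>L 'a"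
  assumes "star (T 1) = T 1"
  shows "nonneg (norm (T 1) *\<^sub>R vec_inner n v v - mat_form n (\<lambda>i j. T (unit_coord j i)) v)"
proof -
  have "mat_form n (\<lambda>i j. T (unit_coord j i)) v = (\<Sum>i<n. star (v i) * T 1 * v i)"
  proof -
    have "(\<Sum>j<n. star (v i) * T (unit_coord j i) * v j) = star (v i) * T 1 * v i" if "i < n" for i
    proof -
      have "(\<Sum>j<n. star (v i) * T (unit_coord j i) * v j) = (\<Sum>j\<in>{i}. star (v i) * T (unit_coord j i) * v j)"
        using that by (intro sum.mono_neutral_right) (auto simp: unit_coord_def)
      then show ?thesis by (simp add: unit_coord_def)
    qed
    then show ?thesis by (simp add: mat_form_def)
  qed
  then have "norm (T 1) *\<^sub>R vec_inner n v v - mat_form n (\<lambda>i j. T (unit_coord j i)) v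
      = (\<Sum>i<n. norm (T 1) *\<^sub>R (star (v i) * v i) - star (v i) * T 1 * v i)"
    by (simp add: vec_inner_def scaleR_sum_right sum_subtractf)
  also have "nonneg \<dots>" by (intro nonneg_sum nonneg_conj_bound assms order_refl)
  finally show ?thesis .
qed

text \<open>Adding \<open>d\<close> times the unit matrix makes \<open>X\<close> and
  \<open>W\<close> positive, so that the dissipative step and the copositivity of \<open>L2\<close>
  apply. Removing it again costs \<open>e d (norm (L1 1) + norm (L2 1))\<close>, the growth rate of
  the defect. The bound \<open>m + 1\<close> is for the diagonal of the shifted \<open>X\<close>, as
  \<open>d \<le> 1\<close>.\<close>

lemma dissipative_copositive_step:
  fixes L1 L2 :: "'a::cstar_algebra \<Rightarrow>\<^sub>L 'a"
  assumes star: "\<And>x. L1 (star x) = star (L1 x)"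
    and diss: "\<And>y v. nonneg (mat_form n (\<lambda>i j. dissipator L1 (y i) (y j)) v)"
    and L2: "L2 \<in> coCP"
    and e: "e \<ge> 0" "e * norm (L1 1) \<le> 1 / 2"
    and d: "d \<ge> 0" "d \<le> 1"
    and X: "\<And>v. nonneg (mat_form n X v + d *\<^sub>R vec_inner n v v)"
    and W: "\<And>v. nonneg (mat_form n W v + d *\<^sub>R vec_inner n v v)"
    and m: "\<And>j. j < n \<Longrightarrow> norm (X j j) \<le> m"
    and \<rho>: "hermitian n \<rho>" "mat_norm_bound n \<rho> \<le> r"
  shows "nonneg (mat_form n (\<lambda>i j. X i j + e *\<^sub>R (L1 (X i j) + L2 (W j i)) + \<rho> i j) v
    + (d * (1 + (norm (L1 1) + norm (L2 1)) * e)
      + (2 * e * e * (real n * (real n * (real n * ((norm L1)\<^sup>2 * (m + 1))))) + r)) *\<^sub>R vec_inner n v v)"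
proof -
  let ?V = "vec_inner n v v"
  define c where "c = 2 * e * e * (real n * (real n * (real n * ((norm L1)\<^sup>2 * (m + 1)))))"
  define X' where "X' i j = X i j + d *\<^sub>R unit_coord j i" for i j
  define W' where "W' i j = W i j + d *\<^sub>R unit_coord j i" for i j
  have X'_form: "mat_form n X' u = mat_form n X u + d *\<^sub>R vec_inner n u u" for u
    unfolding X'_def by (simp add: mat_form_add mat_form_scaleR mat_form_unit)
  have W'_form: "mat_form n W' u = mat_form n W u + d *\<^sub>R vec_inner n u u" for u
    unfolding W'_def by (simp add: mat_form_add mat_form_scaleR mat_form_unit)
  have nX': "norm (X' j j) \<le> m + 1" if "j < n" for j
  proof -
    have "norm (X' j j) \<le> norm (X j j) + norm (d *\<^sub>R (unit_coord j j :: 'a))"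
      unfolding X'_def by (rule norm_triangle_ineq)
    then show ?thesis using m[OF that] d by (simp add: unit_coord_def)
  qed
  have 1: "nonneg (mat_form n X' v + e *\<^sub>R mat_form n (\<lambda>i j. L1 (X' i j)) v + c *\<^sub>R ?V)"
    unfolding c_def by (rule dissipative_matrix_step[OF star diss e _ nX']) (simp add: X'_form X)
  have "nonneg (mat_form n (\<lambda>i j. L2 (W' j i)) v)"
    by (rule coCP_transpose_nonneg[OF L2]) (simp add: W'_form W)
  then have 2: "nonneg (e *\<^sub>R mat_form n (\<lambda>i j. L2 (W' j i)) v)" by (rule nonneg_scaleR) (rule e)
  have "nonneg (norm (L1 1) *\<^sub>R ?V - mat_form n (\<lambda>i j. L1 (unit_coord j i)) v)"
    using star[of 1] by (intro mat_form_unit_bound) simp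
  then have 3: "nonneg ((e * d) *\<^sub>R (norm (L1 1) *\<^sub>R ?V - mat_form n (\<lambda>i j. L1 (unit_coord j i)) v))"
    using e d by (intro nonneg_scaleR) simp_all
  have "nonneg (norm (L2 1) *\<^sub>R ?V - mat_form n (\<lambda>i j. L2 (unit_coord j i)) v)"
    using coCP_star[OF L2, of 1] by (intro mat_form_unit_bound) simp
  then have 4: "nonneg ((e * d) *\<^sub>R (norm (L2 1) *\<^sub>R ?V - mat_form n (\<lambda>i j. L2 (unit_coord j i)) v))"
    using e d by (intro nonneg_scaleR) simp_all
  have 5: "nonneg (mat_norm_bound n \<rho> *\<^sub>R ?V + mat_form n \<rho> v)" by (rule mat_form_bounded[OF \<rho>(1)])
  have 6: "nonneg ((r - mat_norm_bound n \<rho>) *\<^sub>R ?V)"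
    using \<rho>(2) by (intro nonneg_scaleR vec_inner_self_nonneg) simp
  have L1X': "mat_form n (\<lambda>i j. L1 (X' i j)) v = mat_form n (\<lambda>i j. L1 (X i j)) v + d *\<^sub>R mat_form n (\<lambda>i j. L1 (unit_coord j i)) v"
    by (simp add: X'_def blinfun.add_right blinfun.scaleR_right mat_form_add mat_form_scaleR)
  have unit_sym: "unit_coord i j = unit_coord j i" for i j :: nat by (simp add: unit_coord_def)
  have L2W': "mat_form n (\<lambda>i j. L2 (W' j i)) v = mat_form n (\<lambda>i j. L2 (W j i)) v + d *\<^sub>R mat_form n (\<lambda>i j. L2 (unit_coord j i)) v"
    unfolding W'_def blinfun.add_right blinfun.scaleR_right mat_form_add mat_form_scaleR
    by (simp only: unit_sym)
  have "mat_form n (\<lambda>i j. X i j + e *\<^sub>R (L1 (X i j) + L2 (W j i)) + \<rho> i j) v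
    + (d * (1 + (norm (L1 1) + norm (L2 1)) * e) + (c + r)) *\<^sub>R ?V
    = (mat_form n X' v + e *\<^sub>R mat_form n (\<lambda>i j. L1 (X' i j)) v + c *\<^sub>R ?V)
      + (e *\<^sub>R mat_form n (\<lambda>i j. L2 (W' j i)) v
      + ((e * d) *\<^sub>R (norm (L1 1) *\<^sub>R ?V - mat_form n (\<lambda>i j. L1 (unit_coord j i)) v)
      + ((e * d) *\<^sub>R (norm (L2 1) *\<^sub>R ?V - mat_form n (\<lambda>i j. L2 (unit_coord j i)) v)
      + ((mat_norm_bound n \<rho> *\<^sub>R ?V + mat_form n \<rho> v) + (r - mat_norm_bound n \<rho>) *\<^sub>R ?V))))"
    unfolding X'_form L1X' L2W' mat_form_add mat_form_scaleR
    by (simp add: algebra_simps)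
  moreover have "nonneg \<dots>"
    by (intro nonneg_add[OF 1] nonneg_add[OF 2] nonneg_add[OF 3] nonneg_add[OF 4] nonneg_add[OF 5 6])
  ultimately show ?thesis unfolding c_def by (simp only:)
qed

section \<open>Estimates for the exponential, and its even and odd parts\<close>

lemma op_exp_B_op: "T \<in> B_op \<Longrightarrow> op_exp T \<in> B_op"
  by (rule op_exp_in_closed[OF closed_B_op])
    (simp_all add: B_op_add B_op_scaleR, simp_all add: B_op_def)

lemma op_exp_star:
  fixes T :: "'a::cstar_algebra \<Rightarrow>\<^sub>L 'a"
  assumes "\<And>x. T (star x) = star (T x)"
  shows "op_exp T (star x) = star (op_exp T x)"
proof -
  have "op_exp T \<in> {T. \<forall>x. blinfun_apply T (star x) = star (T x)}"
    by (rule op_exp_in_closed[OF closed_star_preserving])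
      (simp_all add: assms blinfun.add_left blinfun.scaleR_left star_simps)
  then show ?thesis by simp
qed

text \<open>Differentiability at 0 in the operator norm. The semigroup property puts the factor for
  the step \<open>e\<close> on the left, so \<open>e0\<close> does not depend on the time already
  reached.\<close>

lemma op_exp_remainder:
  assumes "\<eta> > 0"
  shows "\<exists>e0>0. \<forall>e. 0 < e \<and> e < e0 \<longrightarrow> norm (op_exp (e *\<^sub>R T) - id_blinfun - e *\<^sub>R T) \<le> \<eta> * e"
proof -
  have "((\<lambda>e. inverse e *\<^sub>R (op_exp (e *\<^sub>R T) - op_exp (0 *\<^sub>R T))) \<longlongrightarrow> T) (at_right 0)"
    by (rule has_vector_derivative_0_tendsto[OF op_exp_has_vector_derivative_0])
  then have "eventually (\<lambda>e. dist (inverse e *\<^sub>R (op_exp (e *\<^sub>R T) - op_exp (0 *\<^sub>R T))) T < \<eta>) (at_right 0)"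
    using assms by (rule tendstoD)
  then obtain e0 where e0: "e0 > 0"
    "\<And>e. 0 < e \<Longrightarrow> e < e0 \<Longrightarrow> dist (inverse e *\<^sub>R (op_exp (e *\<^sub>R T) - op_exp (0 *\<^sub>R T))) T < \<eta>"
    unfolding eventually_at_right_field by blast
  have "norm (op_exp (e *\<^sub>R T) - id_blinfun - e *\<^sub>R T) \<le> \<eta> * e" if e: "0 < e" "e < e0" for e
  proof -
    have "op_exp (e *\<^sub>R T) - id_blinfun - e *\<^sub>R T = e *\<^sub>R (inverse e *\<^sub>R (op_exp (e *\<^sub>R T) - op_exp (0 *\<^sub>R T)) - T)"
      unfolding op_exp_0 using e(1) by (simp add: scaleR_diff_right)
    then have "norm (op_exp (e *\<^sub>R T) - id_blinfun - e *\<^sub>R T)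
        = e * dist (inverse e *\<^sub>R (op_exp (e *\<^sub>R T) - op_exp (0 *\<^sub>R T))) T"
      using e(1) by (simp only: norm_scaleR dist_norm)
    also have "\<dots> \<le> e * \<eta>" using e0(2)[OF e] e(1) by (intro mult_left_mono) simp_all
    finally show ?thesis by (simp add: mult.commute)
  qed
  then show ?thesis using e0(1) by blast
qed

text \<open>\<open>E\<close> and \<open>F\<close> below are the even and the odd part of the Dyson series of \<open>exp (t (L1 + L2))\<close> in powers of \<open>L2\<close>.\<close>

theorem dissipative_generator_decomposable:
  fixes L1 L2 :: "'a::cstar_algebra \<Rightarrow>\<^sub>L 'a"
  assumes L1: "star_map L1" "\<And>n. dissipation_ineq n (map_mat (blinfun_apply L1))"
    and L2: "L2 \<in> coCP" and T: "T \<ge> 0"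
  shows "op_exp (T *\<^sub>R (L1 + L2)) \<in> decomposable"
proof -
  have L1_B: "L1 \<in> B_op" and L1_star: "L1 (star x) = star (L1 x)" for x
    using L1(1) by (simp_all add: star_map_def)
  have L2_B: "L2 \<in> B_op" using L2 by (simp add: coCP_def)
  note L2_star = coCP_star[OF L2]
  have diss: "nonneg (mat_form n (\<lambda>i j. dissipator L1 (y i) (y j)) v)" for n y v
    using L1(2) dissipation_ineq_iff[of L1] by blast
  define Up where "Up t = op_exp (t *\<^sub>R (L1 + L2))" for t
  \<comment> \<open>Reversing the sign of \<open>L2\<close> reverses the odd part, so half the sum
    and half the difference of the two semigroups give \<open>E\<close> and \<open>F\<close> without
    any series.\<close>
  define Um where "Um t = op_exp (t *\<^sub>R (L1 - L2))" for t
  define E where "E t = (1/2) *\<^sub>R (Up t + Um t)" for t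
  define F where "F t = (1/2) *\<^sub>R (Up t - Um t)" for t
  have U_B: "Up t \<in> B_op" "Um t \<in> B_op" for t
    unfolding Up_def Um_def by (intro op_exp_B_op B_op_scaleR B_op_add B_op_diff L1_B L2_B)+
  have U_star: "Up t (star x) = star (Up t x)" "Um t (star x) = star (Um t x)" for t x
    unfolding Up_def Um_def
    by (rule op_exp_star, simp add: blinfun.scaleR_left blinfun.add_left blinfun.diff_left star_simps L1_star L2_star)+
  have EF_star: "E t (star x) = star (E t x)" "F t (star x) = star (F t x)" for t x
    by (simp_all add: E_def F_def blinfun.scaleR_left blinfun.add_left blinfun.diff_left star_simps U_star)
  have EF_B: "E t \<in> B_op" "F t \<in> B_op" for t
    unfolding E_def F_def by (intro B_op_scaleR B_op_add B_op_diff U_B)+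
  define B where "B = exp (T * norm (L1 + L2)) + exp (T * norm (L1 - L2))"
  have B0: "B \<ge> 0" by (simp add: B_def)
  have U_le: "norm (Up t) \<le> B" "norm (Um t) \<le> B" if t: "0 \<le> t" "t \<le> T" for t
  proof -
    have "norm (op_exp (t *\<^sub>R L)) \<le> exp (T * norm L)" for L :: "'a \<Rightarrow>\<^sub>L 'a"
    proof -
      have "norm (op_exp (t *\<^sub>R L)) \<le> exp (norm (t *\<^sub>R L))" by (rule norm_op_exp_le)
      also have "\<dots> \<le> exp (T * norm L)" using t by (simp add: mult_right_mono)
      finally show ?thesis .
    qed
    from this[of "L1 + L2"] this[of "L1 - L2"] show "norm (Up t) \<le> B" "norm (Um t) \<le> B"
      unfolding Up_def Um_def B_def by (simp_all add: add_increasing add_increasing2)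
  qed
  have EF_le: "norm (E t) \<le> B" "norm (F t) \<le> B" if t: "0 \<le> t" "t \<le> T" for t
    using norm_triangle_ineq[of "Up t" "Um t"] norm_triangle_ineq4[of "Up t" "Um t"] U_le[OF t]
    unfolding E_def F_def by simp_all
  define Rp where "Rp e = op_exp (e *\<^sub>R (L1 + L2)) - id_blinfun - e *\<^sub>R (L1 + L2)" for e
  define Rm where "Rm e = op_exp (e *\<^sub>R (L1 - L2)) - id_blinfun - e *\<^sub>R (L1 - L2)" for e
  define RE where "RE e t = (1/2) *\<^sub>R ((Rp e o\<^sub>L Up t) + (Rm e o\<^sub>L Um t))" for e t
  define RF where "RF e t = (1/2) *\<^sub>R ((Rp e o\<^sub>L Up t) - (Rm e o\<^sub>L Um t))" for e t
  have Up_add: "Up (t + e) x = Up t x + e *\<^sub>R (L1 (Up t x) + L2 (Up t x)) + Rp e (Up t x)" for t e x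
    by (simp add: Up_def add.commute[of t e] op_exp_add Rp_def blinfun.diff_left blinfun.add_left blinfun.scaleR_left)
  have Um_add: "Um (t + e) x = Um t x + e *\<^sub>R (L1 (Um t x) - L2 (Um t x)) + Rm e (Um t x)" for t e x
    by (simp add: Um_def add.commute[of t e] op_exp_add Rm_def blinfun.diff_left blinfun.add_left blinfun.scaleR_left)
  have E_add: "E (t + e) x = E t x + e *\<^sub>R (L1 (E t x) + L2 (F t x)) + RE e t x" for t e x
    by (simp only: E_def F_def RE_def Up_add Um_add blinfun.diff_left blinfun.add_left blinfun.scaleR_left
        blinfun.diff_right blinfun.add_right blinfun.scaleR_right blinfun_apply_blinfun_compose)
      (simp add: algebra_simps)
  have F_add: "F (t + e) x = F t x + e *\<^sub>R (L1 (F t x) + L2 (E t x)) + RF e t x" for t e x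
    by (simp only: E_def F_def RF_def Up_add Um_add blinfun.diff_left blinfun.add_left blinfun.scaleR_left
        blinfun.diff_right blinfun.add_right blinfun.scaleR_right blinfun_apply_blinfun_compose)
      (simp add: algebra_simps)
  have "RE e t x = E (t + e) x - E t x - e *\<^sub>R (L1 (E t x) + L2 (F t x))"
    "RF e t x = F (t + e) x - F t x - e *\<^sub>R (L1 (F t x) + L2 (E t x))" for e t x
    by (simp_all add: E_add F_add)
  then have R_star: "RE e t (star x) = star (RE e t x)" "RF e t (star x) = star (RF e t x)" for e t x
    by (simp_all add: EF_star L1_star L2_star star_simps)
  have R_le: "norm (RE e t) \<le> g * B" "norm (RF e t) \<le> g * B"
    if t: "0 \<le> t" "t \<le> T" and g: "norm (Rp e) \<le> g" "norm (Rm e) \<le> g" for e t g :: real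
  proof -
    have g0: "g \<ge> 0" using g(1) norm_ge_zero[of "Rp e"] by linarith
    have "norm (Rp e o\<^sub>L Up t) \<le> g * B" "norm (Rm e o\<^sub>L Um t) \<le> g * B"
      by (rule order_trans[OF norm_blinfun_compose mult_mono], use g g0 U_le[OF t] in simp_all)+
    then show "norm (RE e t) \<le> g * B" "norm (RF e t) \<le> g * B"
      using norm_triangle_ineq[of "Rp e o\<^sub>L Up t" "Rm e o\<^sub>L Um t"]
        norm_triangle_ineq4[of "Rp e o\<^sub>L Up t" "Rm e o\<^sub>L Um t"]
      unfolding RE_def RF_def by simp_all
  qed
  have main: "nonneg (mat_form n (\<lambda>i j. E T (star (a i) * a j)) v) \<and> nonneg (mat_form n (\<lambda>i j. F T (star (a j) * a i)) v)"
    for n a v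
  proof -
    define X where "X t i j = E t (star (a i) * a j)" for t and i j :: nat
    \<comment> \<open>The indices are exchanged so that positivity of the form of \<open>W\<close>
      expresses copositivity of \<open>F\<close>. The transposed entry \<open>W t j i\<close> is
      \<open>F t (star (a i) * a j)\<close>, which is what \<open>L2\<close> acts on in the equation
      for \<open>X\<close>.\<close>
    define W where "W t i j = F t (star (a j) * a i)" for t and i j :: nat
    define P where "P t d \<longleftrightarrow> (\<forall>u. nonneg (mat_form n (X t) u + d *\<^sub>R vec_inner n u u)) \<and>
      (\<forall>u. nonneg (mat_form n (W t) u + d *\<^sub>R vec_inner n u u))" for t d
    have P_mono: "P t d'" if "P t d" "d \<le> d'" for t d d'
    proof -
      have "nonneg (z + d' *\<^sub>R vec_inner n u u)" if "nonneg (z + d *\<^sub>R vec_inner n u u)" for z and u :: "nat \<Rightarrow> 'a"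
        using nonneg_add[OF that nonneg_scaleR[OF vec_inner_self_nonneg[of n u], of "d' - d"]] \<open>d \<le> d'\<close>
        by (simp add: scaleR_diff_left)
      then show ?thesis using that(1) unfolding P_def by blast
    qed
    have "Up 0 = id_blinfun" "Um 0 = id_blinfun" by (simp_all only: Up_def Um_def op_exp_0)
    then have "E 0 = id_blinfun" "F 0 = 0" by (simp_all add: E_def F_def scaleR_2[symmetric])
    then have P0: "P 0 0"
      by (simp add: P_def X_def[abs_def] W_def[abs_def] mat_form_outer nonneg_star_mult)
        (simp add: mat_form_def)
    define A where "A = (\<Sum>i<n. \<Sum>j<n. norm (star (a i) * a j))"
    have A0: "A \<ge> 0" unfolding A_def by (intro sum_nonneg norm_ge_zero)
    have A': "(\<Sum>i<n. \<Sum>j<n. norm (star (a j) * a i)) = A" unfolding A_def by (rule sum.swap)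
    have A_diag: "norm (star (a j) * a j) \<le> A" if "j < n" for j
    proof -
      have "norm (star (a j) * a j) \<le> (\<Sum>i<n. norm (star (a j) * a i))"
        using that by (intro member_le_sum) auto
      also have "\<dots> \<le> A" unfolding A_def using that
        by (intro member_le_sum[of j "{..<n}" "\<lambda>j. \<Sum>i<n. norm (star (a j) * a i)"]) (auto intro: sum_nonneg)
      finally show ?thesis .
    qed
    define m where "m = B * A"
    define c0 where "c0 = real n * (real n * (real n * ((norm L1)\<^sup>2 * (m + 1))))"
    have c0: "c0 \<ge> 0" unfolding c0_def m_def using A0 B0 by simp
    define c where "c = norm (L1 1) + norm (L2 1)"
    have diag: "norm (S (star (a j) * a j)) \<le> m" if "j < n" "norm S \<le> B" for j and S :: "'a \<Rightarrow>\<^sub>L 'a"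
      unfolding m_def by (rule order_trans[OF norm_blinfun mult_mono]) (use that A_diag B0 in simp_all)
    have "P T \<tau>" if \<tau>: "\<tau> > 0" for \<tau>
    proof (rule discrete_gronwall[where P = P and c = c, OF P0 _ T \<tau> P_mono])
      show "c \<ge> 0" by (simp add: c_def)
      fix \<eta> :: real assume \<eta>: "\<eta> > 0"
      \<comment> \<open>One half of \<open>\<eta>\<close> is reserved for the remainder of the
        exponential, whose contribution is at most \<open>\<eta>1 e m\<close>; the other half covers
        the second-order loss \<open>2 e^2 c0\<close> and enters through \<open>e0\<close>.\<close>
      define \<eta>1 where "\<eta>1 = \<eta> / (2 * (m + 1))"
      have m1: "m + 1 > 0" using A0 B0 by (simp add: m_def add_nonneg_pos)
      have \<eta>1: "\<eta>1 > 0" using \<eta> m1 by (simp add: \<eta>1_def)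
      have "\<eta>1 * m \<le> \<eta>1 * (m + 1)" using \<eta>1 by simp
      also have "\<eta>1 * (m + 1) = \<eta> / 2" using m1 by (simp add: \<eta>1_def field_simps)
      finally have \<eta>1m: "\<eta>1 * m \<le> \<eta> / 2" .
      obtain e1 where e1: "e1 > 0" "\<And>e. 0 < e \<Longrightarrow> e < e1 \<Longrightarrow> norm (Rp e) \<le> \<eta>1 * e"
        using op_exp_remainder[OF \<eta>1, of "L1 + L2"] unfolding Rp_def by blast
      obtain e2 where e2: "e2 > 0" "\<And>e. 0 < e \<Longrightarrow> e < e2 \<Longrightarrow> norm (Rm e) \<le> \<eta>1 * e"
        using op_exp_remainder[OF \<eta>1, of "L1 - L2"] unfolding Rm_def by blast
      \<comment> \<open>The last of the four bounds secures
        \<open>e * norm (L1 1) \<le> 1 / 2\<close>, as the dissipative step demands.\<close>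
      define e0 where "e0 = min (min e1 e2) (min (\<eta> / (4 * (c0 + 1))) (1 / (2 * (norm (L1 1) + 1))))"
      have e0: "e0 > 0"
        using e1(1) e2(1) \<eta> c0 by (auto simp: e0_def intro!: divide_pos_pos add_nonneg_pos)
      have "P (t + e) (d * (1 + c * e) + \<eta> * e)"
        if e: "0 < e" "e < e0" and t: "0 \<le> t" "t \<le> T" and d: "0 \<le> d" "d \<le> 1" and P: "P t d" for e t d
      proof -
        have e12: "e < e1" "e < e2" and e3: "e < \<eta> / (4 * (c0 + 1))" and e4: "e < 1 / (2 * (norm (L1 1) + 1))"
          using e(2) by (simp_all add: e0_def)
        have "e * (4 * (c0 + 1)) < \<eta>" using e3 c0 by (simp add: pos_less_divide_eq)
        then have "2 * e * c0 \<le> \<eta> / 2" using e(1) by (simp add: algebra_simps)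
        then have "e * (2 * e * c0) \<le> e * (\<eta> / 2)" using e(1) by (intro mult_left_mono) simp_all
        moreover have "e * (\<eta>1 * m) \<le> e * (\<eta> / 2)" using e(1) \<eta>1m by (intro mult_left_mono) simp_all
        ultimately have small: "2 * e * e * c0 + (\<eta>1 * e) * m \<le> \<eta> * e" by (simp add: mult_ac) 
        have "0 < 2 * (norm (L1 1) + 1)" by (simp add: add_nonneg_pos)
        then have "e * (2 * (norm (L1 1) + 1)) < 1" using e4 by (simp only: pos_less_divide_eq)
        then have e5: "e * norm (L1 1) \<le> 1 / 2" using e(1) by (simp add: algebra_simps)
        have RB: "norm (RE e t) * A \<le> (\<eta>1 * e) * m" "norm (RF e t) * A \<le> (\<eta>1 * e) * m"
          using mult_right_mono[OF R_le(1)[OF t e1(2)[OF e(1) e12(1)] e2(2)[OF e(1) e12(2)]] A0]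
            mult_right_mono[OF R_le(2)[OF t e1(2)[OF e(1) e12(1)] e2(2)[OF e(1) e12(2)]] A0]
          by (simp_all add: m_def mult.assoc)
        have bound_le: "(\<Sum>i<n. \<Sum>j<n. norm (S (z i j))) \<le> norm S * (\<Sum>i<n. \<Sum>j<n. norm (z i j))"
          for S :: "'a \<Rightarrow>\<^sub>L 'a" and z
          unfolding sum_distrib_left by (intro sum_mono norm_blinfun)
        define \<rho>E where "\<rho>E i j = RE e t (star (a i) * a j)" for i j
        define \<rho>F where "\<rho>F i j = RF e t (star (a j) * a i)" for i j
        have \<rho>: "hermitian n \<rho>E" "hermitian n \<rho>F"
          by (simp_all add: hermitian_def \<rho>E_def \<rho>F_def R_star[symmetric] star_mult)
        have \<rho>_le: "mat_norm_bound n \<rho>E \<le> (\<eta>1 * e) * m" "mat_norm_bound n \<rho>F \<le> (\<eta>1 * e) * m"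
          using bound_le[of "RE e t" "\<lambda>i j. star (a i) * a j"] bound_le[of "RF e t" "\<lambda>i j. star (a j) * a i"] RB
          unfolding mat_norm_bound_def \<rho>E_def \<rho>F_def A' A_def[symmetric] by linarith+
        have PX: "nonneg (mat_form n (X t) u + d *\<^sub>R vec_inner n u u)"
          and PW: "nonneg (mat_form n (W t) u + d *\<^sub>R vec_inner n u u)" for u
          using P unfolding P_def by blast+
        have X_add: "X (t + e) = (\<lambda>i j. X t i j + e *\<^sub>R (L1 (X t i j) + L2 (W t j i)) + \<rho>E i j)"
          by (simp add: X_def W_def \<rho>E_def E_add fun_eq_iff)
        have W_add: "W (t + e) = (\<lambda>i j. W t i j + e *\<^sub>R (L1 (W t i j) + L2 (X t j i)) + \<rho>F i j)"
          by (simp add: X_def W_def \<rho>F_def F_add fun_eq_iff)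
        have "P (t + e) (d * (1 + (norm (L1 1) + norm (L2 1)) * e) + (2 * e * e * c0 + (\<eta>1 * e) * m))"
          unfolding P_def X_add W_add c0_def
          by (intro conjI allI
              dissipative_copositive_step[OF L1_star diss L2 less_imp_le[OF e(1)] e5 d PX PW _ \<rho>(1) \<rho>_le(1)]
              dissipative_copositive_step[OF L1_star diss L2 less_imp_le[OF e(1)] e5 d PW PX _ \<rho>(2) \<rho>_le(2)])
            (simp_all add: X_def W_def diag EF_le[OF t])
        then show ?thesis by (rule P_mono) (use small in \<open>simp add: c_def\<close>)
      qed
      then show "\<exists>e0>0. \<forall>e t d. 0 < e \<and> e < e0 \<and> 0 \<le> t \<and> t \<le> T \<and> 0 \<le> d \<and> d \<le> 1 \<and> P t d
          \<longrightarrow> P (t + e) (d * (1 + c * e) + \<eta> * e)"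
        using e0 by blast
    qed
    then have lim: "nonneg (mat_form n (X T) v + \<tau> *\<^sub>R vec_inner n v v)"
        "nonneg (mat_form n (W T) v + \<tau> *\<^sub>R vec_inner n v v)" if "\<tau> > 0" for \<tau>
      using that unfolding P_def by blast+
    show ?thesis
      using nonneg_perturb[OF lim(1)] nonneg_perturb[OF lim(2)] unfolding X_def[abs_def] W_def[abs_def] by blast
  qed
  have "E T \<in> CP" using EF_B main by (simp add: CP_iff)
  moreover have "F T \<in> coCP" using EF_B main by (simp add: coCP_iff)
  moreover have "op_exp (T *\<^sub>R (L1 + L2)) = E T + F T"
    unfolding E_def F_def Up_def[symmetric] scaleR_add_right[symmetric] by (simp add: scaleR_2[symmetric])
  ultimately show ?thesis unfolding decomposable_def by blast
qed

theorem theorem6: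
  shows "(\<forall>L :: 'a::cstar_algebra \<Rightarrow>\<^sub>L 'a.
            L \<in> B_op \<longrightarrow> smoothly_decomposable (\<lambda>t. op_exp (t *\<^sub>R L)) \<longrightarrow>
            (\<exists>L1 L2. L1 \<in> B_op \<and> L2 \<in> coCP \<and> L = L1 + L2 \<and>
               (\<forall>n. mat_star_map n (map_mat L1) \<and> dissipation_ineq n (map_mat L1)))) \<and>
         (\<forall>L1 L2 :: 'a \<Rightarrow>\<^sub>L 'a.
            L1 \<in> B_op \<longrightarrow> star_map L1 \<longrightarrow> (\<forall>n. dissipation_ineq n (map_mat L1)) \<longrightarrow> L2 \<in> coCP \<longrightarrow>
            (\<forall>t\<ge>0. op_exp (t *\<^sub>R (L1 + L2)) \<in> decomposable))"
proof (intro conjI allI impI)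
  fix L :: "'a \<Rightarrow>\<^sub>L 'a"
  assume "smoothly_decomposable (\<lambda>t. op_exp (t *\<^sub>R L))"
  then obtain L1 L2 where "L1 \<in> B_op" "L2 \<in> coCP" "L = L1 + L2" "star_map L1"
    "\<And>n. dissipation_ineq n (map_mat (blinfun_apply L1))"
    by (rule smoothly_decomposable_generator) (rule that)
  then show "\<exists>L1 L2. L1 \<in> B_op \<and> L2 \<in> coCP \<and> L = L1 + L2 \<and>
      (\<forall>n. mat_star_map n (map_mat L1) \<and> dissipation_ineq n (map_mat L1))"
    using mat_star_map_if_star_map by blast
next
  fix L1 L2 :: "'a \<Rightarrow>\<^sub>L 'a" and t :: real
  assume "star_map L1" "\<forall>n. dissipation_ineq n (map_mat L1)" "L2 \<in> coCP" "0 \<le> t"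
  then show "op_exp (t *\<^sub>R (L1 + L2)) \<in> decomposable"
    by (intro dissipative_generator_decomposable) simp_all
qed

end
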